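(* Suppose that: (i) $c(x,x')=(x-x')^TA(x)(x-x')$ is lower semicontinuous and there are positive constants $\rho_{\min},\rho_{\max}$ with $\rho_{\min}\le v^TA(x)v\le\rho_{\max}$ for all unit vectors $v$ and $P_0$-almost every $x\in\mathbb{R}^d$; (ii) $\ell:\mathbb{R}\to\mathbb{R}$ is convex, $\kappa:=\inf\{s\ge0:\sup_{u\in\mathbb{R}}(\ell(u)-su^2)<\infty\}$ is finite, and $E_{P_0}\|X\|^4<\infty$. Let $\beta\in B$, $\beta\neq\mathbf{0}$, and take any dual optimizer $\lambda_*(\beta)\in\arg\min_{\lambda\ge0}f_\delta(\beta,\lambda)$. Consider the worst-case problem $$\sup_{P:\,D_c(P_0,P)\le\delta}E_P[\ell(\beta^TX)].\qquad(\star)$$ Then: (a) the dual optimizer $\lambda_*(\beta)$ is strictly positive unless $\ell$ is a constant function; if $\ell$ is indeed a constant function, then any distribution in $\{P:D_c(P_0,P)\le\delta\}$ attains the supremum in $(\star)$; (b) $\lambda_*(\beta)\ge\lambda_{thr}(\beta)$ whenever $\ell$ is not a constant; (c) if $\lambda_*(\beta)>\lambda_{thr}(\beta)$, the law of $X^*:=X+\sqrt\delta\,G\,A(X)^{-1}\beta$ attains the supremum in $(\star)$ and satisfies $E[c(X,X^* )]=\delta$; here the random variable $G$ can be written as $G:=ZG_-+(1-Z)G_+$, with $G_-=\inf\Gamma^*(\beta,\lambda_*(\beta);X)$, $G_+=\sup\Gamma^*(\beta,\lambda_*(\beta);X)$, $P_0$-almost surely, and $Z$ is an independent Bernoulli random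 variable satisfying $P(Z=1)=(\overline c-1)/(\overline c-\underline c)$, where $\overline c:=E_{P_0}[G_+^2\,\beta^TA(X)^{-1}\beta]$ and $\underline c:=E_{P_0}[G_-^2\,\beta^TA(X)^{-1}\beta]$; (d) if $\lambda_*(\beta)=\lambda_{thr}(\beta)$, then a worst-case distribution attaining the supremum in $(\star)$ may not exist; (e) suppose additionally that $\ell$ is twice differentiable with $\ell''(\cdot)\le M$ for a positive constant $M$ and that $P_0$ is such that $\ell'(\beta^TX)$ is not identically $0$, for any $\beta\in B$. If $\lambda_*(\beta)>\lambda_{thr}'(\beta)$, the set $\Gamma^*(\beta,\lambda_*(\beta);x)$ is a singleton for every $x\in\mathbb{R}^d$. Then, for the random variable $G$ being the unique element in $\Gamma^*(\beta,\lambda_*(\beta);X)$, $P_0$-almost surely, the law of $X^*:=X+\sqrt\delta\,G\,A(X)^{-1}\beta$ is the only distribution that attains the supremum in $(\star)$. In addition, $E[c(X,X^* )]=\delta$.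
   Context: Let $d\ge1$, $B\subseteq\mathbb{R}^d$ a convex set, $\delta>0$, $P_0$ a Borel probability measure on $\mathbb{R}^d$, $\ell:\mathbb{R}\to\mathbb{R}$, and $A:\mathbb{R}^d\to\mathbb{S}_d^{++}$ (real symmetric positive definite $d\times d$ matrices). $E_{P_0}$ denotes expectation with $X\sim P_0$; in (c) and (e), $X\sim P_0$. The optimal transport cost is $D_c(P_0,P)=\inf_\pi E_\pi[c(X,X')]$, the infimum being over couplings $\pi$ of $P_0$ and $P$ (Borel probability measures on $\mathbb{R}^d\times\mathbb{R}^d$ with first marginal $P_0$ and second marginal $P$). Define $$F(\gamma,\beta,\lambda;x)=\ell\big(\beta^Tx+\gamma\sqrt\delta\,\beta^TA(x)^{-1}\beta\big)-\lambda\sqrt\delta\,\big(\gamma^2\beta^TA(x)^{-1}\beta-1\big),$$ $\ell_{rob}(\beta,\lambda;x)=\sup_{\gamma\in\mathbb{R}}F(\gamma,\beta,\lambda;x)$, $f_\delta(\beta,\lambda)=E_{P_0}[\ell_{rob}(\beta,\lambda;X)]$, and $$\Gamma^*(\beta,\lambda;x)=\{\gamma\in\mathbb{R}:F(\gamma,\beta,\lambda;x)=\sup_{c\in\mathbb{R}}F(c,\beta,\lambda;x)\}.$$ The set $\arg\min_{\lambda\ge0}f_\delta(\beta,\lambda)$ is nonempty for every $\beta\in B$. Thresholds: $$\lambda_{thr}(\beta)=\kappa\sqrt\delta\;P_0\text{-}\operatorname{ess\,sup}_x\,\beta^TA(x)^{-1}\beta,\qquad\lambda_{thr}'(\beta)=\tfrac12M\sqrt\delta\;P_0\text{-}\operatorname{ess\,sup}_x\,\beta^TA(x)^{-1}\beta,$$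 where $P_0\text{-}\operatorname{ess\,sup}_xh(x)=\inf\{a\in\mathbb{R}:P_0(h>a)=0\}$.
   Formalization: In (c) the inf/sup mixture is claimed only when the stated ratio is a probability (any if both constants equal 1); existence is shown with least/greatest-modulus elements of Γ*. In (e) Γ* is a singleton for x with β^T A(x)^{-1}β at most its P0-ess sup, so P0-a.e. *)

theory Defs
  imports "HOL-Probability.Probability"
begin

subsection \<open>Extended-valued expectation, lower semicontinuity, positive definiteness\<close>

text \<open>Expectation of an extended-real function as the integral of the positive part minus the
  integral of the negative part. In all uses below the negative part has a finite integral, so the
  convention \<open>\<infinity> - \<infinity> = \<infinity>\<close> of \<^typ>\<open>ereal\<close> plays no role.\<close>

definition ext_expectation :: "'a measure \<Rightarrow> ('a \<Rightarrow> ereal) \<Rightarrow> ereal" where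
  "ext_expectation M f =
     enn2ereal (\<integral>\<^sup>+ x. e2ennreal (f x) \<partial>M) - enn2ereal (\<integral>\<^sup>+ x. e2ennreal (- f x) \<partial>M)"

definition lower_semicont :: "('a::topological_space \<Rightarrow> real) \<Rightarrow> bool" where
  "lower_semicont f \<longleftrightarrow> (\<forall>z t. t < f z \<longrightarrow> (\<forall>\<^sub>F w in nhds z. t < f w))"

definition sym_pos_def :: "real^'n^'n \<Rightarrow> bool" where
  "sym_pos_def S \<longleftrightarrow> transpose S = S \<and> (\<forall>v. v \<noteq> 0 \<longrightarrow> 0 < v \<bullet> (S *v v))"

subsection \<open>Optimal transport ball and the worst-case problem\<close>

definition state_cost :: "(real^'n \<Rightarrow> real^'n^'n) \<Rightarrow> real^'n \<Rightarrow> real^'n \<Rightarrow> real" where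
  "state_cost A x x' = (x - x') \<bullet> (A x *v (x - x'))"

definition couplings ::
  "(real^'n) measure \<Rightarrow> (real^'n) measure \<Rightarrow> ((real^'n) \<times> (real^'n)) measure set" where
  "couplings P0 P = {\<pi>. prob_space \<pi> \<and> sets \<pi> = sets borel \<and>
     distr \<pi> borel fst = P0 \<and> distr \<pi> borel snd = P}"

definition transport_cost ::
  "(real^'n \<Rightarrow> real^'n^'n) \<Rightarrow> (real^'n) measure \<Rightarrow> (real^'n) measure \<Rightarrow> ennreal" where
  "transport_cost A P0 P =
     (INF \<pi>\<in>couplings P0 P. \<integral>\<^sup>+ z. ennreal (state_cost A (fst z) (snd z)) \<partial>\<pi>)"

definition transport_ball ::
  "real \<Rightarrow> (real^'n) measure \<Rightarrow> (real^'n \<Rightarrow> real^'n^'n) \<Rightarrow> (real^'n) measure set" where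
  "transport_ball \<delta> P0 A =
     {P. prob_space P \<and> sets P = sets borel \<and> transport_cost A P0 P \<le> ennreal \<delta>}"

definition expected_loss :: "(real \<Rightarrow> real) \<Rightarrow> real^'n \<Rightarrow> (real^'n) measure \<Rightarrow> ereal" where
  "expected_loss l \<beta> P = ext_expectation P (\<lambda>x. ereal (l (\<beta> \<bullet> x)))"

definition worst_case ::
  "real \<Rightarrow> (real^'n) measure \<Rightarrow> (real \<Rightarrow> real) \<Rightarrow> (real^'n \<Rightarrow> real^'n^'n) \<Rightarrow> real^'n
    \<Rightarrow> (real^'n) measure \<Rightarrow> bool" where
  "worst_case \<delta> P0 l A \<beta> P \<longleftrightarrow> P \<in> transport_ball \<delta> P0 A \<and>
     expected_loss l \<beta> P = (SUP Q\<in>transport_ball \<delta> P0 A. expected_loss l \<beta> Q)"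

subsection \<open>The dual problem\<close>

definition inv_quad :: "(real^'n \<Rightarrow> real^'n^'n) \<Rightarrow> real^'n \<Rightarrow> real^'n \<Rightarrow> real" where
  "inv_quad A \<beta> x = \<beta> \<bullet> (matrix_inv (A x) *v \<beta>)"

definition dual_F ::
  "real \<Rightarrow> (real \<Rightarrow> real) \<Rightarrow> (real^'n \<Rightarrow> real^'n^'n) \<Rightarrow> real \<Rightarrow> real^'n \<Rightarrow> real \<Rightarrow> real^'n \<Rightarrow> real" where
  "dual_F \<delta> l A \<gamma> \<beta> lam x =
     l (\<beta> \<bullet> x + \<gamma> * sqrt \<delta> * inv_quad A \<beta> x) - lam * sqrt \<delta> * (\<gamma>\<^sup>2 * inv_quad A \<beta> x - 1)"

definition loss_rob ::
  "real \<Rightarrow> (real \<Rightarrow> real) \<Rightarrow> (real^'n \<Rightarrow> real^'n^'n) \<Rightarrow> real^'n \<Rightarrow> real \<Rightarrow> real^'n \<Rightarrow> ereal" where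
  "loss_rob \<delta> l A \<beta> lam x = (SUP \<gamma>. ereal (dual_F \<delta> l A \<gamma> \<beta> lam x))"

definition dual_obj ::
  "real \<Rightarrow> (real^'n) measure \<Rightarrow> (real \<Rightarrow> real) \<Rightarrow> (real^'n \<Rightarrow> real^'n^'n) \<Rightarrow> real^'n \<Rightarrow> real \<Rightarrow> ereal" where
  "dual_obj \<delta> P0 l A \<beta> lam = ext_expectation P0 (loss_rob \<delta> l A \<beta> lam)"

definition dual_optimizer ::
  "real \<Rightarrow> (real^'n) measure \<Rightarrow> (real \<Rightarrow> real) \<Rightarrow> (real^'n \<Rightarrow> real^'n^'n) \<Rightarrow> real^'n \<Rightarrow> real \<Rightarrow> bool" where
  "dual_optimizer \<delta> P0 l A \<beta> lam \<longleftrightarrow> is_arg_min (dual_obj \<delta> P0 l A \<beta>) (\<lambda>\<mu>. 0 \<le> \<mu>) lam"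

definition Gamma_star ::
  "real \<Rightarrow> (real \<Rightarrow> real) \<Rightarrow> (real^'n \<Rightarrow> real^'n^'n) \<Rightarrow> real^'n \<Rightarrow> real \<Rightarrow> real^'n \<Rightarrow> real set" where
  "Gamma_star \<delta> l A \<beta> lam x = {\<gamma>. ereal (dual_F \<delta> l A \<gamma> \<beta> lam x) = loss_rob \<delta> l A \<beta> lam x}"

definition growth_rate :: "(real \<Rightarrow> real) \<Rightarrow> ereal" where
  "growth_rate l =
     (INF s\<in>{s::real. 0 \<le> s \<and> (SUP u. ereal (l u - s * u\<^sup>2)) < \<infinity>}. ereal s)"

text \<open>For Borel \<open>h\<close>, \<open>esssup P0 h\<close> is \<open>Inf {a. P0 (h > a) = 0}\<close>; \<open>inv_quad A \<beta>\<close> is Borel once the cost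
  is lower semicontinuous.\<close>

definition lambda_thr ::
  "real \<Rightarrow> (real^'n) measure \<Rightarrow> (real \<Rightarrow> real) \<Rightarrow> (real^'n \<Rightarrow> real^'n^'n) \<Rightarrow> real^'n \<Rightarrow> ereal" where
  "lambda_thr \<delta> P0 l A \<beta> =
     growth_rate l * ereal (sqrt \<delta>) * esssup P0 (\<lambda>x. ereal (inv_quad A \<beta> x))"

definition lambda_thr' ::
  "real \<Rightarrow> (real^'n) measure \<Rightarrow> real \<Rightarrow> (real^'n \<Rightarrow> real^'n^'n) \<Rightarrow> real^'n \<Rightarrow> ereal" where
  "lambda_thr' \<delta> P0 M A \<beta> =
     ereal (M / 2 * sqrt \<delta>) * esssup P0 (\<lambda>x. ereal (inv_quad A \<beta> x))"

subsection \<open>Standing assumptions\<close>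

definition dro_setting ::
  "(real^'n) set \<Rightarrow> real \<Rightarrow> (real^'n) measure \<Rightarrow> (real \<Rightarrow> real) \<Rightarrow> (real^'n \<Rightarrow> real^'n^'n) \<Rightarrow> bool" where
  "dro_setting B \<delta> P0 l A \<longleftrightarrow>
     convex B \<and> 0 < \<delta> \<and> prob_space P0 \<and> sets P0 = sets borel \<and>
     (\<forall>x. sym_pos_def (A x)) \<and>
     (\<forall>\<beta>\<in>B. \<exists>lam. dual_optimizer \<delta> P0 l A \<beta> lam) \<and>
     lower_semicont (\<lambda>(x, x'). state_cost A x x') \<and>
     (\<exists>\<rho>min \<rho>max. 0 < \<rho>min \<and> 0 < \<rho>max \<and>
        (AE x in P0. \<forall>v. norm v = 1 \<longrightarrow> \<rho>min \<le> v \<bullet> (A x *v v) \<and> v \<bullet> (A x *v v) \<le> \<rho>max)) \<and>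
     convex_on UNIV l \<and> growth_rate l < \<infinity> \<and>
     integrable P0 (\<lambda>x. norm x ^ 4)"

subsection \<open>Transported random variables\<close>

definition X_star ::
  "real \<Rightarrow> (real^'n \<Rightarrow> real^'n^'n) \<Rightarrow> real^'n \<Rightarrow> real^'n \<Rightarrow> real \<Rightarrow> real^'n" where
  "X_star \<delta> A \<beta> x g = x + (sqrt \<delta> * g) *\<^sub>R (matrix_inv (A x) *v \<beta>)"

definition law_X_star ::
  "real \<Rightarrow> (real^'n \<Rightarrow> real^'n^'n) \<Rightarrow> real^'n \<Rightarrow> 'w measure \<Rightarrow> ('w \<Rightarrow> real^'n) \<Rightarrow> ('w \<Rightarrow> real)
    \<Rightarrow> (real^'n) measure" where
  "law_X_star \<delta> A \<beta> M X G = distr M borel (\<lambda>\<omega>. X_star \<delta> A \<beta> (X \<omega>) (G \<omega>))"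

definition cost_X_star ::
  "real \<Rightarrow> (real^'n \<Rightarrow> real^'n^'n) \<Rightarrow> real^'n \<Rightarrow> 'w measure \<Rightarrow> ('w \<Rightarrow> real^'n) \<Rightarrow> ('w \<Rightarrow> real)
    \<Rightarrow> ennreal" where
  "cost_X_star \<delta> A \<beta> M X G =
     (\<integral>\<^sup>+ \<omega>. ennreal (state_cost A (X \<omega>) (X_star \<delta> A \<beta> (X \<omega>) (G \<omega>))) \<partial>M)"

definition second_moment ::
  "(real^'n) measure \<Rightarrow> (real^'n \<Rightarrow> real^'n^'n) \<Rightarrow> real^'n \<Rightarrow> (real^'n \<Rightarrow> real) \<Rightarrow> real" where
  "second_moment P0 A \<beta> g = (\<integral>x. (g x)\<^sup>2 * inv_quad A \<beta> x \<partial>P0)"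

text \<open>\<open>X\<close> has law \<open>P0\<close> and \<open>Z\<close> is an independent Bernoulli variable with success probability
  \<open>(c2 - 1) / (c2 - c1)\<close>, where \<open>c1\<close> and \<open>c2\<close> are the second moments of \<open>g1\<close> and \<open>g2\<close>. When
  \<open>c1 = c2 = 1\<close> the quotient is \<open>0/0\<close> and every success probability is admitted; when
  \<open>c1 = c2 \<noteq> 1\<close> none is (Isabelle's \<open>x / 0 = 0\<close> must not intervene).
  Independence is spelled out on the generated sigma-algebras because \<open>prob_space.indep_var\<close> demands
  that both variables have the same value type.\<close>

definition bernoulli_mixing ::
  "(real^'n) measure \<Rightarrow> (real^'n \<Rightarrow> real^'n^'n) \<Rightarrow> real^'n \<Rightarrow> (real^'n \<Rightarrow> real) \<Rightarrow> (real^'n \<Rightarrow> real)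
    \<Rightarrow> 'w measure \<Rightarrow> ('w \<Rightarrow> real^'n) \<Rightarrow> ('w \<Rightarrow> real) \<Rightarrow> bool" where
  "bernoulli_mixing P0 A \<beta> g1 g2 M X Z \<longleftrightarrow>
     prob_space M \<and> X \<in> borel_measurable M \<and> Z \<in> borel_measurable M \<and> distr M borel X = P0 \<and>
     prob_space.indep_set M {X -` S \<inter> space M | S. S \<in> sets borel}
       {Z -` T \<inter> space M | T. T \<in> sets borel} \<and>
     (AE \<omega> in M. Z \<omega> \<in> {0, 1}) \<and>
     (let c1 = second_moment P0 A \<beta> g1; c2 = second_moment P0 A \<beta> g2 in
        if c1 = c2 then c1 = 1
        else measure M {\<omega> \<in> space M. Z \<omega> = 1} = (c2 - 1) / (c2 - c1))"

end

theory Submission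
  imports Defs
begin

text \<open>Moving mass from \<open>x\<close> along \<open>A(x)\<^sup>-\<^sup>1 \<beta>\<close> is the cheapest way to change \<open>\<beta>\<^sup>T x\<close>, so for every coupling the
  loss at \<open>x'\<close> is at most the robustified loss at \<open>x\<close> plus a multiple of the transport cost; this is
  weak duality. It is an equality for every transport \<open>X + \<surd>\<delta> G A(X)\<^sup>-\<^sup>1 \<beta>\<close> with \<open>G \<in> \<Gamma>\<^sup>*\<close> that exhausts the
  budget, that is, \<open>E[G\<^sup>2 \<beta>\<^sup>T A(X)\<^sup>-\<^sup>1 \<beta>] = 1\<close>. Above the threshold the inner problem is coercive, uniformly
  in the multiplier, and optimality of \<open>\<lambda>\<^sub>*\<close> says that this second moment is at most \<open>1\<close> for the
  maximiser of least modulus and at least \<open>1\<close> for the one of largest modulus, so that a Bernoulli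
  mixture meets the budget. Below the threshold the robustified loss is infinite with positive
  probability. When \<open>\<ell>'' \<le> M\<close> the dual gap dominates the squared distance to the optimal transport
  map, hence almost optimal couplings of any worst-case law concentrate on the graph of that map.\<close>

subsection \<open>Convex functions and quadratic growth\<close>

text \<open>\<open>dual_F\<close> is affine in the multiplier, with slope
  \<open>- sqrt \<delta> * (\<gamma>\<^sup>2 * k - 1)\<close> for
  \<open>k = inv_quad A \<beta> x\<close>, so optimality of the multiplier sees a maximiser only
  through \<open>\<gamma>\<^sup>2\<close>. This is why existence rests on extremal moduli: infimum
  and supremum of the maximisers can share their modulus, and then no mixture of them need meet the
  budget. For the loss \<open>max 0 (\<bar>u\<bar> - 1)\<close>, \<open>P0\<close> the point mass at
  0, \<open>A\<close> the identity, a unit vector \<open>\<beta>\<close> and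
  \<open>\<delta> = 1\<close>, the optimal multiplier is 1/4 and the maximisers are -2, 0 and 2; the
  outer two both have second moment 4, and only mixing one of them with 0 gives 1. The growth rate
  \<open>\<kappa>\<close> is an infimum that need not be attained, and the optimal multiplier must
  also be approached from below. Hence two constants are interposed, \<open>\<kappa> < r\<close> and
  \<open>r * sqrt \<delta> * K < lam0 < lam\<close>, with \<open>K\<close> the essential supremum of
  \<open>k\<close>; all estimates are uniform over multipliers from \<open>lam0\<close> on.
  Couplings are only taken optimal up to a small error, and the dual objective is never
  differentiated: comparing its values at two multipliers suffices.\<close>

lemma convex_on_affine_minorant:
  fixes l :: "real \<Rightarrow> real"
  assumes "convex_on UNIV l"
  obtains a b where "\<And>u. a + b * u \<le> l u"
proof -
  \<comment> \<open>The right derivative at 0, as the infimum of the difference quotients; it is a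
    subgradient there.\<close>
  define b where "b = Inf ((\<lambda>t. (l 0 - l t) / (0 - t)) ` ({0<..} \<inter> UNIV))"
  have "l 0 + b * (y - 0) \<le> l y" for y
    unfolding b_def using convex_le_Inf_differential[OF assms, of 0 y] by simp
  then show ?thesis by (intro that[of "l 0" b]) simp
qed

lemma convex_on_UNIV_continuous:
  fixes l :: "real \<Rightarrow> real"
  assumes "convex_on UNIV l"
  shows "continuous_on UNIV l"
  using convex_on_continuous[of UNIV l] assms by simp

text \<open>If \<open>l q < l p\<close>, convexity keeps \<open>l\<close> above the line through
  these two points beyond \<open>p\<close>, and that line exceeds every bound.\<close>

lemma convex_on_nonconstant_unbounded:
  fixes l :: "real \<Rightarrow> real"
  assumes "convex_on UNIV l" and "\<not> l constant_on UNIV"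
  shows "\<exists>u. c < l u"
proof (rule ccontr)
  assume "\<nexists>u. c < l u"
  then have ub: "l u \<le> c" for u by (meson not_le)
  have le: "l p \<le> l q" for p q
  proof (rule ccontr)
    assume "\<not> l p \<le> l q"
    then have d: "l q < l p" by simp
    \<comment> \<open>At \<open>q + t * (p - q)\<close> the line through the two points has the
      value \<open>c + 1\<close>.\<close>
    define t where "t = (c - l q + 1) / (l p - l q)"
    have t: "t > 0" "t * (l p - l q) = c - l q + 1"
      using d ub[of q] by (auto simp: t_def field_simps)
    have t1: "t \<ge> 1" using ub[of p] d by (simp add: t_def field_simps)
    have "l ((1 - 1/t) *\<^sub>R q + (1/t) *\<^sub>R (q + t * (p - q))) \<le> (1 - 1/t) * l q + (1/t) * l (q + t * (p - q))"
      by (rule convex_onD[OF assms(1)]) (use t t1 in auto)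
    moreover have "(1 - 1/t) *\<^sub>R q + (1/t) *\<^sub>R (q + t * (p - q)) = p"
      using t by (simp add: field_simps)
    ultimately have "l p \<le> (1 - 1/t) * l q + (1/t) * l (q + t * (p - q))" by simp
    also have "\<dots> \<le> (1 - 1/t) * l q + (1/t) * c"
      using ub t by (intro add_left_mono mult_left_mono) auto
    finally have "t * l p \<le> t * ((1 - 1/t) * l q + (1/t) * c)" using t by simp
    also have "\<dots> = t * l q - l q + c" using t by (simp add: field_simps)
    finally show False using t(2) by (simp add: algebra_simps)
  qed
  then have "l constant_on UNIV"
    unfolding constant_on_def by (metis order_antisym)
  with assms(2) show False ..
qed

lemma growth_rate_nonneg: "0 \<le> growth_rate l"
  unfolding growth_rate_def by (intro INF_greatest) auto

text \<open>The infimum defining the growth rate need not be attained, so a quadratic bound is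
  extracted for a rate strictly above it.\<close>

lemma growth_rate_bound:
  assumes "growth_rate l < ereal r"
  obtains C where "\<And>u. l u \<le> C + r * u\<^sup>2"
proof -
  obtain s where s: "0 \<le> s" "(SUP u. ereal (l u - s * u\<^sup>2)) < \<infinity>" "s < r"
    using assms unfolding growth_rate_def INF_less_iff by auto
  obtain C where C: "(SUP u. ereal (l u - s * u\<^sup>2)) \<le> ereal C"
    using s(2) by (metis less_ereal.simps(4) ereal_dense2 less_imp_le)
  have "l u \<le> C + r * u\<^sup>2" for u
  proof -
    have "ereal (l u - s * u\<^sup>2) \<le> ereal C"
      using C by (meson SUP_upper UNIV_I order_trans)
    then have "l u \<le> C + s * u\<^sup>2" by simp
    also have "\<dots> \<le> C + r * u\<^sup>2" using s by (intro add_left_mono mult_right_mono) auto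
    finally show ?thesis .
  qed
  then show ?thesis by (rule that)
qed

lemma growth_rate_unbounded:
  assumes "0 \<le> r" "ereal r < growth_rate l"
  shows "\<exists>u. c + r * u\<^sup>2 < l u"
proof (rule ccontr)
  assume "\<nexists>u. c + r * u\<^sup>2 < l u"
  then have "l u \<le> c + r * u\<^sup>2" for u by (meson not_le)
  then have "(SUP u. ereal (l u - r * u\<^sup>2)) \<le> ereal c"
    by (intro SUP_least) (simp add: algebra_simps)
  also have "ereal c < \<infinity>" by simp
  finally have "growth_rate l \<le> ereal r"
    unfolding growth_rate_def using assms(1) by (intro INF_lower) auto
  with assms(2) show False by simp
qed

subsection \<open>Positive definite matrices\<close>

lemma sym_pos_def_mult_inv:
  assumes "sym_pos_def S"
  shows "S *v (matrix_inv S *v b) = b"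
proof -
  have "v = 0" if "S *v v = 0" for v
    using assms that unfolding sym_pos_def_def by (metis inner_zero_right less_irrefl)
  then have "invertible S"
    by (metis invertible_left_inverse matrix_left_invertible_ker)
  then have "S ** matrix_inv S = mat 1"
    unfolding invertible_def matrix_inv_def by (metis (mono_tags, lifting) someI_ex)
  then show ?thesis by (simp add: matrix_vector_mul_assoc)
qed

lemma sym_pos_def_inner_commute:
  assumes "sym_pos_def S"
  shows "v \<bullet> (S *v w) = w \<bullet> (S *v v)"
  using assms unfolding sym_pos_def_def
  by (metis dot_lmul_matrix inner_commute matrix_transpose_mul transpose_matrix_vector)

lemma sym_pos_def_nonneg: "sym_pos_def S \<Longrightarrow> 0 \<le> v \<bullet> (S *v v)"
  unfolding sym_pos_def_def by (cases "v = 0") (auto simp: less_imp_le)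

text \<open>Completing the square. The choice \<open>t = 1\<close> gives the variational formula
  behind the measurability of \<open>inv_quad\<close>; the minimising \<open>t\<close> gives
  Cauchy-Schwarz.\<close>

lemma sym_pos_def_shift:
  fixes S :: "real^'n^'n"
  assumes "sym_pos_def S" and w: "w = matrix_inv S *v b"
  shows "(v - t *\<^sub>R w) \<bullet> (S *v (v - t *\<^sub>R w)) = v \<bullet> (S *v v) - 2 * t * (b \<bullet> v) + t\<^sup>2 * (b \<bullet> w)"
proof -
  have Sw: "S *v w = b" using sym_pos_def_mult_inv[OF assms(1)] w by simp
  have "w \<bullet> (S *v v) = v \<bullet> b" using sym_pos_def_inner_commute[OF assms(1), of w v] Sw by simp
  then show ?thesis
    by (simp add: matrix_vector_mult_diff_distrib inner_diff_left inner_diff_right matrix_vector_mult_scaleR Sw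
        power2_eq_square inner_commute algebra_simps)
qed

lemma quad_form_ge:
  fixes S :: "real^'n^'n"
  assumes "\<And>v. norm v = 1 \<Longrightarrow> \<rho> \<le> v \<bullet> (S *v v)"
  shows "\<rho> * (norm v)\<^sup>2 \<le> v \<bullet> (S *v v)"
proof (cases "v = 0")
  case False
  have "norm ((1 / norm v) *\<^sub>R v) = 1" using False by simp
  from assms[OF this] show ?thesis using False
    by (simp add: matrix_vector_mult_scaleR field_simps power2_eq_square)
qed simp

context
  fixes A :: "real^'n \<Rightarrow> real^'n^'n"
  assumes spd: "\<And>x. sym_pos_def (A x)"
begin

lemma inv_quad_eq:
  assumes "w = matrix_inv (A x) *v b"
  shows "w \<bullet> (A x *v w) = inv_quad A b x"
  using sym_pos_def_mult_inv[OF spd[of x], of b] assms by (simp add: inv_quad_def inner_commute)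

lemma inv_quad_pos:
  assumes "b \<noteq> 0"
  shows "0 < inv_quad A b x"
proof -
  define w where "w = matrix_inv (A x) *v b"
  have "w \<noteq> 0" using sym_pos_def_mult_inv[OF spd[of x], of b] assms w_def by force
  then show ?thesis using inv_quad_eq[OF w_def] spd unfolding sym_pos_def_def by metis
qed

lemma inv_quad_nonneg: "0 \<le> inv_quad A b x"
  using inv_quad_eq sym_pos_def_nonneg[OF spd] by metis

text \<open>Cauchy-Schwarz for the form of \<open>A x\<close>. In terms of cost, for
  \<open>b \<noteq> 0\<close>: changing \<open>b \<bullet> x\<close> by \<open>t\<close> costs at
  least \<open>t\<^sup>2 / inv_quad A b x\<close>.\<close>

lemma inner_square_le_inv_quad:
  shows "(b \<bullet> v)\<^sup>2 \<le> inv_quad A b x * (v \<bullet> (A x *v v))"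
proof (cases "b = 0")
  case True then show ?thesis by (simp add: inv_quad_def)
next
  case False
  define q where "q = inv_quad A b x"
  have q: "q > 0" using inv_quad_pos[OF False] q_def by simp
  \<comment> \<open>The minimiser of the quadratic polynomial that follows.\<close>
  define t where "t = (b \<bullet> v) / q"
  have "0 \<le> v \<bullet> (A x *v v) - 2 * t * (b \<bullet> v) + t\<^sup>2 * q"
    using sym_pos_def_shift[OF spd[of x] refl, of v t b] sym_pos_def_nonneg[OF spd[of x]]
    unfolding q_def inv_quad_def by metis
  then have "0 \<le> q * (v \<bullet> (A x *v v) - 2 * t * (b \<bullet> v) + t\<^sup>2 * q)" using q by simp
  also have "\<dots> = q * (v \<bullet> (A x *v v)) - (b \<bullet> v)\<^sup>2"
    using q by (simp add: t_def power2_eq_square field_simps)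
  finally show ?thesis using q_def by simp
qed

lemma inv_quad_ge:
  assumes "0 < \<rho>" and *: "\<And>v. norm v = 1 \<Longrightarrow> v \<bullet> (A x *v v) \<le> \<rho>"
  shows "(norm b)\<^sup>2 / \<rho> \<le> inv_quad A b x"
proof (cases "b = 0")
  case True then show ?thesis by (simp add: inv_quad_def)
next
  case False
  define v where "v = (1 / norm b) *\<^sub>R b"
  have v: "norm v = 1" "b \<bullet> v = norm b" using False by (auto simp: v_def dot_square_norm power2_eq_square)
  have "(norm b)\<^sup>2 \<le> inv_quad A b x * (v \<bullet> (A x *v v))"
    using inner_square_le_inv_quad[of b v x] v by simp
  also have "\<dots> \<le> inv_quad A b x * \<rho>" using *[OF v(1)] inv_quad_nonneg by (intro mult_left_mono) auto
  finally show ?thesis using assms(1) by (simp add: field_simps)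
qed

text \<open>For \<open>w = matrix_inv (A x) *v b\<close> both
  \<open>\<rho> * (norm w)\<^sup>2 \<le> q\<close> and \<open>q \<le> norm b * norm w\<close> hold;
  eliminating \<open>norm w\<close> leaves
  \<open>\<rho> * q\<^sup>2 \<le> (norm b)\<^sup>2 * q\<close>.\<close>

lemma inv_quad_le:
  assumes "0 < \<rho>" and *: "\<And>v. norm v = 1 \<Longrightarrow> \<rho> \<le> v \<bullet> (A x *v v)"
  shows "inv_quad A b x \<le> (norm b)\<^sup>2 / \<rho>"
proof -
  define w where "w = matrix_inv (A x) *v b"
  define q where "q = inv_quad A b x"
  have q0: "0 \<le> q" using inv_quad_nonneg q_def by simp
  have "\<rho> * (norm w)\<^sup>2 \<le> q"
    using quad_form_ge[OF *, of w] inv_quad_eq[OF w_def] q_def by simp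
  moreover have "q \<le> norm b * norm w"
    unfolding q_def inv_quad_def w_def[symmetric] by (rule norm_cauchy_schwarz)
  then have "q\<^sup>2 \<le> (norm b)\<^sup>2 * (norm w)\<^sup>2" using q0 by (metis power_mono power_mult_distrib)
  then have "\<rho> * q\<^sup>2 \<le> (norm b)\<^sup>2 * (\<rho> * (norm w)\<^sup>2)" using assms(1) by (simp add: algebra_simps)
  ultimately have "\<rho> * q\<^sup>2 \<le> (norm b)\<^sup>2 * q"
    by (meson mult_left_mono order_trans zero_le_power2)
  then have "\<rho> * q \<le> (norm b)\<^sup>2" using q0 by (cases "q = 0") (auto simp: power2_eq_square)
  then show ?thesis using assms(1) q_def by (simp add: field_simps)
qed

end

subsection \<open>Measurability\<close>

lemma lower_semicont_borel_measurable:
  assumes "lower_semicont f"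
  shows "f \<in> borel_measurable borel"
proof -
  have "open {z. t < f z}" for t
  proof (subst open_subopen, safe)
    fix z assume "t < f z"
    then have "\<forall>\<^sub>F w in nhds z. t < f w" using assms unfolding lower_semicont_def by blast
    then show "\<exists>T. open T \<and> z \<in> T \<and> T \<subseteq> {z. t < f z}" unfolding eventually_nhds by blast
  qed
  then show ?thesis by (subst borel_measurable_iff_greater) auto
qed

context
  fixes A :: "real^'n \<Rightarrow> real^'n^'n"
  assumes lsc: "lower_semicont (\<lambda>(x, x'). state_cost A x x')"
begin

lemma state_cost_measurable: "(\<lambda>z. state_cost A (fst z) (snd z)) \<in> borel_measurable borel"
  using lower_semicont_borel_measurable[OF lsc] by (simp add: case_prod_unfold)

text \<open>Measurability of \<open>A\<close> is drawn from the cost alone: the form at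
  \<open>v\<close> is the cost of moving \<open>x\<close> to \<open>x - v\<close>.\<close>

lemma quad_form_measurable: "(\<lambda>x. v \<bullet> (A x *v v)) \<in> borel_measurable borel"
proof -
  have "(\<lambda>x. (x, x - v)) \<in> borel_measurable borel"
    by (intro borel_measurable_continuous_onI continuous_intros)
  from measurable_compose[OF this state_cost_measurable] show ?thesis
    by (simp add: state_cost_def)
qed

context
  assumes spd: "\<And>x. sym_pos_def (A x)"
begin

text \<open>By completing the square, \<open>b\<^sup>T A(x)\<^sup>-\<^sup>1 b\<close> is the supremum of \<open>2 b\<^sup>T v - v\<^sup>T A(x) v\<close> over a countable
  dense set of \<open>v\<close>.\<close>
lemma inv_quad_measurable: "inv_quad A b \<in> borel_measurable borel"
proof -
  obtain D :: "(real^'n) set" where D: "countable D" "\<And>X. open X \<Longrightarrow> X \<noteq> {} \<Longrightarrow> \<exists>d\<in>D. d \<in> X"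
    using countable_dense_setE by metis
  have le: "2 * (b \<bullet> v) - v \<bullet> (A x *v v) \<le> inv_quad A b x" for x v
  proof -
    define w where "w = matrix_inv (A x) *v b"
    have "0 \<le> v \<bullet> (A x *v v) - 2 * 1 * (b \<bullet> v) + 1\<^sup>2 * (b \<bullet> w)"
      using sym_pos_def_nonneg[OF spd[of x]] sym_pos_def_shift[OF spd w_def, of v 1] by metis
    then show ?thesis unfolding inv_quad_def w_def by simp
  qed
  have set_eq: "{x. a < inv_quad A b x} = (\<Union>v\<in>D. {x. a < 2 * (b \<bullet> v) - v \<bullet> (A x *v v)})" for a
  proof safe
    fix x assume a: "a < inv_quad A b x"
    let ?g = "\<lambda>v. 2 * (b \<bullet> v) - v \<bullet> (A x *v v)"
    have "continuous_on UNIV ?g" by (intro continuous_intros)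
    then have "open {v. a < ?g v}" by (intro open_Collect_less continuous_intros)
    moreover have "?g (matrix_inv (A x) *v b) = inv_quad A b x"
      by (simp add: inv_quad_def sym_pos_def_mult_inv[OF spd] inner_commute)
    then have "matrix_inv (A x) *v b \<in> {v. a < ?g v}" using a by simp
    ultimately obtain v where "v \<in> D" "a < ?g v" using D(2)[of "{v. a < ?g v}"] by blast
    then show "x \<in> (\<Union>v\<in>D. {x. a < 2 * (b \<bullet> v) - v \<bullet> (A x *v v)})" by blast
  next
    fix x v assume "a < 2 * (b \<bullet> v) - v \<bullet> (A x *v v)"
    then show "a < inv_quad A b x" using le[of v x] by simp
  qed
  have "{x \<in> space borel. a < 2 * (b \<bullet> v) - v \<bullet> (A x *v v)} \<in> sets borel" for a v
    using quad_form_measurable[of v] by measurable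
  then have "{x. a < 2 * (b \<bullet> v) - v \<bullet> (A x *v v)} \<in> sets borel" for a v by simp
  then show ?thesis
    unfolding borel_measurable_iff_greater using D(1) set_eq
    by (auto intro!: sets.countable_UN')
qed

text \<open>Polarisation expresses each coordinate through values of
  \<open>inv_quad\<close>.\<close>

lemma matrix_inv_mult_measurable: "(\<lambda>x. matrix_inv (A x) *v b) \<in> borel_measurable borel"
proof -
  have eq: "i \<bullet> (matrix_inv (A x) *v b) = (inv_quad A (i + b) x - inv_quad A i x - inv_quad A b x) / 2" for i x
  proof -
    let ?I = "matrix_inv (A x)"
    have "i \<bullet> (?I *v b) = (A x *v (?I *v i)) \<bullet> (?I *v b)" by (simp add: sym_pos_def_mult_inv spd)
    also have "\<dots> = (?I *v i) \<bullet> (A x *v (?I *v b))"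
      using sym_pos_def_inner_commute[OF spd, of "?I *v b" x "?I *v i"] by (simp add: inner_commute)
    also have "\<dots> = b \<bullet> (?I *v i)" by (simp add: sym_pos_def_mult_inv spd inner_commute)
    finally show ?thesis
      by (simp add: inv_quad_def matrix_vector_right_distrib inner_add_left inner_add_right)
  qed
  have "(\<lambda>x. (matrix_inv (A x) *v b) \<bullet> i) \<in> borel_measurable borel" for i
    unfolding inner_commute[of _ i] eq using inv_quad_measurable by measurable
  then show ?thesis by (subst borel_measurable_euclidean_space) auto
qed

lemma X_star_measurable [measurable]:
  assumes [measurable]: "X \<in> borel_measurable M" "G \<in> borel_measurable M"
  shows "(\<lambda>\<omega>. X_star \<delta> A b (X \<omega>) (G \<omega>)) \<in> borel_measurable M"
proof -
  note [measurable] = measurable_compose[OF assms(1) matrix_inv_mult_measurable]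
  show ?thesis unfolding X_star_def by measurable
qed

end
end

subsection \<open>Extended expectations\<close>

lemma ext_expectation_AE_eq_integral:
  assumes "integrable M g" and "AE x in M. f x = ereal (g x)"
  shows "ext_expectation M f = ereal (integral\<^sup>L M g)"
proof -
  have "(\<integral>\<^sup>+ x. e2ennreal (f x) \<partial>M) = (\<integral>\<^sup>+ x. ennreal (g x) \<partial>M)"
    "(\<integral>\<^sup>+ x. e2ennreal (- f x) \<partial>M) = (\<integral>\<^sup>+ x. ennreal (- g x) \<partial>M)"
    using assms(2) by (auto intro!: nn_integral_cong_AE elim!: eventually_mono simp: ennreal.abs_eq)
  moreover have "(\<integral>\<^sup>+ x. ennreal (g x) \<partial>M) < \<infinity>" "(\<integral>\<^sup>+ x. ennreal (- g x) \<partial>M) < \<infinity>"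
    using assms(1) by (auto simp: real_integrable_def top.not_eq_extremum)
  ultimately show ?thesis
    unfolding ext_expectation_def real_lebesgue_integral_def[OF assms(1)]
    by (smt (verit, ccfv_threshold) enn2ereal_ennreal ennreal_enn2real enn2real_nonneg ereal_minus(1) infinity_ennreal_def)
qed

lemma ext_expectation_eq_infinity:
  assumes "E \<in> sets M" "emeasure M E \<noteq> 0" and "\<And>x. x \<in> E \<Longrightarrow> f x = \<infinity>"
  shows "ext_expectation M f = \<infinity>"
proof -
  have "\<infinity> = (\<integral>\<^sup>+ x. \<infinity> * indicator E x \<partial>M)"
    unfolding nn_integral_cmult_indicator[OF assms(1)] using assms(2) by (simp add: ennreal_top_mult)
  also have "\<dots> \<le> (\<integral>\<^sup>+ x. e2ennreal (f x) \<partial>M)"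
    using assms(3) by (intro nn_integral_mono) (auto split: split_indicator simp: e2ennreal_infty)
  finally have "(\<integral>\<^sup>+ x. e2ennreal (f x) \<partial>M) = \<infinity>" by (simp add: top.extremum_unique)
  \<comment> \<open>In \<open>ereal\<close>, \<open>\<infinity> - y = \<infinity>\<close> for every
    \<open>y\<close>, so the negative part needs no control.\<close>
  then show ?thesis unfolding ext_expectation_def by simp
qed

subsection \<open>Maximisers of coercive functions\<close>

lemma coercive_attains_max_on_closed:
  fixes f :: "real \<Rightarrow> real"
  assumes "continuous_on UNIV f" "\<And>c. bounded {\<gamma>. c \<le> f \<gamma>}" "closed S" "S \<noteq> {}"
  obtains m where "m \<in> S" "\<And>\<gamma>. \<gamma> \<in> S \<Longrightarrow> f \<gamma> \<le> f m"
proof -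
  obtain p where p: "p \<in> S" using assms(4) by auto
  have cl: "closed {\<gamma>. f p \<le> f \<gamma>}" by (intro closed_Collect_le assms(1) continuous_intros)
  then have "compact ({\<gamma>. f p \<le> f \<gamma>} \<inter> S)"
    using assms(2,3) by (auto simp: compact_eq_bounded_closed intro: bounded_Int)
  moreover have "{\<gamma>. f p \<le> f \<gamma>} \<inter> S \<noteq> {}" using p by auto
  ultimately obtain m where "m \<in> {\<gamma>. f p \<le> f \<gamma>} \<inter> S" "\<forall>y\<in>{\<gamma>. f p \<le> f \<gamma>} \<inter> S. f y \<le> f m"
    using continuous_attains_sup[of _ f] assms(1) by (meson continuous_on_subset subset_UNIV)
  then show ?thesis by (intro that[of m]) force+
qed

lemma compact_argmax:
  fixes f :: "real \<Rightarrow> real"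
  assumes "continuous_on UNIV f" "\<And>c. bounded {\<gamma>. c \<le> f \<gamma>}"
  shows "compact {\<gamma>. \<forall>c. f c \<le> f \<gamma>}"
proof -
  have "closed {\<gamma>. \<forall>c. f c \<le> f \<gamma>}"
    by (intro closed_Collect_all closed_Collect_le assms(1) continuous_intros)
  moreover have "bounded {\<gamma>. \<forall>c. f c \<le> f \<gamma>}" by (rule bounded_subset[OF assms(2)[of "f 0"]]) auto
  ultimately show ?thesis by (simp add: compact_eq_bounded_closed)
qed

lemma argmax_nonempty:
  fixes f :: "real \<Rightarrow> real"
  assumes "continuous_on UNIV f" "\<And>c. bounded {\<gamma>. c \<le> f \<gamma>}"
  shows "{\<gamma>. \<forall>c. f c \<le> f \<gamma>} \<noteq> {}"
  using coercive_attains_max_on_closed[OF assms, of UNIV] by auto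

text \<open>The maximisers form a compact set, on which \<open>h\<close> attains its minimum.
  Identity, negation, modulus and negated modulus as \<open>h\<close> give all selections needed
  later.\<close>

lemma Inf_image_argmax:
  fixes f :: "real \<Rightarrow> real" and h :: "real \<Rightarrow> real"
  assumes "continuous_on UNIV f" "\<And>c. bounded {\<gamma>. c \<le> f \<gamma>}" "continuous_on UNIV h"
  obtains m where "\<And>c. f c \<le> f m" "h m = Inf (h ` {\<gamma>. \<forall>c. f c \<le> f \<gamma>})"
    "\<And>\<gamma>. (\<And>c. f c \<le> f \<gamma>) \<Longrightarrow> h m \<le> h \<gamma>"
proof -
  let ?S = "{\<gamma>. \<forall>c. f c \<le> f \<gamma>}"
  obtain m where m: "m \<in> ?S" "\<forall>y\<in>?S. h m \<le> h y"
    using continuous_attains_inf[OF compact_argmax argmax_nonempty, OF assms(1,2,1,2), of h] assms(3)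
    by (meson continuous_on_subset subset_UNIV)
  have "Inf (h ` ?S) = h m" using m by (intro cInf_eq_minimum) auto
  with m show ?thesis by (intro that[of m]) auto
qed

text \<open>The sublevel set \<open>{Inf (h ` argmax) \<le> a}\<close> is where the maximum over \<open>{h \<le> a}\<close> equals the global
  maximum; by continuity both may be taken over countable dense sets.\<close>
lemma Inf_image_argmax_measurable:
  fixes \<Phi> :: "real \<Rightarrow> 'a \<Rightarrow> real" and h :: "real \<Rightarrow> real"
  assumes meas [measurable]: "\<And>\<gamma>. \<Phi> \<gamma> \<in> borel_measurable M" and S [measurable]: "S \<in> sets M"
    and cont: "\<And>x. x \<in> S \<Longrightarrow> continuous_on UNIV (\<lambda>\<gamma>. \<Phi> \<gamma> x)"
    and coer: "\<And>x c. x \<in> S \<Longrightarrow> bounded {\<gamma>. c \<le> \<Phi> \<gamma> x}"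
    and h: "continuous_on UNIV h"
  shows "(\<lambda>x. if x \<in> S then Inf (h ` {\<gamma>. \<forall>c. \<Phi> c x \<le> \<Phi> \<gamma> x}) else 0) \<in> borel_measurable M"
proof (subst borel_measurable_iff_le, intro allI)
  fix a :: real
  let ?I = "\<lambda>x. Inf (h ` {\<gamma>. \<forall>c. \<Phi> c x \<le> \<Phi> \<gamma> x})"
  \<comment> \<open>The rationals could miss the closed set
    \<open>{\<gamma>. h \<gamma> \<le> a}\<close>, so a countable dense subset of that set itself is
    taken.\<close>
  obtain T where T: "countable T" "T \<subseteq> {\<gamma>. h \<gamma> \<le> a}" "{\<gamma>. h \<gamma> \<le> a} \<subseteq> closure T"
    using separable by metis
  have clh: "closed {\<gamma>. h \<gamma> \<le> a}" by (intro closed_Collect_le h continuous_intros)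
  have key: "?I x \<le> a \<longleftrightarrow> (\<forall>j::nat. \<exists>p\<in>T. \<forall>q\<in>\<rat>. \<Phi> q x - 1 / Suc j \<le> \<Phi> p x)" if x: "x \<in> S" for x
  proof
    assume le: "?I x \<le> a"
    obtain m where m: "\<And>c. \<Phi> c x \<le> \<Phi> m x" "h m = ?I x"
      using Inf_image_argmax[OF cont[OF x] coer[OF x] h] by metis
    show "\<forall>j::nat. \<exists>p\<in>T. \<forall>q\<in>\<rat>. \<Phi> q x - 1 / Suc j \<le> \<Phi> p x"
    proof
      fix j :: nat
      have "m \<in> closure T" using m(2) le T(3) by auto
      moreover have "open {p. \<Phi> m x - 1 / Suc j < \<Phi> p x}"
        by (intro open_Collect_less cont[OF x] continuous_intros)
      moreover have "m \<in> {p. \<Phi> m x - 1 / Suc j < \<Phi> p x}" by simp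
      ultimately have "T \<inter> {p. \<Phi> m x - 1 / Suc j < \<Phi> p x} \<noteq> {}"
        by (meson closure_iff_nhds_not_empty subset_refl)
      then obtain p where "p \<in> T" "\<Phi> m x - 1 / Suc j < \<Phi> p x" by auto
      then have "\<Phi> q x - 1 / Suc j \<le> \<Phi> p x" for q using m(1)[of q] by linarith
      then show "\<exists>p\<in>T. \<forall>q\<in>\<rat>. \<Phi> q x - 1 / Suc j \<le> \<Phi> p x" using \<open>p \<in> T\<close> by blast
    qed
  next
    assume R: "\<forall>j::nat. \<exists>p\<in>T. \<forall>q\<in>\<rat>. \<Phi> q x - 1 / Suc j \<le> \<Phi> p x"
    then have "{\<gamma>. h \<gamma> \<le> a} \<noteq> {}" using T(2) by blast
    then obtain m where m: "h m \<le> a" "\<And>\<gamma>. h \<gamma> \<le> a \<Longrightarrow> \<Phi> \<gamma> x \<le> \<Phi> m x"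
      using coercive_attains_max_on_closed[OF cont[OF x] coer[OF x] clh] by auto
    have "\<Phi> c x \<le> \<Phi> m x" for c
    proof (rule ccontr)
      assume "\<not> \<Phi> c x \<le> \<Phi> m x"
      then obtain j :: nat where j: "1 / Suc j < \<Phi> c x - \<Phi> m x"
        using nat_approx_posE[of "\<Phi> c x - \<Phi> m x"] by auto
      then have "c \<in> {q. \<Phi> m x + 1 / Suc j < \<Phi> q x}" by auto
      moreover have "open {q. \<Phi> m x + 1 / Suc j < \<Phi> q x}"
        by (intro open_Collect_less cont[OF x] continuous_intros)
      moreover have "c \<in> closure \<rat>" using Rats_closure_real by simp
      ultimately have "\<rat> \<inter> {q. \<Phi> m x + 1 / Suc j < \<Phi> q x} \<noteq> {}"
        by (meson closure_iff_nhds_not_empty subset_refl)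
      then obtain q where q: "q \<in> \<rat>" "\<Phi> m x + 1 / Suc j < \<Phi> q x" by auto
      obtain p where p: "p \<in> T" "\<forall>q\<in>\<rat>. \<Phi> q x - 1 / Suc j \<le> \<Phi> p x" using R by blast
      then have "\<Phi> q x - 1 / Suc j \<le> \<Phi> m x"
        using m(2)[of p] T(2) q(1) by force
      with q(2) show False by simp
    qed
    then have m': "m \<in> {\<gamma>. \<forall>c. \<Phi> c x \<le> \<Phi> \<gamma> x}" by simp
    have "?I x \<le> h m"
      using Inf_image_argmax[OF cont[OF x] coer[OF x] h] m' by (metis mem_Collect_eq)
    with m(1) show "?I x \<le> a" by simp
  qed
  have "{x \<in> space M. (if x \<in> S then ?I x else 0) \<le> a} =
      (S \<inter> (\<Inter>j::nat. \<Union>p\<in>T. \<Inter>q\<in>\<rat>. {x \<in> space M. \<Phi> q x - 1 / Suc j \<le> \<Phi> p x})) \<union>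
      (if 0 \<le> a then space M - S else {})"
    using sets.sets_into_space[OF S] by (auto simp: key split: if_splits)
  also have "\<dots> \<in> sets M"
  proof -
    have "(\<Inter>q\<in>\<rat>. {x \<in> space M. \<Phi> q x - 1 / Suc j \<le> \<Phi> p x}) \<in> sets M" for p and j :: nat
      using countable_rat Rats_0 by (intro sets.countable_INT') auto
    then have "(\<Union>p\<in>T. \<Inter>q\<in>\<rat>. {x \<in> space M. \<Phi> q x - 1 / Suc j \<le> \<Phi> p x}) \<in> sets M" for j :: nat
      by (intro sets.countable_UN''[OF T(1)])
    then have "(\<Inter>j::nat. \<Union>p\<in>T. \<Inter>q\<in>\<rat>. {x \<in> space M. \<Phi> q x - 1 / Suc j \<le> \<Phi> p x}) \<in> sets M"
      by (intro sets.countable_INT) auto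
    then show ?thesis by auto
  qed
  finally show "{x \<in> space M. (if x \<in> S then ?I x else 0) \<le> a} \<in> sets M" .
qed

subsection \<open>The robustified loss\<close>

lemma Gamma_star_eq:
  "Gamma_star \<delta> l A \<beta> lam x = {\<gamma>. \<forall>c. dual_F \<delta> l A c \<beta> lam x \<le> dual_F \<delta> l A \<gamma> \<beta> lam x}"
proof -
  have "ereal (dual_F \<delta> l A \<gamma> \<beta> lam x) = loss_rob \<delta> l A \<beta> lam x \<longleftrightarrow>
    (\<forall>c. dual_F \<delta> l A c \<beta> lam x \<le> dual_F \<delta> l A \<gamma> \<beta> lam x)" (is "?L \<longleftrightarrow> ?R") for \<gamma>
  proof
    assume L: ?L
    have "ereal (dual_F \<delta> l A c \<beta> lam x) \<le> ereal (dual_F \<delta> l A \<gamma> \<beta> lam x)" for c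
      unfolding L loss_rob_def by (rule SUP_upper) simp
    then show ?R by simp
  next
    assume ?R then show ?L unfolding loss_rob_def by (intro antisym SUP_upper SUP_least) auto
  qed
  then show ?thesis unfolding Gamma_star_def by auto
qed

text \<open>The margin between \<open>r * sqrt \<delta> * K\<close> and \<open>lam0\<close> makes
  the inner problem coercive. The multiplier is not fixed here, so every estimate applies to all
  multipliers from \<open>lam0\<close> on, in particular to those slightly below the optimal
  one.\<close>

locale growth_bounded_dual =
  fixes \<delta> :: real and P0 :: "(real^'n) measure" and l :: "real \<Rightarrow> real"
    and A :: "real^'n \<Rightarrow> real^'n^'n" and \<beta> :: "real^'n" and k0 K C r lam0 :: real
  assumes delta: "0 < \<delta>" and prob: "prob_space P0" and sets_P0 [measurable_cong]: "sets P0 = sets borel"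
    and spd: "\<And>x. sym_pos_def (A x)" and lsc: "lower_semicont (\<lambda>(x, x'). state_cost A x x')"
    and conv: "convex_on UNIV l" and beta: "\<beta> \<noteq> 0"
    and moment: "integrable P0 (\<lambda>x. (norm x)\<^sup>2)"
    and k0: "0 < k0" "k0 \<le> K"
    and AE_inv_quad: "AE x in P0. k0 \<le> inv_quad A \<beta> x \<and> inv_quad A \<beta> x \<le> K"
    and r: "0 \<le> r" and growth: "\<And>u. l u \<le> C + r * u\<^sup>2"
    and lam0: "r * sqrt \<delta> * K < lam0"
begin

abbreviation k where "k \<equiv> inv_quad A \<beta>"
abbreviation F where "F lam \<gamma> x \<equiv> dual_F \<delta> l A \<gamma> \<beta> lam x"
abbreviation \<Gamma> where "\<Gamma> \<equiv> Gamma_star \<delta> l A \<beta>"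

text \<open>Defined by the bounds rather than as the complement of a null set: a given point with
  \<open>k x \<le> K\<close> becomes good once \<open>k0\<close> is lowered, which gives access to
  points in null sets too.\<close>

definition good where "good = {x. k0 \<le> k x \<and> k x \<le> K}"

lemma sqrt_delta: "0 < sqrt \<delta>" "sqrt \<delta> * sqrt \<delta> = \<delta>" using delta by auto

lemma k_measurable [measurable]: "k \<in> borel_measurable borel"
  by (rule inv_quad_measurable[OF lsc spd])

lemma l_continuous: "continuous_on UNIV l"
  by (rule convex_on_UNIV_continuous[OF conv])

lemma l_measurable [measurable]: "l \<in> borel_measurable borel"
  by (rule borel_measurable_continuous_onI[OF l_continuous])

lemma good_measurable [measurable]: "good \<in> sets borel"
proof -
  have "good = {x \<in> space borel. k0 \<le> k x \<and> k x \<le> K}" by (auto simp: good_def)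
  also have "\<dots> \<in> sets borel" by measurable
  finally show ?thesis .
qed

lemma AE_good: "AE x in P0. x \<in> good" using AE_inv_quad by (simp add: good_def)

lemma k_pos: "0 < k x" by (rule inv_quad_pos[OF spd beta])

lemma F_measurable [measurable]:
  assumes [measurable]: "g \<in> borel_measurable M" "X \<in> borel_measurable M"
  shows "(\<lambda>x. F lam (g x) (X x)) \<in> borel_measurable M"
  unfolding dual_F_def by measurable

lemma F_continuous: "continuous_on UNIV (\<lambda>\<gamma>. F lam \<gamma> x)"
  unfolding dual_F_def
  by (intro continuous_intros continuous_on_compose2[OF l_continuous]) auto

text \<open>With \<open>u = \<beta> \<bullet> x\<close> and a shift \<open>t\<close>, the growth
  bound and Young's inequality give \<open>(r + e) * t\<^sup>2\<close> plus a multiple of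
  \<open>1 + u\<^sup>2\<close>. Since \<open>t\<^sup>2\<close> is at most
  \<open>\<delta> * K\<close> times \<open>\<gamma>\<^sup>2 * k x\<close>, the penalty wins by
  \<open>\<eta>\<close>, whatever \<open>lam \<ge> lam0\<close>.\<close>

lemma F_upper:
  obtains D \<eta> where "0 < \<eta>" "0 \<le> D"
    "\<And>lam x \<gamma>. lam0 \<le> lam \<Longrightarrow> x \<in> good \<Longrightarrow> F lam \<gamma> x \<le> D * (1 + (\<beta> \<bullet> x)\<^sup>2) + lam * sqrt \<delta> - \<eta> * (\<gamma>\<^sup>2 * k x)"
proof -
  define s where "s = sqrt \<delta>"
  have s: "s > 0" "s * s = \<delta>" using sqrt_delta by (auto simp: s_def)
  have K: "K > 0" using k0 by simp
  \<comment> \<open>Half of the margin \<open>lam0 - r * s * K\<close> pays for Young's inequality;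
    the other half remains as \<open>\<eta>\<close>.\<close>
  define e where "e = (lam0 - r * s * K) / (2 * s * K)"
  have e: "e > 0" using lam0 s K by (auto simp: e_def s_def)
  have esK: "e * s * K = (lam0 - r * s * K) / 2" using s K by (simp add: e_def)
  define \<eta> where "\<eta> = s * (lam0 - r * s * K) / 2"
  have eta: "\<eta> > 0" using lam0 s by (auto simp: \<eta>_def s_def)
  define D where "D = \<bar>C\<bar> + r + r\<^sup>2 / e"
  have D: "D \<ge> 0" using r e by (auto simp: D_def)
  show ?thesis
  proof (rule that[OF eta D])
    fix lam x \<gamma> assume lam: "lam0 \<le> lam" and x: "x \<in> good"
    define u where "u = \<beta> \<bullet> x"
    define t where "t = \<gamma> * s * k x"
    define y where "y = \<gamma>\<^sup>2 * k x"
    have kx: "0 < k x" "k x \<le> K" using x k_pos by (auto simp: good_def)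
    have y0: "0 \<le> y" using kx by (simp add: y_def)
    \<comment> \<open>Young's inequality for the mixed term: \<open>2 * r * u * t \<le> e *
      t\<^sup>2 + r\<^sup>2 / e * u\<^sup>2\<close>.\<close>
    have "0 \<le> (e * t - r * u)\<^sup>2 / e" using e by simp
    also have "\<dots> = e * t\<^sup>2 - 2 * r * u * t + r\<^sup>2 / e * u\<^sup>2"
      using e by (simp add: power2_eq_square field_simps)
    finally have sq: "r * (u + t)\<^sup>2 \<le> (r + e) * t\<^sup>2 + (r + r\<^sup>2 / e) * u\<^sup>2"
      by (simp add: power2_eq_square algebra_simps)
    have t2: "t\<^sup>2 \<le> s * s * K * y"
    proof -
      have "t\<^sup>2 = s * s * y * k x" by (simp add: t_def y_def power2_eq_square)
      also have "\<dots> \<le> s * s * y * K" using kx y0 s by (intro mult_left_mono) auto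
      finally show ?thesis by (simp add: mult_ac)
    qed
    have "l (u + t) \<le> C + r * (u + t)\<^sup>2" by (rule growth)
    also have "\<dots> \<le> C + ((r + e) * t\<^sup>2 + (r + r\<^sup>2 / e) * u\<^sup>2)" using sq by simp
    also have "\<dots> \<le> C + ((r + e) * (s * s * K * y) + (r + r\<^sup>2 / e) * u\<^sup>2)"
      using t2 r e by (intro add_left_mono add_right_mono mult_left_mono) auto
    also have "(r + e) * (s * s * K * y) = s * (r * s * K) * y + s * (e * s * K) * y"
      by (simp add: algebra_simps)
    also have "\<dots> = (lam0 * s - \<eta>) * y" unfolding esK \<eta>_def by (simp add: algebra_simps add_divide_distrib diff_divide_distrib)
    also have "(lam0 * s - \<eta>) * y \<le> (lam * s - \<eta>) * y" using lam s y0 by (intro mult_right_mono) auto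
    finally have "l (u + t) \<le> C + ((lam * s - \<eta>) * y + (r + r\<^sup>2 / e) * u\<^sup>2)" by simp
    moreover have "C + (r + r\<^sup>2 / e) * u\<^sup>2 \<le> D * (1 + u\<^sup>2)"
    proof -
      have "0 \<le> r + r\<^sup>2 / e" "0 \<le> \<bar>C\<bar> * u\<^sup>2" using r e by auto
      moreover have "D * (1 + u\<^sup>2) = \<bar>C\<bar> + (r + r\<^sup>2 / e) + \<bar>C\<bar> * u\<^sup>2 + (r + r\<^sup>2 / e) * u\<^sup>2"
        unfolding D_def by (simp only: distrib_left distrib_right mult_1_right add.assoc)
      ultimately show ?thesis by linarith
    qed
    ultimately have "l (u + t) - lam * s * (y - 1) \<le> D * (1 + u\<^sup>2) + lam * s - \<eta> * y"
      by (simp add: algebra_simps)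
    then show "F lam \<gamma> x \<le> D * (1 + (\<beta> \<bullet> x)\<^sup>2) + lam * sqrt \<delta> - \<eta> * (\<gamma>\<^sup>2 * k x)"
      by (simp add: dual_F_def u_def t_def y_def s_def)
  qed
qed

lemma l_lower:
  obtains D where "0 \<le> D" "\<And>u. - D * (1 + u\<^sup>2) \<le> l u"
proof -
  obtain a b where ab: "\<And>u. a + b * u \<le> l u" using convex_on_affine_minorant[OF conv] by metis
  have "- (\<bar>a\<bar> + \<bar>b\<bar>) * (1 + u\<^sup>2) \<le> l u" for u
  proof -
    have "0 \<le> (\<bar>u\<bar> - 1)\<^sup>2" by simp
    then have "\<bar>u\<bar> \<le> 1 + u\<^sup>2" by (simp add: power2_eq_square algebra_simps abs_mult_self_eq; smt (verit) zero_le_square)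
    then have "\<bar>b\<bar> * \<bar>u\<bar> \<le> \<bar>b\<bar> * (1 + u\<^sup>2)" by (intro mult_left_mono) auto
    moreover have "- (\<bar>b\<bar> * \<bar>u\<bar>) \<le> b * u" by (metis abs_mult abs_ge_minus_self minus_le_iff)
    moreover have "\<bar>a\<bar> \<le> \<bar>a\<bar> * (1 + u\<^sup>2)" by (simp add: algebra_simps)
    moreover have "- (\<bar>a\<bar> + \<bar>b\<bar>) * (1 + u\<^sup>2) = - (\<bar>a\<bar> * (1 + u\<^sup>2)) - \<bar>b\<bar> * (1 + u\<^sup>2)"
      by (simp only: distrib_right mult_minus_left minus_add)
    ultimately show ?thesis using ab[of u] by linarith
  qed
  then show ?thesis by (intro that[of "\<bar>a\<bar> + \<bar>b\<bar>"]) auto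
qed

lemma F_coercive:
  assumes "lam0 \<le> lam" "x \<in> good"
  shows "bounded {\<gamma>. c \<le> F lam \<gamma> x}"
proof -
  obtain D \<eta> where D: "0 < \<eta>" "0 \<le> D" and
    *: "\<And>\<gamma>. F lam \<gamma> x \<le> D * (1 + (\<beta> \<bullet> x)\<^sup>2) + lam * sqrt \<delta> - \<eta> * (\<gamma>\<^sup>2 * k x)"
    using F_upper assms by metis
  define Q where "Q = (D * (1 + (\<beta> \<bullet> x)\<^sup>2) + lam * sqrt \<delta> - c) / (\<eta> * k x)"
  have "\<bar>\<gamma>\<bar> \<le> sqrt Q" if "c \<le> F lam \<gamma> x" for \<gamma>
  proof -
    have "\<gamma>\<^sup>2 \<le> Q" using that *[of \<gamma>] D k_pos[of x] by (simp add: Q_def field_simps)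
    then show ?thesis using real_sqrt_le_mono by fastforce
  qed
  then show ?thesis unfolding bounded_iff by (auto intro!: exI[of _ "sqrt Q"])
qed

text \<open>This is the extremal value of \<open>h\<close>, not the maximiser attaining it. The two
  agree for the identity; for the modulus the sign has to be recovered separately.\<close>

definition select :: "(real \<Rightarrow> real) \<Rightarrow> real \<Rightarrow> real^'n \<Rightarrow> real" where
  "select h lam x = (if x \<in> good then Inf (h ` \<Gamma> lam x) else 0)"

lemma select_measurable [measurable]:
  assumes "lam0 \<le> lam" "continuous_on UNIV h"
  shows "select h lam \<in> borel_measurable borel"
  unfolding select_def[abs_def] Gamma_star_eq
  by (rule Inf_image_argmax_measurable) (use assms F_continuous F_coercive in auto)

lemma select_attained:
  assumes "lam0 \<le> lam" "continuous_on UNIV h" "x \<in> good"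
  obtains m where "m \<in> \<Gamma> lam x" "h m = select h lam x" "\<And>\<gamma>. \<gamma> \<in> \<Gamma> lam x \<Longrightarrow> h m \<le> h \<gamma>"
proof -
  from Inf_image_argmax[OF F_continuous[of lam x] F_coercive[OF assms(1,3)] assms(2)] assms(3) show ?thesis
    using that by (simp add: select_def Gamma_star_eq) blast
qed

text \<open>A maximiser does at least as well as \<open>\<gamma> = 0\<close>. The summand
  \<open>lam * sqrt \<delta>\<close> occurs on both sides of that comparison and cancels, so
  \<open>H\<close> does not depend on the multiplier.\<close>

lemma Gamma_bound:
  obtains H where "0 \<le> H"
    "\<And>lam x \<gamma>. lam0 \<le> lam \<Longrightarrow> x \<in> good \<Longrightarrow> \<gamma> \<in> \<Gamma> lam x \<Longrightarrow> \<gamma>\<^sup>2 * k x \<le> H * (1 + (\<beta> \<bullet> x)\<^sup>2)"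
proof -
  obtain D \<eta> where D: "0 < \<eta>" "0 \<le> D"
    "\<And>lam x \<gamma>. lam0 \<le> lam \<Longrightarrow> x \<in> good \<Longrightarrow> F lam \<gamma> x \<le> D * (1 + (\<beta> \<bullet> x)\<^sup>2) + lam * sqrt \<delta> - \<eta> * (\<gamma>\<^sup>2 * k x)"
    using F_upper by metis
  obtain D' where D': "0 \<le> D'" "\<And>u. - D' * (1 + u\<^sup>2) \<le> l u" using l_lower by metis
  show ?thesis
  proof (rule that[of "(D + D') / \<eta>"])
    show "0 \<le> (D + D') / \<eta>" using D D' by simp
    fix lam x \<gamma> assume a: "lam0 \<le> lam" "x \<in> good" "\<gamma> \<in> \<Gamma> lam x"
    have "l (\<beta> \<bullet> x) + lam * sqrt \<delta> = F lam 0 x" by (simp add: dual_F_def)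
    also have "\<dots> \<le> F lam \<gamma> x" using a(3) by (simp add: Gamma_star_eq)
    also have "\<dots> \<le> D * (1 + (\<beta> \<bullet> x)\<^sup>2) + lam * sqrt \<delta> - \<eta> * (\<gamma>\<^sup>2 * k x)" by (rule D(3)[OF a(1,2)])
    finally have "\<eta> * (\<gamma>\<^sup>2 * k x) \<le> (D + D') * (1 + (\<beta> \<bullet> x)\<^sup>2)"
      using D'(2)[of "\<beta> \<bullet> x"] by (simp add: algebra_simps)
    then show "\<gamma>\<^sup>2 * k x \<le> (D + D') / \<eta> * (1 + (\<beta> \<bullet> x)\<^sup>2)" using D(1) by (simp add: field_simps)
  qed
qed

section \<open>Integrability of the maximisers and the real-valued robustified loss\<close>

lemma integrable_inner_square: "integrable P0 (\<lambda>x. (\<beta> \<bullet> x)\<^sup>2)"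
proof (rule Bochner_Integration.integrable_bound[OF integrable_mult_right[OF moment, of "(norm \<beta>)\<^sup>2"]])
  show "AE x in P0. norm ((\<beta> \<bullet> x)\<^sup>2) \<le> norm ((norm \<beta>)\<^sup>2 * (norm x)\<^sup>2)"
    by (auto simp: power_mult_distrib[symmetric] intro!: power2_le_iff_abs_le[THEN iffD2] Cauchy_Schwarz_ineq2)
qed measurable

lemma integrable_quadratic: "integrable P0 (\<lambda>x. a * (1 + (\<beta> \<bullet> x)\<^sup>2) + b)"
proof -
  interpret prob_space P0 by (rule prob)
  show ?thesis using integrable_inner_square by simp
qed

lemma integrable_Gamma:
  assumes "lam0 \<le> lam" and [measurable]: "g \<in> borel_measurable borel" and "\<And>x. x \<in> good \<Longrightarrow> \<exists>\<gamma>\<in>\<Gamma> lam x. \<bar>g x\<bar> = \<bar>\<gamma>\<bar>"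
  shows "integrable P0 (\<lambda>x. (g x)\<^sup>2 * k x)"
proof -
  obtain H where H: "0 \<le> H"
    "\<And>lam x \<gamma>. lam0 \<le> lam \<Longrightarrow> x \<in> good \<Longrightarrow> \<gamma> \<in> \<Gamma> lam x \<Longrightarrow> \<gamma>\<^sup>2 * k x \<le> H * (1 + (\<beta> \<bullet> x)\<^sup>2)"
    using Gamma_bound by metis
  show ?thesis
  proof (rule Bochner_Integration.integrable_bound[OF integrable_quadratic[of H 0]])
    have "norm ((g x)\<^sup>2 * k x) \<le> norm (H * (1 + (\<beta> \<bullet> x)\<^sup>2) + 0)" if x: "x \<in> good" for x
    proof -
      obtain \<gamma> where "\<gamma> \<in> \<Gamma> lam x" "\<bar>g x\<bar> = \<bar>\<gamma>\<bar>" using assms(3)[OF x] by auto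
      then have "(g x)\<^sup>2 * k x \<le> H * (1 + (\<beta> \<bullet> x)\<^sup>2)"
        using H(2)[OF assms(1) x, of \<gamma>] by (metis power2_abs)
      then show ?thesis using k_pos[of x] by simp
    qed
    then show "AE x in P0. norm ((g x)\<^sup>2 * k x) \<le> norm (H * (1 + (\<beta> \<bullet> x)\<^sup>2) + 0)"
      using AE_good by auto
  qed measurable
qed

text \<open>The robustified loss as a real function. Evaluating at the selected maximiser makes it
  Borel, which the uncountable supremum in \<open>loss_rob\<close> does not show directly.\<close>

definition val :: "real \<Rightarrow> real^'n \<Rightarrow> real" where
  "val lam x = F lam (select (\<lambda>\<gamma>. \<gamma>) lam x) x"

lemma val_measurable [measurable]: "lam0 \<le> lam \<Longrightarrow> val lam \<in> borel_measurable borel"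
  unfolding val_def[abs_def] by (intro F_measurable select_measurable) auto

lemma val_eq:
  assumes "lam0 \<le> lam" "x \<in> good" "\<gamma> \<in> \<Gamma> lam x"
  shows "F lam \<gamma> x = val lam x"
proof -
  obtain m where "m \<in> \<Gamma> lam x" "m = select (\<lambda>\<gamma>. \<gamma>) lam x"
    using select_attained[OF assms(1) _ assms(2), of "\<lambda>\<gamma>. \<gamma>"] by auto
  then show ?thesis using assms(3) unfolding val_def Gamma_star_eq by (auto intro: antisym)
qed

lemma F_le_val:
  assumes "lam0 \<le> lam" "x \<in> good"
  shows "F lam \<gamma> x \<le> val lam x"
proof -
  obtain m where m: "m \<in> \<Gamma> lam x" "m = select (\<lambda>\<gamma>. \<gamma>) lam x"
    using select_attained[OF assms(1) _ assms(2), of "\<lambda>\<gamma>. \<gamma>"] by auto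
  then show ?thesis using val_eq[OF assms m(1)] by (auto simp: Gamma_star_eq)
qed

lemma loss_rob_eq_val:
  assumes "lam0 \<le> lam" "x \<in> good"
  shows "loss_rob \<delta> l A \<beta> lam x = ereal (val lam x)"
proof -
  obtain m where m: "m \<in> \<Gamma> lam x" "m = select (\<lambda>\<gamma>. \<gamma>) lam x"
    using select_attained[OF assms(1) _ assms(2), of "\<lambda>\<gamma>. \<gamma>"] by auto
  then show ?thesis using val_eq[OF assms m(1)] by (auto simp: Gamma_star_def)
qed

lemma val_integrable:
  assumes lam: "lam0 \<le> lam"
  shows "integrable P0 (val lam)"
proof -
  obtain D \<eta> where D: "0 < \<eta>" "0 \<le> D"
    "\<And>lam x \<gamma>. lam0 \<le> lam \<Longrightarrow> x \<in> good \<Longrightarrow> F lam \<gamma> x \<le> D * (1 + (\<beta> \<bullet> x)\<^sup>2) + lam * sqrt \<delta> - \<eta> * (\<gamma>\<^sup>2 * k x)"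
    using F_upper by metis
  obtain D' where D': "0 \<le> D'" "\<And>u. - D' * (1 + u\<^sup>2) \<le> l u" using l_lower by metis
  show ?thesis
  proof (rule Bochner_Integration.integrable_bound[OF integrable_quadratic[of "D + D'" "\<bar>lam * sqrt \<delta>\<bar>"]])
    have "norm (val lam x) \<le> norm ((D + D') * (1 + (\<beta> \<bullet> x)\<^sup>2) + \<bar>lam * sqrt \<delta>\<bar>)" if x: "x \<in> good" for x
    proof -
      let ?q = "1 + (\<beta> \<bullet> x)\<^sup>2"
      have "0 \<le> \<eta> * ((select (\<lambda>\<gamma>. \<gamma>) lam x)\<^sup>2 * k x)" using D(1) k_pos[of x] by simp
      then have "val lam x \<le> D * ?q + lam * sqrt \<delta>"
        using D(3)[OF lam x, of "select (\<lambda>\<gamma>. \<gamma>) lam x"] unfolding val_def by linarith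
      moreover have "- D' * ?q + lam * sqrt \<delta> \<le> val lam x"
        using F_le_val[OF lam x, of 0] D'(2)[of "\<beta> \<bullet> x"] by (simp add: dual_F_def)
      moreover have "0 \<le> D * ?q" "0 \<le> D' * ?q" using D(2) D'(1) by auto
      moreover have "(D + D') * ?q = D * ?q + D' * ?q" by (rule distrib_right)
      ultimately show ?thesis unfolding real_norm_def by linarith
    qed
    then show "AE x in P0. norm (val lam x) \<le> norm ((D + D') * (1 + (\<beta> \<bullet> x)\<^sup>2) + \<bar>lam * sqrt \<delta>\<bar>)"
      using AE_good by auto
  qed (use lam in measurable)
qed

lemma dual_obj_eq:
  assumes "lam0 \<le> lam"
  shows "dual_obj \<delta> P0 l A \<beta> lam = ereal (integral\<^sup>L P0 (val lam))"
  unfolding dual_obj_def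
  by (rule ext_expectation_AE_eq_integral[OF val_integrable[OF assms]])
    (use AE_good loss_rob_eq_val[OF assms] in auto)

end

subsection \<open>Weak duality and its attainment\<close>

context growth_bounded_dual
begin

lemma lam_pos: "lam0 \<le> lam \<Longrightarrow> 0 < lam"
proof -
  have "0 \<le> r * sqrt \<delta> * K" using r k0 sqrt_delta by simp
  then show "lam0 \<le> lam \<Longrightarrow> 0 < lam" using lam0 by linarith
qed

text \<open>This is the \<open>\<gamma>\<close> for which \<open>X_star\<close> has the same inner
  product with \<open>\<beta>\<close> as \<open>x'\<close>. The penalty then is the cheapest cost of
  reaching that inner product, up to the factor \<open>lam / sqrt \<delta>\<close> and a
  constant.\<close>

lemma F_transport:
  "F lam ((\<beta> \<bullet> (x' - x)) / (sqrt \<delta> * k x)) x =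
     l (\<beta> \<bullet> x') - lam / sqrt \<delta> * ((\<beta> \<bullet> (x' - x))\<^sup>2 / k x) + lam * sqrt \<delta>"
proof -
  define t where "t = \<beta> \<bullet> (x' - x)"
  define s where "s = sqrt \<delta>"
  have s: "s > 0" using sqrt_delta s_def by simp
  have a: "\<beta> \<bullet> x + t = \<beta> \<bullet> x'" by (simp add: t_def inner_diff_right)
  have b: "t / (s * k x) * s * k x = t" using s k_pos[of x] by simp
  have "lam * s * ((t / (s * k x))\<^sup>2 * k x - 1) = lam / s * (t\<^sup>2 / k x) - lam * s"
    using s k_pos[of x] by (simp add: power2_eq_square field_simps)
  then show ?thesis unfolding dual_F_def t_def[symmetric] s_def[symmetric] b a by simp
qed

lemma inner_square_le_cost: "(\<beta> \<bullet> (x' - x))\<^sup>2 / k x \<le> state_cost A x x'"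
proof -
  have "(\<beta> \<bullet> (x' - x))\<^sup>2 = (\<beta> \<bullet> (x - x'))\<^sup>2" by (simp add: inner_diff_right power2_eq_square algebra_simps)
  then show ?thesis
    using inner_square_le_inv_quad[OF spd, where b=\<beta> and v="x - x'" and x=x] k_pos[of x]
    by (simp add: state_cost_def field_simps)
qed

lemma loss_le_val_cost:
  assumes "lam0 \<le> lam" "x \<in> good"
  shows "l (\<beta> \<bullet> x') \<le> val lam x - lam * sqrt \<delta> + lam / sqrt \<delta> * state_cost A x x'"
proof -
  have "lam / sqrt \<delta> * ((\<beta> \<bullet> (x' - x))\<^sup>2 / k x) \<le> lam / sqrt \<delta> * state_cost A x x'"
    using lam_pos[OF assms(1)] sqrt_delta by (intro mult_left_mono inner_square_le_cost) auto
  then show ?thesis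
    using F_le_val[OF assms, of "(\<beta> \<bullet> (x' - x)) / (sqrt \<delta> * k x)"] unfolding F_transport by linarith
qed

lemma state_cost_nonneg: "0 \<le> state_cost A x x'"
  unfolding state_cost_def by (rule sym_pos_def_nonneg[OF spd])

text \<open>The infimum over couplings is not known to be attained here; the slack \<open>e\<close>
  replaces an optimal coupling.\<close>

lemma transport_ball_coupling:
  assumes "P \<in> transport_ball \<delta> P0 A" "0 < e"
  obtains \<pi> where "\<pi> \<in> couplings P0 P"
    "(\<integral>\<^sup>+ z. ennreal (state_cost A (fst z) (snd z)) \<partial>\<pi>) \<le> ennreal (\<delta> + e)"
proof -
  have "transport_cost A P0 P < ennreal (\<delta> + e)"
    using assms delta by (auto simp: transport_ball_def ennreal_less_iff intro: le_less_trans)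
  then show ?thesis unfolding transport_cost_def INF_less_iff using that by (meson less_imp_le)
qed

lemma couplings_measurable:
  assumes "\<pi> \<in> couplings P0 P"
  shows "fst \<in> borel_measurable \<pi>" "snd \<in> borel_measurable \<pi>"
    "(\<lambda>z. state_cost A (fst z) (snd z)) \<in> borel_measurable \<pi>"
proof -
  have "sets \<pi> = sets borel" using assms by (simp add: couplings_def)
  note * = measurable_cong_sets[OF this refl]
  show "fst \<in> borel_measurable \<pi>" "snd \<in> borel_measurable \<pi>"
    unfolding * by (intro borel_measurable_continuous_onI continuous_intros)+
  show "(\<lambda>z. state_cost A (fst z) (snd z)) \<in> borel_measurable \<pi>"
    unfolding * by (rule state_cost_measurable[OF lsc])
qed

lemma couplings_integrable_fst:
  fixes f :: "real^'n \<Rightarrow> real"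
  assumes \<pi>: "\<pi> \<in> couplings P0 P" and f: "integrable P0 f"
  shows "integrable \<pi> (\<lambda>z. f (fst z))" "(\<integral>z. f (fst z) \<partial>\<pi>) = integral\<^sup>L P0 f"
proof -
  have d: "distr \<pi> borel fst = P0" using \<pi> by (simp add: couplings_def)
  have m: "f \<in> borel_measurable borel" using borel_measurable_integrable[OF f] by simp
  show "integrable \<pi> (\<lambda>z. f (fst z))"
    using integrable_distr[OF couplings_measurable(1)[OF \<pi>], of f] f by (simp add: d)
  show "(\<integral>z. f (fst z) \<partial>\<pi>) = integral\<^sup>L P0 f"
    using integral_distr[OF couplings_measurable(1)[OF \<pi>] m] by (simp add: d)
qed

lemma couplings_AE_fst:
  assumes \<pi>: "\<pi> \<in> couplings P0 P" and "AE x in P0. Q x"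
  shows "AE z in \<pi>. Q (fst z)"
proof -
  have d: "distr \<pi> borel fst = P0" using \<pi> by (simp add: couplings_def)
  show ?thesis
    by (rule AE_distrD[OF couplings_measurable(1)[OF \<pi>]]) (unfold d, rule assms(2))
qed

lemma couplings_loss:
  assumes \<pi>: "\<pi> \<in> couplings P0 P" and e: "0 \<le> e"
    and c: "(\<integral>\<^sup>+ z. ennreal (state_cost A (fst z) (snd z)) \<partial>\<pi>) \<le> ennreal e"
  shows "integrable \<pi> (\<lambda>z. state_cost A (fst z) (snd z))"
    "(\<integral>z. state_cost A (fst z) (snd z) \<partial>\<pi>) \<le> e"
    "integrable \<pi> (\<lambda>z. l (\<beta> \<bullet> snd z))"
proof -
  interpret \<pi>: prob_space \<pi> using \<pi> by (simp add: couplings_def)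
  note [measurable] = couplings_measurable[OF \<pi>]
  let ?c = "\<lambda>z. state_cost A (fst z) (snd z)"
  show ic: "integrable \<pi> ?c"
    by (rule integrableI_nonneg) (use c state_cost_nonneg in \<open>auto intro: le_less_trans\<close>)
  show "(\<integral>z. ?c z \<partial>\<pi>) \<le> e"
    using c e nn_integral_eq_integral[OF ic] state_cost_nonneg by (simp add: ennreal_le_iff)
  obtain D where D: "0 \<le> D" "\<And>u. - D * (1 + u\<^sup>2) \<le> l u" using l_lower by metis
  let ?w = "\<lambda>z. (D + \<bar>C\<bar> + r) * (1 + 2 * (\<beta> \<bullet> fst z)\<^sup>2 + 2 * K * ?c z)"
  show "integrable \<pi> (\<lambda>z. l (\<beta> \<bullet> snd z))"
  proof (rule Bochner_Integration.integrable_bound[of _ ?w])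
    show "integrable \<pi> ?w"
      using couplings_integrable_fst(1)[OF \<pi> integrable_inner_square] ic by simp
    have "norm (l (\<beta> \<bullet> snd z)) \<le> norm (?w z)" if good: "fst z \<in> good" for z
    proof -
      let ?u = "\<beta> \<bullet> fst z" and ?v = "\<beta> \<bullet> snd z"
      have "(?v - ?u)\<^sup>2 \<le> k (fst z) * ?c z"
        using inner_square_le_cost[of "snd z" "fst z"] k_pos[of "fst z"] by (simp add: inner_diff_right field_simps)
      also have "\<dots> \<le> K * ?c z" using good state_cost_nonneg by (intro mult_right_mono) (auto simp: good_def)
      finally have "(?v - ?u)\<^sup>2 \<le> K * ?c z" .
      \<comment> \<open>Equivalent to
        \<open>?v\<^sup>2 \<le> 2 * ?u\<^sup>2 + 2 * (?v - ?u)\<^sup>2\<close>.\<close>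
      moreover have "0 \<le> (?v - 2 * ?u)\<^sup>2" by simp
      ultimately have v2: "?v\<^sup>2 \<le> 2 * ?u\<^sup>2 + 2 * K * ?c z" by (simp add: power2_eq_square algebra_simps)
      have "\<bar>l ?v\<bar> \<le> D * (1 + ?v\<^sup>2) + (\<bar>C\<bar> + r * ?v\<^sup>2)"
        using D(2)[of ?v] growth[of ?v] D(1) r
        by (smt (verit) mult_minus_left mult_nonneg_nonneg zero_le_power2)
      also have "\<dots> \<le> (D + \<bar>C\<bar> + r) * (1 + ?v\<^sup>2)"
        using D(1) r by (simp add: distrib_left distrib_right)
      also have "\<dots> \<le> ?w z" using v2 D(1) r by (intro mult_left_mono) auto
      finally show ?thesis by simp
    qed
    then show "AE z in \<pi>. norm (l (\<beta> \<bullet> snd z)) \<le> norm (?w z)"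
      using couplings_AE_fst[OF \<pi> AE_good] by auto
  qed measurable
qed

text \<open>Keeping the integral of the pointwise gap serves two purposes: its sign gives weak
  duality, and its smallness for almost optimal couplings gives uniqueness.\<close>

lemma couplings_duality_gap:
  assumes \<pi>: "\<pi> \<in> couplings P0 P" and e: "0 \<le> e" and lam: "lam0 \<le> lam"
    and c: "(\<integral>\<^sup>+ z. ennreal (state_cost A (fst z) (snd z)) \<partial>\<pi>) \<le> ennreal (\<delta> + e)"
  defines "gap \<equiv> \<lambda>z. val lam (fst z) - lam * sqrt \<delta> + lam / sqrt \<delta> * state_cost A (fst z) (snd z) - l (\<beta> \<bullet> snd z)"
  shows "integrable \<pi> gap" "AE z in \<pi>. 0 \<le> gap z"
    "integral\<^sup>L \<pi> gap + (\<integral>x. l (\<beta> \<bullet> x) \<partial>P) \<le> integral\<^sup>L P0 (val lam) + lam / sqrt \<delta> * e"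
proof -
  interpret \<pi>: prob_space \<pi> using \<pi> by (simp add: couplings_def)
  note [measurable] = couplings_measurable[OF \<pi>]
  have e': "0 \<le> \<delta> + e" using e delta by simp
  note cl = couplings_loss[OF \<pi> e' c]
  note cv = couplings_integrable_fst[OF \<pi> val_integrable[OF lam]]
  show "integrable \<pi> gap" unfolding gap_def using cl cv by simp
  show "AE z in \<pi>. 0 \<le> gap z"
    using couplings_AE_fst[OF \<pi> AE_good] by eventually_elim (use loss_le_val_cost[OF lam] in \<open>auto simp: gap_def\<close>)
  have P: "distr \<pi> borel snd = P" using \<pi> by (simp add: couplings_def)
  have "(\<integral>x. l (\<beta> \<bullet> x) \<partial>P) = (\<integral>z. l (\<beta> \<bullet> snd z) \<partial>\<pi>)"
    unfolding P[symmetric] by (rule integral_distr) auto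
  moreover have "integral\<^sup>L \<pi> gap = integral\<^sup>L P0 (val lam) - lam * sqrt \<delta>
      + lam / sqrt \<delta> * (\<integral>z. state_cost A (fst z) (snd z) \<partial>\<pi>) - (\<integral>z. l (\<beta> \<bullet> snd z) \<partial>\<pi>)"
    unfolding gap_def using cl cv by (simp add: \<pi>.prob_space)
  moreover have "lam / sqrt \<delta> * (\<integral>z. state_cost A (fst z) (snd z) \<partial>\<pi>) \<le> lam / sqrt \<delta> * (\<delta> + e)"
    using lam_pos[OF lam] sqrt_delta cl by (intro mult_left_mono) auto
  moreover have "lam / sqrt \<delta> * (\<delta> + e) = lam * sqrt \<delta> + lam / sqrt \<delta> * e"
    using sqrt_delta by (simp add: field_simps)
  ultimately show "integral\<^sup>L \<pi> gap + (\<integral>x. l (\<beta> \<bullet> x) \<partial>P) \<le> integral\<^sup>L P0 (val lam) + lam / sqrt \<delta> * e"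
    by linarith
qed

lemma expected_loss_eq:
  assumes P: "P \<in> transport_ball \<delta> P0 A"
  shows "expected_loss l \<beta> P = ereal (\<integral>x. l (\<beta> \<bullet> x) \<partial>P)"
proof -
  obtain \<pi> where \<pi>: "\<pi> \<in> couplings P0 P"
    "(\<integral>\<^sup>+ z. ennreal (state_cost A (fst z) (snd z)) \<partial>\<pi>) \<le> ennreal (\<delta> + 1)"
    using transport_ball_coupling[OF P, of 1] by auto
  note [measurable] = couplings_measurable[OF \<pi>(1)]
  have d: "distr \<pi> borel snd = P" using \<pi> by (simp add: couplings_def)
  have "integrable \<pi> (\<lambda>z. l (\<beta> \<bullet> snd z))" using couplings_loss(3)[OF \<pi>(1) _ \<pi>(2)] delta by simp
  then have "integrable (distr \<pi> borel snd) (\<lambda>x. l (\<beta> \<bullet> x))" by (subst integrable_distr_eq) auto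
  then have "integrable P (\<lambda>x. l (\<beta> \<bullet> x))" by (simp add: d)
  then show ?thesis unfolding expected_loss_def by (rule ext_expectation_AE_eq_integral) simp
qed

lemma weak_duality:
  assumes P: "P \<in> transport_ball \<delta> P0 A" and lam: "lam0 \<le> lam"
  shows "(\<integral>x. l (\<beta> \<bullet> x) \<partial>P) \<le> integral\<^sup>L P0 (val lam)"
proof (rule field_le_epsilon)
  fix e :: real assume e: "0 < e"
  define e' where "e' = e * sqrt \<delta> / lam"
  have e': "0 < e'" using e sqrt_delta lam_pos[OF lam] by (simp add: e'_def)
  obtain \<pi> where \<pi>: "\<pi> \<in> couplings P0 P"
    "(\<integral>\<^sup>+ z. ennreal (state_cost A (fst z) (snd z)) \<partial>\<pi>) \<le> ennreal (\<delta> + e')"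
    using transport_ball_coupling[OF P e'] by auto
  have eq: "lam / sqrt \<delta> * e' = e" using sqrt_delta lam_pos[OF lam] by (simp add: e'_def)
  note g = couplings_duality_gap[OF \<pi>(1) less_imp_le[OF e'] lam \<pi>(2)]
  show "(\<integral>x. l (\<beta> \<bullet> x) \<partial>P) \<le> integral\<^sup>L P0 (val lam) + e"
    using g(3) integral_nonneg_AE[OF g(2)] unfolding eq by linarith
qed

section \<open>Transports driven by maximisers: cost, law and optimality\<close>

lemma state_cost_X_star: "state_cost A x (X_star \<delta> A \<beta> x g) = \<delta> * (g\<^sup>2 * k x)"
proof -
  define w where "w = matrix_inv (A x) *v \<beta>"
  have "x - X_star \<delta> A \<beta> x g = (- (sqrt \<delta> * g)) *\<^sub>R w" by (simp add: X_star_def w_def)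
  then have "state_cost A x (X_star \<delta> A \<beta> x g) = (sqrt \<delta> * g)\<^sup>2 * (w \<bullet> (A x *v w))"
    unfolding state_cost_def by (simp only: matrix_vector_mult_scaleR inner_scaleR_left inner_scaleR_right)
      (simp add: power2_eq_square)
  also have "w \<bullet> (A x *v w) = k x" unfolding w_def by (rule inv_quad_eq[OF spd refl])
  finally show ?thesis using delta by (simp add: power_mult_distrib)
qed

lemma inner_X_star: "\<beta> \<bullet> X_star \<delta> A \<beta> x g = \<beta> \<bullet> x + g * sqrt \<delta> * k x"
  by (simp add: X_star_def inv_quad_def inner_add_right mult_ac)

text \<open>The pair of \<open>X\<close> and its image is a coupling of cost exactly
  \<open>\<delta>\<close>, and its loss meets the bound of weak duality. \<open>G\<close> may use
  randomness beyond \<open>X\<close>, as a mixture does.\<close>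

lemma worst_case_law_X_star:
  fixes M :: "'w measure"
  assumes lam: "lam0 \<le> lam" and M: "prob_space M"
    and X [measurable]: "X \<in> borel_measurable M" and G [measurable]: "G \<in> borel_measurable M"
    and XP0: "distr M borel X = P0" and opt: "AE \<omega> in M. G \<omega> \<in> \<Gamma> lam (X \<omega>)"
    and int: "integrable M (\<lambda>\<omega>. (G \<omega>)\<^sup>2 * k (X \<omega>))" and one: "(\<integral>\<omega>. (G \<omega>)\<^sup>2 * k (X \<omega>) \<partial>M) = 1"
  shows "worst_case \<delta> P0 l A \<beta> (law_X_star \<delta> A \<beta> M X G)" "cost_X_star \<delta> A \<beta> M X G = ennreal \<delta>"
    "expected_loss l \<beta> (law_X_star \<delta> A \<beta> M X G) = ereal (integral\<^sup>L P0 (val lam))"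
proof -
  interpret M: prob_space M by (rule M)
  have [measurable]: "(\<lambda>\<omega>. X_star \<delta> A \<beta> (X \<omega>) (G \<omega>)) \<in> borel_measurable M"
    by (rule X_star_measurable[OF lsc spd X G])
  let ?Y = "\<lambda>\<omega>. X_star \<delta> A \<beta> (X \<omega>) (G \<omega>)"
  let ?P = "law_X_star \<delta> A \<beta> M X G"
  have P: "?P = distr M borel ?Y" by (simp add: law_X_star_def)
  have "(\<integral>\<^sup>+ \<omega>. ennreal (state_cost A (X \<omega>) (?Y \<omega>)) \<partial>M) = ennreal (\<integral>\<omega>. \<delta> * ((G \<omega>)\<^sup>2 * k (X \<omega>)) \<partial>M)"
    unfolding state_cost_X_star using int delta k_pos
    by (intro nn_integral_eq_integral) (auto intro!: mult_nonneg_nonneg simp: less_imp_le)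
  also have "\<dots> = ennreal \<delta>" using one by simp
  finally show cost: "cost_X_star \<delta> A \<beta> M X G = ennreal \<delta>" by (simp add: cost_X_star_def)
  define \<pi> where "\<pi> = distr M borel (\<lambda>\<omega>. (X \<omega>, ?Y \<omega>))"
  have [measurable]: "(\<lambda>\<omega>. (X \<omega>, ?Y \<omega>)) \<in> borel_measurable M" by measurable
  have [measurable]: "(fst :: (real^'n) \<times> (real^'n) \<Rightarrow> _) \<in> borel_measurable borel" "(snd :: (real^'n) \<times> (real^'n) \<Rightarrow> _) \<in> borel_measurable borel"
    by (intro borel_measurable_continuous_onI continuous_intros)+
  have pc: "\<pi> \<in> couplings P0 ?P"
    unfolding couplings_def \<pi>_def P
    by (auto simp: distr_distr comp_def XP0 intro: M.prob_space_distr)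
  have pcost: "(\<integral>\<^sup>+ z. ennreal (state_cost A (fst z) (snd z)) \<partial>\<pi>) = ennreal \<delta>"
  proof -
    have [measurable]: "(\<lambda>z. state_cost A (fst z) (snd z)) \<in> borel_measurable borel"
      by (rule state_cost_measurable[OF lsc])
    show ?thesis unfolding \<pi>_def using cost by (subst nn_integral_distr) (auto simp: cost_X_star_def)
  qed
  have "transport_cost A P0 ?P \<le> ennreal \<delta>"
    unfolding transport_cost_def pcost[symmetric] by (rule INF_lower[OF pc])
  then have ball: "?P \<in> transport_ball \<delta> P0 A"
    unfolding transport_ball_def by (auto simp: P intro: M.prob_space_distr)
  have val_int: "integrable M (\<lambda>\<omega>. val lam (X \<omega>))"
    by (rule integrable_distr[OF X]) (unfold XP0, rule val_integrable[OF lam])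
  have val_eq': "(\<integral>\<omega>. val lam (X \<omega>) \<partial>M) = integral\<^sup>L P0 (val lam)"
    using integral_distr[OF X, of "val lam"] lam by (simp add: XP0)
  have "AE \<omega> in M. X \<omega> \<in> good" using AE_good by (intro AE_distrD[OF X]) (unfold XP0)
  \<comment> \<open>Complementary slackness: on \<Gamma> the loss is the robustified loss plus a
    multiple of \<open>(G \<omega>)\<^sup>2 * k (X \<omega>) - 1\<close>, whose expectation
    vanishes.\<close>
  then have "AE \<omega> in M. l (\<beta> \<bullet> ?Y \<omega>) = val lam (X \<omega>) + lam * sqrt \<delta> * ((G \<omega>)\<^sup>2 * k (X \<omega>) - 1)"
    using opt
  proof eventually_elim
    case (elim \<omega>)
    from val_eq[OF lam elim] show ?case by (simp add: dual_F_def inner_X_star)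
  qed
  then have "(\<integral>\<omega>. l (\<beta> \<bullet> ?Y \<omega>) \<partial>M) = (\<integral>\<omega>. val lam (X \<omega>) + lam * sqrt \<delta> * ((G \<omega>)\<^sup>2 * k (X \<omega>) - 1) \<partial>M)"
    using lam by (intro integral_cong_AE) measurable
  also have "\<dots> = integral\<^sup>L P0 (val lam)" using int val_int one val_eq' by (simp add: M.prob_space)
  finally have "(\<integral>x. l (\<beta> \<bullet> x) \<partial>?P) = integral\<^sup>L P0 (val lam)"
    unfolding P by (subst integral_distr) auto
  then show el: "expected_loss l \<beta> ?P = ereal (integral\<^sup>L P0 (val lam))"
    using expected_loss_eq[OF ball] by simp
  have "(SUP Q\<in>transport_ball \<delta> P0 A. expected_loss l \<beta> Q) = ereal (integral\<^sup>L P0 (val lam))"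
  proof (rule antisym)
    show "(SUP Q\<in>transport_ball \<delta> P0 A. expected_loss l \<beta> Q) \<le> ereal (integral\<^sup>L P0 (val lam))"
      by (intro SUP_least) (use weak_duality[OF _ lam] expected_loss_eq in auto)
    show "ereal (integral\<^sup>L P0 (val lam)) \<le> (SUP Q\<in>transport_ball \<delta> P0 A. expected_loss l \<beta> Q)"
      using SUP_upper[OF ball, of "expected_loss l \<beta>"] el by simp
  qed
  then show "worst_case \<delta> P0 l A \<beta> ?P" unfolding worst_case_def using ball el by simp
qed

text \<open>With \<open>c1\<close>, \<open>c2\<close> the two second moments and \<open>p\<close>
  the probability of \<open>Z = 1\<close>, independence gives the mixture the second moment
  \<open>p * c1 + (1 - p) * c2\<close>, and \<open>p\<close> is the solution of setting this to 1.
  Stated for arbitrary selections, since it serves both the infimum and supremum and the extremal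
  moduli.\<close>

lemma worst_case_bernoulli_mixing:
  fixes M :: "'w measure"
  assumes lam: "lam0 \<le> lam"
    and g1 [measurable]: "g1 \<in> borel_measurable borel" and g2 [measurable]: "g2 \<in> borel_measurable borel"
    and opt1: "AE x in P0. g1 x \<in> \<Gamma> lam x" and opt2: "AE x in P0. g2 x \<in> \<Gamma> lam x"
    and int1: "integrable P0 (\<lambda>x. (g1 x)\<^sup>2 * k x)" and int2: "integrable P0 (\<lambda>x. (g2 x)\<^sup>2 * k x)"
    and mix: "bernoulli_mixing P0 A \<beta> g1 g2 M X Z"
    and G: "G = (\<lambda>\<omega>. Z \<omega> * g1 (X \<omega>) + (1 - Z \<omega>) * g2 (X \<omega>))"
  shows "worst_case \<delta> P0 l A \<beta> (law_X_star \<delta> A \<beta> M X G)" "cost_X_star \<delta> A \<beta> M X G = ennreal \<delta>"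
proof -
  have M: "prob_space M" and X [measurable]: "X \<in> borel_measurable M" and Z [measurable]: "Z \<in> borel_measurable M"
    and XP0: "distr M borel X = P0"
    and indep: "prob_space.indep_set M {X -` S \<inter> space M | S. S \<in> sets borel}
       {Z -` T \<inter> space M | T. T \<in> sets borel}"
    and Z01: "AE \<omega> in M. Z \<omega> \<in> {0, 1}"
    using mix unfolding bernoulli_mixing_def by auto
  interpret M: prob_space M by (rule M)
  \<comment> \<open>\<open>X\<close> and \<open>Z\<close> take values in different types; composing
    \<open>X\<close> with a real function brings independence into the form that the product rule
    for expectations requires.\<close>
  have indep_phi: "M.indep_var borel Z borel (\<lambda>\<omega>. \<phi> (X \<omega>))"
    if [measurable]: "\<phi> \<in> borel_measurable borel" for \<phi> :: "real^'n \<Rightarrow> real"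
  proof (unfold M.indep_var_eq, intro conjI M.indep_set_sigma_sets)
    show "M.indep_set {Z -` T \<inter> space M |T. T \<in> sets borel} {(\<lambda>\<omega>. \<phi> (X \<omega>)) -` S \<inter> space M |S. S \<in> sets borel}"
    proof (rule M.indep_setI)
      fix a b assume "a \<in> {Z -` T \<inter> space M |T. T \<in> sets borel}"
        and "b \<in> {(\<lambda>\<omega>. \<phi> (X \<omega>)) -` S \<inter> space M |S. S \<in> sets borel}"
      then obtain T S where TS: "a = Z -` T \<inter> space M" "T \<in> sets borel"
        "b = (\<lambda>\<omega>. \<phi> (X \<omega>)) -` S \<inter> space M" "S \<in> sets borel" by auto
      have "\<phi> -` S \<in> sets borel" using measurable_sets_borel[OF that TS(4)] by simp
      moreover have "b = X -` (\<phi> -` S) \<inter> space M" using TS(3) by auto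
      ultimately have "b \<in> {X -` S \<inter> space M | S. S \<in> sets borel}" by auto
      moreover have "a \<in> {Z -` T \<inter> space M | T. T \<in> sets borel}" using TS by auto
      ultimately have "M.prob (b \<inter> a) = M.prob b * M.prob a" using M.indep_setD[OF indep] by auto
      then show "M.prob (a \<inter> b) = M.prob a * M.prob b" by (simp add: Int_commute mult.commute)
    qed (auto intro: measurable_sets)
    have Int: "Int_stable {f -` S \<inter> space M |S. S \<in> sets (borel :: real measure)}" for f
    proof (rule Int_stableI)
      fix a b assume "a \<in> {f -` S \<inter> space M |S. S \<in> sets (borel :: real measure)}"
        "b \<in> {f -` S \<inter> space M |S. S \<in> sets (borel :: real measure)}"
      then obtain S T where "a = f -` S \<inter> space M" "b = f -` T \<inter> space M" "S \<in> sets borel" "T \<in> sets borel" by auto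
      then show "a \<inter> b \<in> {f -` S \<inter> space M |S. S \<in> sets (borel :: real measure)}"
        by (auto intro!: exI[of _ "S \<inter> T"])
    qed
    show "Int_stable {Z -` T \<inter> space M |T. T \<in> sets borel}"
      "Int_stable {(\<lambda>\<omega>. \<phi> (X \<omega>)) -` S \<inter> space M |S. S \<in> sets borel}" by (rule Int)+
  qed measurable
  define p where "p = M.prob {\<omega> \<in> space M. Z \<omega> = 1}"
  have iZ: "integrable M Z"
    by (rule M.integrable_const_bound[of _ 1]) (use Z01 in auto)
  have eZ: "(\<integral>\<omega>. Z \<omega> \<partial>M) = p"
  proof -
    have "AE \<omega> in M. Z \<omega> = indicator {\<omega> \<in> space M. Z \<omega> = 1} \<omega>"
      using Z01 AE_space by eventually_elim (auto simp: indicator_def)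
    then have "(\<integral>\<omega>. Z \<omega> \<partial>M) = (\<integral>\<omega>. indicator {\<omega> \<in> space M. Z \<omega> = 1} \<omega> \<partial>M)"
      by (intro integral_cong_AE) auto
    then show ?thesis by (simp add: p_def)
  qed
  define \<phi>1 where "\<phi>1 x = (g1 x)\<^sup>2 * k x" for x
  define \<phi>2 where "\<phi>2 x = (g2 x)\<^sup>2 * k x" for x
  have [measurable]: "\<phi>1 \<in> borel_measurable borel" "\<phi>2 \<in> borel_measurable borel"
    unfolding \<phi>1_def[abs_def] \<phi>2_def[abs_def] by measurable
  have push: "integrable M (\<lambda>\<omega>. \<phi> (X \<omega>))" "(\<integral>\<omega>. \<phi> (X \<omega>) \<partial>M) = integral\<^sup>L P0 \<phi>"
    if i: "integrable P0 \<phi>" and [measurable]: "\<phi> \<in> borel_measurable borel" for \<phi> :: "real^'n \<Rightarrow> real"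
    using i integrable_distr[OF X, of \<phi>] integral_distr[OF X, of \<phi>] by (auto simp: XP0)
  have i\<phi>: "integrable P0 \<phi>1" "integrable P0 \<phi>2" using int1 int2 by (simp_all add: \<phi>1_def[abs_def] \<phi>2_def[abs_def])
  note push1 = push[OF i\<phi>(1)] and push2 = push[OF i\<phi>(2)]
  have prod1: "integrable M (\<lambda>\<omega>. Z \<omega> * \<phi>1 (X \<omega>))" "(\<integral>\<omega>. Z \<omega> * \<phi>1 (X \<omega>) \<partial>M) = p * integral\<^sup>L P0 \<phi>1"
    using M.indep_var_integrable[OF indep_phi iZ push1(1)] M.indep_var_lebesgue_integral[OF indep_phi iZ push1(1)]
      push1(2) eZ by auto
  have prod2: "integrable M (\<lambda>\<omega>. Z \<omega> * \<phi>2 (X \<omega>))" "(\<integral>\<omega>. Z \<omega> * \<phi>2 (X \<omega>) \<partial>M) = p * integral\<^sup>L P0 \<phi>2"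
    using M.indep_var_integrable[OF indep_phi iZ push2(1)] M.indep_var_lebesgue_integral[OF indep_phi iZ push2(1)]
      push2(2) eZ by auto
  have [measurable]: "G \<in> borel_measurable M" unfolding G by measurable
  \<comment> \<open>The mixed term carries the factor \<open>Z \<omega> * (1 - Z \<omega>)\<close>,
    which vanishes almost surely.\<close>
  have Geq: "AE \<omega> in M. (G \<omega>)\<^sup>2 * k (X \<omega>) = Z \<omega> * \<phi>1 (X \<omega>) + (\<phi>2 (X \<omega>) - Z \<omega> * \<phi>2 (X \<omega>))"
    using Z01 by eventually_elim (auto simp: G \<phi>1_def \<phi>2_def)
  have iR: "integrable M (\<lambda>\<omega>. Z \<omega> * \<phi>1 (X \<omega>) + (\<phi>2 (X \<omega>) - Z \<omega> * \<phi>2 (X \<omega>)))"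
    using prod1 prod2 push2 by simp
  have iG: "integrable M (\<lambda>\<omega>. (G \<omega>)\<^sup>2 * k (X \<omega>))"
    by (subst integrable_cong_AE[OF _ _ Geq]) (use iR in auto)
  have "(\<integral>\<omega>. (G \<omega>)\<^sup>2 * k (X \<omega>) \<partial>M) = (\<integral>\<omega>. Z \<omega> * \<phi>1 (X \<omega>) + (\<phi>2 (X \<omega>) - Z \<omega> * \<phi>2 (X \<omega>)) \<partial>M)"
    by (rule integral_cong_AE[OF _ _ Geq]) auto
  also have "\<dots> = p * integral\<^sup>L P0 \<phi>1 + (integral\<^sup>L P0 \<phi>2 - p * integral\<^sup>L P0 \<phi>2)"
    using prod1 prod2 push2 by simp
  also have "\<dots> = 1"
  proof -
    have c: "second_moment P0 A \<beta> g1 = integral\<^sup>L P0 \<phi>1" "second_moment P0 A \<beta> g2 = integral\<^sup>L P0 \<phi>2"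
      by (simp_all add: second_moment_def \<phi>1_def[abs_def] \<phi>2_def[abs_def])
    have "if integral\<^sup>L P0 \<phi>1 = integral\<^sup>L P0 \<phi>2 then integral\<^sup>L P0 \<phi>1 = 1
      else p = (integral\<^sup>L P0 \<phi>2 - 1) / (integral\<^sup>L P0 \<phi>2 - integral\<^sup>L P0 \<phi>1)"
      using mix unfolding bernoulli_mixing_def c p_def Let_def by blast
    then show ?thesis by (auto split: if_splits simp: field_simps)
  qed
  finally have eG: "(\<integral>\<omega>. (G \<omega>)\<^sup>2 * k (X \<omega>) \<partial>M) = 1" .
  have "AE \<omega> in M. g1 (X \<omega>) \<in> \<Gamma> lam (X \<omega>)" "AE \<omega> in M. g2 (X \<omega>) \<in> \<Gamma> lam (X \<omega>)"
    by (rule AE_distrD[OF X], unfold XP0, rule opt1 opt2)+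
  then have GG: "AE \<omega> in M. G \<omega> \<in> \<Gamma> lam (X \<omega>)"
    using Z01 by eventually_elim (auto simp: G)
  show "worst_case \<delta> P0 l A \<beta> (law_X_star \<delta> A \<beta> M X G)" "cost_X_star \<delta> A \<beta> M X G = ennreal \<delta>"
    by (rule worst_case_law_X_star(1,2)[OF lam M X _ XP0 GG iG eG], measurable)+
qed

end

text \<open>The success probability lies between 0 and 1 because the second moments straddle 1; the
  product with a Bernoulli law then carries the mixing variable.\<close>

lemma bernoulli_mixing_exists:
  fixes P0 :: "(real^'n) measure"
  assumes P0: "prob_space P0" and sets [measurable_cong]: "sets P0 = sets borel"
    and c: "second_moment P0 A \<beta> g1 \<le> 1" "1 \<le> second_moment P0 A \<beta> g2"
  shows "\<exists>(M :: ((real^'n) \<times> real) measure) X Z. bernoulli_mixing P0 A \<beta> g1 g2 M X Z"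
proof -
  define c1 c2 where "c1 = second_moment P0 A \<beta> g1" and "c2 = second_moment P0 A \<beta> g2"
  \<comment> \<open>If the moments coincide, both equal 1 and \<open>p = 0 / 0 = 0\<close>, which is
    admissible.\<close>
  define p where "p = (c2 - 1) / (c2 - c1)"
  have p: "0 \<le> p" "p \<le> 1" using c unfolding p_def c1_def[symmetric] c2_def[symmetric]
    by (auto simp: divide_le_eq_1)
  define N where "N = distr (measure_pmf (bernoulli_pmf p)) borel (\<lambda>b. if b then 1 else 0 :: real)"
  interpret P0: prob_space P0 by (rule P0)
  interpret N: prob_space N unfolding N_def by (intro measure_pmf.prob_space_distr) simp
  interpret pair_prob_space P0 N ..
  have sN [measurable_cong]: "sets N = sets borel" by (simp add: N_def)
  have spN: "space P0 = UNIV" "space N = UNIV" using sets_eq_imp_space_eq[OF sets] sets_eq_imp_space_eq[OF sN] by auto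
  let ?M = "P0 \<Otimes>\<^sub>M N"
  have sp: "space ?M = UNIV" using spN by (simp add: space_pair_measure)
  have m1: "measure ?M (S \<times> T) = P0.prob S * N.prob T" if "S \<in> sets borel" "T \<in> sets borel" for S T
    using that sets sN by (simp add: measure_def N.emeasure_pair_measure_Times enn2real_mult)
  have f: "fst -` S \<inter> space ?M = S \<times> UNIV" "snd -` T \<inter> space ?M = UNIV \<times> T" for S :: "(real^'n) set" and T :: "real set"
    using sp by auto
  have "bernoulli_mixing P0 A \<beta> g1 g2 ?M fst snd"
    unfolding bernoulli_mixing_def
  proof (intro conjI)
    show "prob_space ?M" by (rule P.prob_space_axioms)
    show "fst \<in> borel_measurable ?M" "snd \<in> borel_measurable ?M" by measurable
    show "distr ?M borel fst = P0"
      using N.distr_pair_fst[of P0] distr_cong[OF refl sets, of ?M fst fst] by simp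
    show "P.indep_set {fst -` S \<inter> space ?M |S. S \<in> sets borel} {snd -` T \<inter> space ?M |T. T \<in> sets borel}"
    proof (rule P.indep_setI)
      fix a b assume "a \<in> {fst -` S \<inter> space ?M |S. S \<in> sets borel}" "b \<in> {snd -` T \<inter> space ?M |T. T \<in> sets borel}"
      then obtain S T where ST: "S \<in> sets borel" "T \<in> sets borel" "a = S \<times> UNIV" "b = UNIV \<times> T"
        unfolding f by auto
      have "a \<inter> b = S \<times> T" using ST by auto
      moreover have "P0.prob UNIV = 1" "N.prob UNIV = 1" using P0.prob_space N.prob_space spN by auto
      ultimately show "P.prob (a \<inter> b) = P.prob a * P.prob b" using ST by (simp add: m1)
    qed (auto intro!: measurable_sets[OF _ ])
    have "AE z in N. z \<in> {0, 1}" unfolding N_def by (subst AE_distr_iff) auto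
    then show "AE \<omega> in ?M. snd \<omega> \<in> {0, 1}" by (intro AE_pair_measure) auto
    show "let c1 = second_moment P0 A \<beta> g1; c2 = second_moment P0 A \<beta> g2
      in if c1 = c2 then c1 = 1 else measure ?M {\<omega> \<in> space ?M. snd \<omega> = 1} = (c2 - 1) / (c2 - c1)"
    proof -
      have "{\<omega> \<in> space ?M. snd \<omega> = 1} = UNIV \<times> {1}" using sp by auto
      moreover have "N.prob {1} = p"
      proof -
        have "N.prob {1} = measure (measure_pmf (bernoulli_pmf p)) ((\<lambda>b. if b then 1 else 0 :: real) -` {1})"
          unfolding N_def by (subst measure_distr) auto
        also have "(\<lambda>b. if b then 1 else 0 :: real) -` {1} = {True}" by (auto split: if_splits)
        finally show ?thesis using p by (simp add: measure_pmf_single)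
      qed
      moreover have "P0.prob UNIV = 1" using P0.prob_space spN by auto
      ultimately have "measure ?M {\<omega> \<in> space ?M. snd \<omega> = 1} = p" by (simp add: m1)
      then show ?thesis using c by (auto simp: Let_def p_def c1_def c2_def)
    qed
  qed
  then show ?thesis by blast
qed

subsection \<open>First-order optimality of the multiplier\<close>

context growth_bounded_dual
begin

text \<open>\<open>Gamma_bound\<close> confines maximisers for nearby multipliers to a fixed
  interval, and any limit point is a maximiser at \<open>lam\<close> by continuity. The strict bound
  through \<open>h\<close> is the form that lower and upper limits need; \<open>h\<close> is later
  plus or minus \<open>\<gamma>\<^sup>2 * k x\<close>.\<close>

lemma Gamma_upper_hemicontinuous:
  assumes x: "x \<in> good" and mu: "\<And>n. lam0 \<le> mu n" "mu \<longlonglongrightarrow> lam" and g: "\<And>n. g n \<in> \<Gamma> (mu n) x"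
    and h: "continuous_on UNIV h" and m: "\<And>\<gamma>. \<gamma> \<in> \<Gamma> lam x \<Longrightarrow> m \<le> h \<gamma>" and c: "c < m"
  shows "\<forall>\<^sub>F n in sequentially. c < (h (g n) :: real)"
proof (rule ccontr)
  assume "\<not> (\<forall>\<^sub>F n in sequentially. c < h (g n))"
  then obtain q :: "nat \<Rightarrow> nat" where q: "strict_mono q" "\<And>n. \<not> c < h (g (q n))"
    using not_eventually_sequentiallyD by blast
  obtain H where H: "0 \<le> H"
    "\<And>lam x \<gamma>. lam0 \<le> lam \<Longrightarrow> x \<in> good \<Longrightarrow> \<gamma> \<in> \<Gamma> lam x \<Longrightarrow> \<gamma>\<^sup>2 * k x \<le> H * (1 + (\<beta> \<bullet> x)\<^sup>2)"
    using Gamma_bound by metis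
  have "\<bar>g n\<bar> \<le> sqrt (H * (1 + (\<beta> \<bullet> x)\<^sup>2) / k x)" for n
    using H(2)[OF mu(1) x g, of n] k_pos[of x] by (intro real_le_rsqrt) (simp add: field_simps)
  then have "bounded (range (g \<circ> q))" unfolding bounded_iff by (auto intro!: exI)
  then obtain \<gamma> q' where q': "strict_mono (q' :: nat \<Rightarrow> nat)" "((g \<circ> q) \<circ> q') \<longlonglongrightarrow> \<gamma>"
    using bounded_imp_convergent_subsequence by blast
  let ?p = "\<lambda>n. q (q' n)"
  have p: "strict_mono ?p" using strict_mono_o[OF q(1) q'(1)] by (simp add: comp_def)
  have mup: "(\<lambda>n. mu (?p n)) \<longlonglongrightarrow> lam" using LIMSEQ_subseq_LIMSEQ[OF mu(2) p] by (simp add: comp_def)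
  have gp: "(\<lambda>n. g (?p n)) \<longlonglongrightarrow> \<gamma>" using q'(2) by (simp add: comp_def)
  have "F lam c' x \<le> F lam \<gamma> x" for c'
  proof (rule LIMSEQ_le)
    show "(\<lambda>n. F (mu (?p n)) c' x) \<longlonglongrightarrow> F lam c' x"
      unfolding dual_F_def by (intro tendsto_intros mup)
    have "(\<lambda>n. l (\<beta> \<bullet> x + g (?p n) * sqrt \<delta> * k x)) \<longlonglongrightarrow> l (\<beta> \<bullet> x + \<gamma> * sqrt \<delta> * k x)"
      by (rule continuous_on_tendsto_compose[OF l_continuous]) (auto intro!: tendsto_intros gp)
    then show "(\<lambda>n. F (mu (?p n)) (g (?p n)) x) \<longlonglongrightarrow> F lam \<gamma> x"
      unfolding dual_F_def by (intro tendsto_intros mup gp)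
    show "\<exists>N. \<forall>n\<ge>N. F (mu (?p n)) c' x \<le> F (mu (?p n)) (g (?p n)) x"
      using g by (auto simp: Gamma_star_eq)
  qed
  then have "m \<le> h \<gamma>" by (intro m) (simp add: Gamma_star_eq)
  moreover have "(\<lambda>n. h (g (?p n))) \<longlonglongrightarrow> h \<gamma>"
    by (rule continuous_on_tendsto_compose[OF h gp]) auto
  then have "h \<gamma> \<le> c"
    by (rule LIMSEQ_le_const2) (use q(2) in \<open>auto simp: not_less\<close>)
  ultimately show False using c by simp
qed

lemma select_id_in_Gamma:
  assumes "lam0 \<le> lam" "x \<in> good"
  shows "select (\<lambda>\<gamma>. \<gamma>) lam x \<in> \<Gamma> lam x"
  using select_attained[OF assms(1) _ assms(2), of "\<lambda>\<gamma>. \<gamma>"] by auto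

text \<open>A discrete envelope argument: inserting the maximiser for \<open>mu\<close> into the
  problem at \<open>lam\<close> bounds the dual value there from below, and optimality of
  \<open>lam\<close> bounds it from above by the value at \<open>mu\<close>.\<close>

lemma optimizer_slope:
  assumes opt: "dual_optimizer \<delta> P0 l A \<beta> lam" and lam: "lam0 \<le> lam" and mu: "lam0 \<le> mu"
  defines "g \<equiv> select (\<lambda>\<gamma>. \<gamma>) mu"
  shows "integrable P0 (\<lambda>x. (g x)\<^sup>2 * k x)" "(mu - lam) * ((\<integral>x. (g x)\<^sup>2 * k x \<partial>P0) - 1) \<le> 0"
proof -
  interpret prob_space P0 by (rule prob)
  show ig: "integrable P0 (\<lambda>x. (g x)\<^sup>2 * k x)"
    unfolding g_def by (rule integrable_Gamma[OF mu]) (use mu select_id_in_Gamma[OF mu] in auto)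
  have "\<not> dual_obj \<delta> P0 l A \<beta> mu < dual_obj \<delta> P0 l A \<beta> lam"
    using opt lam_pos[OF mu] by (simp add: dual_optimizer_def is_arg_min_def)
  then have "integral\<^sup>L P0 (val lam) \<le> integral\<^sup>L P0 (val mu)"
    unfolding dual_obj_eq[OF lam] dual_obj_eq[OF mu] by simp
  moreover have "(\<integral>x. val mu x + (mu - lam) * sqrt \<delta> * ((g x)\<^sup>2 * k x - 1) \<partial>P0) \<le> integral\<^sup>L P0 (val lam)"
  proof (rule integral_mono_AE)
    show "AE x in P0. val mu x + (mu - lam) * sqrt \<delta> * ((g x)\<^sup>2 * k x - 1) \<le> val lam x"
      using AE_good
    proof eventually_elim
      case (elim x)
      have "F lam (g x) x = val mu x + (mu - lam) * sqrt \<delta> * ((g x)\<^sup>2 * k x - 1)"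
        unfolding val_def g_def dual_F_def by (simp add: algebra_simps)
      then show ?case using F_le_val[OF lam elim, of "g x"] by simp
    qed
  qed (use ig val_integrable[OF lam] val_integrable[OF mu] in auto)
  ultimately have "sqrt \<delta> * ((mu - lam) * ((\<integral>x. (g x)\<^sup>2 * k x \<partial>P0) - 1)) \<le> 0"
    using ig val_integrable[OF mu] by (simp add: prob_space mult_ac)
  then show "(mu - lam) * ((\<integral>x. (g x)\<^sup>2 * k x \<partial>P0) - 1) \<le> 0"
    using sqrt_delta by (simp add: mult_le_0_iff)
qed

text \<open>Maximisers at \<open>\<lambda>\<^sub>n \<down> \<lambda>\<close> have second moment at most \<open>1\<close> by optimality of \<open>\<lambda>\<close>; the limit points of their
  values lie in \<open>\<Gamma>\<close>, so Fatou's lemma transfers the bound to the maximiser of least modulus. Below,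
  the reverse Fatou lemma along \<open>\<lambda>\<^sub>n \<up> \<lambda>\<close> treats the one of largest modulus.\<close>
lemma optimizer_min_second_moment:
  assumes opt: "dual_optimizer \<delta> P0 l A \<beta> lam" and lam: "lam0 \<le> lam"
    and g [measurable]: "g \<in> borel_measurable borel" and gG: "\<And>x. x \<in> good \<Longrightarrow> g x \<in> \<Gamma> lam x"
    and min: "\<And>x \<gamma>. x \<in> good \<Longrightarrow> \<gamma> \<in> \<Gamma> lam x \<Longrightarrow> \<bar>g x\<bar> \<le> \<bar>\<gamma>\<bar>"
  shows "(\<integral>x. (g x)\<^sup>2 * k x \<partial>P0) \<le> 1"
proof -
  define mu where "mu n = lam + inverse (real (Suc n))" for n
  have mu: "lam0 \<le> mu n" "lam < mu n" for n using lam by (auto simp: mu_def intro: order_trans)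
  have mul: "mu \<longlonglongrightarrow> lam" unfolding mu_def
    using tendsto_add[OF tendsto_const LIMSEQ_inverse_real_of_nat, of lam] by simp
  define G where "G n = select (\<lambda>\<gamma>. \<gamma>) (mu n)" for n
  have [measurable]: "G n \<in> borel_measurable borel" for n unfolding G_def using mu by measurable
  have i: "integrable P0 (\<lambda>x. (G n x)\<^sup>2 * k x)" "(\<integral>x. (G n x)\<^sup>2 * k x \<partial>P0) \<le> 1" for n
    using optimizer_slope[OF opt lam mu(1)[of n]] mu(2)[of n] by (auto simp: G_def mult_le_0_iff)
  have "(\<integral>\<^sup>+ x. ennreal ((g x)\<^sup>2 * k x) \<partial>P0) \<le> (\<integral>\<^sup>+ x. liminf (\<lambda>n. ennreal ((G n x)\<^sup>2 * k x)) \<partial>P0)"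
  proof (rule nn_integral_mono_AE)
    show "AE x in P0. ennreal ((g x)\<^sup>2 * k x) \<le> liminf (\<lambda>n. ennreal ((G n x)\<^sup>2 * k x))"
      using AE_good
    proof eventually_elim
      case (elim x)
      show ?case unfolding le_Liminf_iff
      proof safe
        fix y assume y: "y < ennreal ((g x)\<^sup>2 * k x)"
        then obtain c where c: "y = ennreal c" "0 \<le> c" "c < (g x)\<^sup>2 * k x"
          by (metis ennreal_cases ennreal_less_iff less_top_ennreal order_less_trans top.not_eq_extremum)
        have "\<forall>\<^sub>F n in sequentially. c < (G n x)\<^sup>2 * k x"
        proof (rule Gamma_upper_hemicontinuous[OF elim mu(1) mul, of "\<lambda>n. G n x" "\<lambda>\<gamma>. \<gamma>\<^sup>2 * k x" "(g x)\<^sup>2 * k x"])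
          show "G n x \<in> \<Gamma> (mu n) x" for n unfolding G_def by (rule select_id_in_Gamma[OF mu(1) elim])
          show "(g x)\<^sup>2 * k x \<le> \<gamma>\<^sup>2 * k x" if "\<gamma> \<in> \<Gamma> lam x" for \<gamma>
            using min[OF elim that] k_pos[of x] by (intro mult_right_mono) (auto simp: abs_le_square_iff less_imp_le)
        qed (auto intro!: continuous_intros c)
        then show "\<forall>\<^sub>F n in sequentially. y < ennreal ((G n x)\<^sup>2 * k x)"
          by eventually_elim (use c in \<open>auto simp: ennreal_less_iff\<close>)
      qed
    qed
  qed
  also have "\<dots> \<le> liminf (\<lambda>n. \<integral>\<^sup>+ x. ennreal ((G n x)\<^sup>2 * k x) \<partial>P0)"
    by (rule nn_integral_liminf) measurable
  also have "\<dots> \<le> liminf (\<lambda>n::nat. 1)"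
  proof (intro Liminf_mono always_eventually allI)
    fix n
    have "(\<integral>\<^sup>+ x. ennreal ((G n x)\<^sup>2 * k x) \<partial>P0) = ennreal (\<integral>x. (G n x)\<^sup>2 * k x \<partial>P0)"
      using k_pos by (intro nn_integral_eq_integral i) (auto simp: less_imp_le)
    then show "(\<integral>\<^sup>+ x. ennreal ((G n x)\<^sup>2 * k x) \<partial>P0) \<le> 1" using i(2)[of n] by simp
  qed
  also have "liminf (\<lambda>n::nat. 1) = (1::ennreal)" by (simp add: Liminf_const)
  finally have "(\<integral>\<^sup>+ x. ennreal ((g x)\<^sup>2 * k x) \<partial>P0) \<le> 1" .
  moreover have "(\<integral>\<^sup>+ x. ennreal ((g x)\<^sup>2 * k x) \<partial>P0) = ennreal (\<integral>x. (g x)\<^sup>2 * k x \<partial>P0)"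
    using k_pos gG by (intro nn_integral_eq_integral integrable_Gamma[OF lam]) (auto simp: less_imp_le)
  ultimately show ?thesis by simp
qed

lemma optimizer_max_second_moment:
  assumes opt: "dual_optimizer \<delta> P0 l A \<beta> lam" and lam: "lam0 < lam"
    and g [measurable]: "g \<in> borel_measurable borel" and gG: "\<And>x. x \<in> good \<Longrightarrow> g x \<in> \<Gamma> lam x"
    and max: "\<And>x \<gamma>. x \<in> good \<Longrightarrow> \<gamma> \<in> \<Gamma> lam x \<Longrightarrow> \<bar>\<gamma>\<bar> \<le> \<bar>g x\<bar>"
  shows "1 \<le> (\<integral>x. (g x)\<^sup>2 * k x \<partial>P0)"
proof -
  \<comment> \<open>The sequence starts at \<open>lam0\<close> and increases to \<open>lam\<close>;
    the strict inequality between them provides the multipliers below \<open>lam\<close>.\<close>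
  define mu where "mu n = lam - (lam - lam0) * inverse (real (Suc n))" for n
  have mu: "lam0 \<le> mu n" "mu n < lam" for n
  proof -
    have "(lam - lam0) * inverse (real (Suc n)) \<le> (lam - lam0) * 1" "0 < (lam - lam0) * inverse (real (Suc n))"
      using lam by (intro mult_left_mono) (auto simp: inverse_le_1_iff lam less_imp_le[OF lam] intro!: mult_pos_pos)
    then show "lam0 \<le> mu n" "mu n < lam" unfolding mu_def by auto
  qed
  have "mu \<longlonglongrightarrow> lam - (lam - lam0) * 0" unfolding mu_def
    by (intro tendsto_intros LIMSEQ_inverse_real_of_nat)
  then have mul: "mu \<longlonglongrightarrow> lam" by simp
  define G where "G n = select (\<lambda>\<gamma>. \<gamma>) (mu n)" for n
  have GG: "G n x \<in> \<Gamma> (mu n) x" if "x \<in> good" for n x unfolding G_def by (rule select_id_in_Gamma[OF mu(1) that])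
  have [measurable]: "G n \<in> borel_measurable borel" for n unfolding G_def using mu by measurable
  have i: "integrable P0 (\<lambda>x. (G n x)\<^sup>2 * k x)" "1 \<le> (\<integral>x. (G n x)\<^sup>2 * k x \<partial>P0)" for n
    using optimizer_slope[OF opt less_imp_le[OF lam] mu(1)[of n]] mu(2)[of n] by (auto simp: G_def mult_le_0_iff)
  obtain H where H: "0 \<le> H"
    "\<And>lam x \<gamma>. lam0 \<le> lam \<Longrightarrow> x \<in> good \<Longrightarrow> \<gamma> \<in> \<Gamma> lam x \<Longrightarrow> \<gamma>\<^sup>2 * k x \<le> H * (1 + (\<beta> \<bullet> x)\<^sup>2)"
    using Gamma_bound by metis
  have "1 = limsup (\<lambda>n::nat. 1 :: ennreal)" by (simp add: Limsup_const)
  also have "\<dots> \<le> limsup (\<lambda>n. \<integral>\<^sup>+ x. ennreal ((G n x)\<^sup>2 * k x) \<partial>P0)"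
  proof (intro Limsup_mono always_eventually allI)
    fix n
    have "(\<integral>\<^sup>+ x. ennreal ((G n x)\<^sup>2 * k x) \<partial>P0) = ennreal (\<integral>x. (G n x)\<^sup>2 * k x \<partial>P0)"
      using k_pos by (intro nn_integral_eq_integral i) (auto simp: less_imp_le)
    then show "1 \<le> (\<integral>\<^sup>+ x. ennreal ((G n x)\<^sup>2 * k x) \<partial>P0)" using i(2)[of n] by simp
  qed
  also have "\<dots> \<le> (\<integral>\<^sup>+ x. limsup (\<lambda>n. ennreal ((G n x)\<^sup>2 * k x)) \<partial>P0)"
  proof (rule nn_integral_limsup)
    \<comment> \<open>The dominating function for the reverse Fatou lemma; it works for all
      \<open>n\<close> because \<open>H\<close> does not depend on the multiplier.\<close>
    show "AE x in P0. ennreal ((G n x)\<^sup>2 * k x) \<le> ennreal (H * (1 + (\<beta> \<bullet> x)\<^sup>2))" for n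
      using AE_good by eventually_elim (use H(2)[OF mu(1) _ GG] in \<open>auto intro: ennreal_leI\<close>)
    have "(\<integral>\<^sup>+ x. ennreal (H * (1 + (\<beta> \<bullet> x)\<^sup>2)) \<partial>P0) = ennreal (\<integral>x. H * (1 + (\<beta> \<bullet> x)\<^sup>2) \<partial>P0)"
      using integrable_quadratic[of H 0] H(1) by (intro nn_integral_eq_integral) auto
    then show "(\<integral>\<^sup>+ x. ennreal (H * (1 + (\<beta> \<bullet> x)\<^sup>2)) \<partial>P0) < \<infinity>" by simp
  qed measurable
  also have "\<dots> \<le> (\<integral>\<^sup>+ x. ennreal ((g x)\<^sup>2 * k x) \<partial>P0)"
  proof (rule nn_integral_mono_AE)
    show "AE x in P0. limsup (\<lambda>n. ennreal ((G n x)\<^sup>2 * k x)) \<le> ennreal ((g x)\<^sup>2 * k x)"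
      using AE_good
    proof eventually_elim
      case (elim x)
      show ?case unfolding Limsup_le_iff
      proof safe
        fix y assume y: "ennreal ((g x)\<^sup>2 * k x) < y"
        have gk: "0 \<le> (g x)\<^sup>2 * k x" using k_pos[of x] by simp
        \<comment> \<open>\<open>y\<close> may be infinite while hemicontinuity is stated for reals,
          so a real level is interposed.\<close>
        obtain c where c: "(g x)\<^sup>2 * k x < c" "ennreal c \<le> y"
        proof (cases y)
          case (real c)
          with y gk show ?thesis by (intro that[of c]) (auto simp: ennreal_less_iff)
        next
          case top
          then show ?thesis by (intro that[of "(g x)\<^sup>2 * k x + 1"]) auto
        qed
        have "\<forall>\<^sub>F n in sequentially. - c < - ((G n x)\<^sup>2 * k x)"
        proof (rule Gamma_upper_hemicontinuous[OF elim mu(1) mul, of "\<lambda>n. G n x" "\<lambda>\<gamma>. - (\<gamma>\<^sup>2 * k x)" "- ((g x)\<^sup>2 * k x)"])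
          show "G n x \<in> \<Gamma> (mu n) x" for n by (rule GG[OF elim])
          have "\<gamma>\<^sup>2 * k x \<le> (g x)\<^sup>2 * k x" if "\<gamma> \<in> \<Gamma> lam x" for \<gamma>
            using max[OF elim that] k_pos[of x] by (intro mult_right_mono) (auto simp: abs_le_square_iff less_imp_le)
          then show "- ((g x)\<^sup>2 * k x) \<le> - (\<gamma>\<^sup>2 * k x)" if "\<gamma> \<in> \<Gamma> lam x" for \<gamma> using that by simp
        qed (auto intro!: continuous_intros c)
        then show "\<forall>\<^sub>F n in sequentially. ennreal ((G n x)\<^sup>2 * k x) < y"
        proof eventually_elim
          case (elim n)
          have "ennreal ((G n x)\<^sup>2 * k x) < ennreal c"
            using elim k_pos[of x] by (intro ennreal_lessI) (auto intro: le_less_trans[OF _ elim[unfolded neg_less_iff_less]])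
          then show ?case using c(2) by (rule less_le_trans)
        qed
      qed
    qed
  qed
  also have "(\<integral>\<^sup>+ x. ennreal ((g x)\<^sup>2 * k x) \<partial>P0) = ennreal (\<integral>x. (g x)\<^sup>2 * k x \<partial>P0)"
    using k_pos gG lam by (intro nn_integral_eq_integral integrable_Gamma[of lam]) (auto simp: less_imp_le)
  finally show ?thesis by simp
qed

text \<open>\<open>select\<close> only returns the extremal modulus. Its sign is recovered
  measurably by \<open>resign\<close>: the nonnegative candidate is kept if it attains
  \<open>val\<close>, otherwise its negative must be a maximiser.\<close>

lemma abs_extremal_selections:
  assumes lam: "lam0 \<le> lam"
  obtains g1 g2 where "g1 \<in> borel_measurable borel" "g2 \<in> borel_measurable borel"
    "\<And>x. x \<in> good \<Longrightarrow> g1 x \<in> \<Gamma> lam x" "\<And>x. x \<in> good \<Longrightarrow> g2 x \<in> \<Gamma> lam x"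
    "\<And>x \<gamma>. x \<in> good \<Longrightarrow> \<gamma> \<in> \<Gamma> lam x \<Longrightarrow> \<bar>g1 x\<bar> \<le> \<bar>\<gamma>\<bar> \<and> \<bar>\<gamma>\<bar> \<le> \<bar>g2 x\<bar>"
proof -
  define resign where "resign m x = (if val lam x = F lam (m x) x then m x else - m x)" for m :: "real^'n \<Rightarrow> real" and x
  have resign_meas: "resign m \<in> borel_measurable borel" if [measurable]: "m \<in> borel_measurable borel" for m
  proof -
    note [measurable] = val_measurable[OF lam]
    show ?thesis unfolding resign_def[abs_def] by measurable
  qed
  have resign_in: "resign m x \<in> \<Gamma> lam x \<and> \<bar>resign m x\<bar> = \<bar>\<gamma>\<bar>" if "x \<in> good" "\<gamma> \<in> \<Gamma> lam x" "m x = \<bar>\<gamma>\<bar>" for m x \<gamma>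
  proof -
    have "\<gamma>' \<in> \<Gamma> lam x" if "val lam x = F lam \<gamma>' x" for \<gamma>'
      using F_le_val[OF lam \<open>x \<in> good\<close>] that by (simp add: Gamma_star_eq)
    then show ?thesis using val_eq[OF lam that(1,2)] that(2,3)
      by (cases "0 \<le> \<gamma>") (auto simp: resign_def)
  qed
  have ca: "continuous_on UNIV (\<lambda>\<gamma>::real. \<bar>\<gamma>\<bar>)" "continuous_on UNIV (\<lambda>\<gamma>::real. - \<bar>\<gamma>\<bar>)"
    by (intro continuous_intros)+
  define m1 where "m1 = select (\<lambda>\<gamma>. \<bar>\<gamma>\<bar>) lam"
  define m2 where "m2 x = - select (\<lambda>\<gamma>. - \<bar>\<gamma>\<bar>) lam x" for x
  have [measurable]: "m1 \<in> borel_measurable borel" "m2 \<in> borel_measurable borel"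
    unfolding m1_def m2_def[abs_def] using select_measurable[OF lam ca(1)] select_measurable[OF lam ca(2)] by measurable
  have 1: "resign m1 x \<in> \<Gamma> lam x" "\<And>\<gamma>. \<gamma> \<in> \<Gamma> lam x \<Longrightarrow> \<bar>resign m1 x\<bar> \<le> \<bar>\<gamma>\<bar>" if x: "x \<in> good" for x
    using select_attained[OF lam ca(1) x] resign_in[OF x, of _ m1] unfolding m1_def by metis+
  have 2: "resign m2 x \<in> \<Gamma> lam x" "\<And>\<gamma>. \<gamma> \<in> \<Gamma> lam x \<Longrightarrow> \<bar>\<gamma>\<bar> \<le> \<bar>resign m2 x\<bar>" if x: "x \<in> good" for x
    using select_attained[OF lam ca(2) x] resign_in[OF x, of _ m2] unfolding m2_def by (metis minus_minus neg_le_iff_le)+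
  show ?thesis by (rule that[of "resign m1" "resign m2"]) (use 1 2 resign_meas in auto)
qed

end

subsection \<open>Uniqueness\<close>

text \<open>The closed neighbourhoods of \<open>S\<close> decrease to \<open>S\<close> as
  \<open>e\<close> tends to 0. The empty set is separate because \<open>infdist\<close> to it is 0
  by convention, so its neighbourhoods are the whole space.\<close>

lemma measure_closed_le:
  fixes P Q :: "'a::metric_space measure"
  assumes P: "prob_space P" "sets P = sets borel" and Q: "prob_space Q" "sets Q = sets borel"
    and le: "\<And>e. 0 < e \<Longrightarrow> measure P S \<le> measure Q {x. infdist x S \<le> e} + e"
    and S: "closed S"
  shows "measure P S \<le> measure Q S"
proof (cases "S = {}")
  case False
  interpret Q: prob_space Q by (rule Q)
  define E where "E n = {x. infdist x S \<le> inverse (real (Suc n))}" for n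
  have "closed (E n)" for n unfolding E_def by (intro closed_Collect_le continuous_intros)
  then have "range E \<subseteq> sets Q" using Q by (auto intro: borel_closed)
  moreover have "decseq E"
    unfolding E_def by (intro antimonoI Collect_mono impI) (erule order_trans, simp add: field_simps)
  ultimately have "(\<lambda>n. measure Q (E n)) \<longlonglongrightarrow> measure Q (\<Inter>n. E n)"
    by (rule Q.finite_Lim_measure_decseq)
  moreover have "(\<Inter>n. E n) = S"
  proof safe
    fix x assume "x \<in> (\<Inter>n. E n)"
    then have "infdist x S \<le> inverse (real (Suc n))" for n by (auto simp: E_def)
    then have "infdist x S \<le> 0" by (intro LIMSEQ_le_const[OF LIMSEQ_inverse_real_of_nat]) auto
    then have "infdist x S = 0" using infdist_nonneg[of x S] by linarith
    then show "x \<in> S" using in_closed_iff_infdist_zero[OF S False] by simp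
  qed (simp add: E_def)
  ultimately have lim: "(\<lambda>n. measure Q (E n) + inverse (real (Suc n))) \<longlonglongrightarrow> measure Q S + 0"
    by (intro tendsto_add LIMSEQ_inverse_real_of_nat) simp
  have "measure P S \<le> measure Q (E n) + inverse (real (Suc n))" for n
    unfolding E_def by (rule le) simp
  then show ?thesis using LIMSEQ_le_const[OF lim, of "measure P S"] by auto
qed simp

lemma measure_eqI_closed:
  fixes P Q :: "'a::topological_space measure"
  assumes P: "prob_space P" "sets P = sets borel" and Q: "prob_space Q" "sets Q = sets borel"
    and eq: "\<And>S. closed S \<Longrightarrow> measure P S = measure Q S"
  shows "P = Q"
proof (rule measure_eqI_generator_eq[where E="Collect closed" and \<Omega>=UNIV and A="\<lambda>_. UNIV"])
  interpret P: prob_space P by (rule P)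
  interpret Q: prob_space Q by (rule Q)
  show "emeasure P S = emeasure Q S" if "S \<in> Collect closed" for S
    using eq that by (simp add: P.emeasure_eq_measure Q.emeasure_eq_measure)
  show "emeasure P UNIV \<noteq> \<infinity>" by simp
  show "sets P = sigma_sets UNIV (Collect closed)" "sets Q = sigma_sets UNIV (Collect closed)"
    unfolding P Q borel_eq_closed by simp_all
qed (auto simp: Int_stable_def)

text \<open>Comparing both laws on closed sets avoids any compactness of couplings.\<close>
lemma law_eq_distr_if_concentrated:
  fixes P0 P :: "'a::{metric_space, second_countable_topology} measure" and T :: "'a \<Rightarrow> 'a"
  assumes P: "prob_space P" "sets P = sets borel" and P0: "prob_space P0" "sets P0 = sets borel"
    and T [measurable]: "T \<in> borel_measurable borel"
    and conc: "\<And>e. 0 < e \<Longrightarrow> \<exists>\<pi>. prob_space \<pi> \<and> sets \<pi> = sets borel \<and> distr \<pi> borel fst = P0 \<and> distr \<pi> borel snd = P \<and>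
      measure \<pi> {z. e \<le> dist (snd z) (T (fst z))} \<le> e"
  shows "P = distr P0 borel T"
proof -
  define Q where "Q = distr P0 borel T"
  have T': "T \<in> measurable P0 borel" using P0(2) by (simp cong: measurable_cong_sets)
  have Q: "prob_space Q" "sets Q = sets borel"
    unfolding Q_def using prob_space.prob_space_distr[OF P0(1) T'] by auto
  have main: "measure P S \<le> measure Q {x. infdist x S \<le> e} + e \<and> measure Q S \<le> measure P {x. infdist x S \<le> e} + e"
    if S: "closed S" and e: "0 < e" for S e
  proof (cases "S = {}")
    case False
    obtain \<pi> where \<pi>: "prob_space \<pi>" and s\<pi> [measurable_cong]: "sets \<pi> = sets borel"
      and d: "distr \<pi> borel fst = P0" "distr \<pi> borel snd = P"
      and m: "measure \<pi> {z. e \<le> dist (snd z) (T (fst z))} \<le> e" using conc[OF e] by blast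
    interpret \<pi>: prob_space \<pi> by (rule \<pi>)
    have sp: "space \<pi> = UNIV" using sets_eq_imp_space_eq[OF s\<pi>] by simp
    have [measurable]: "(fst :: 'a \<times> 'a \<Rightarrow> _) \<in> borel_measurable borel" "(snd :: 'a \<times> 'a \<Rightarrow> _) \<in> borel_measurable borel"
      by (intro borel_measurable_continuous_onI continuous_intros)+
    have Pm: "measure P R = measure \<pi> {z. snd z \<in> R}" if [measurable]: "R \<in> sets borel" for R
      unfolding d(2)[symmetric] by (subst measure_distr) (auto simp: sp vimage_def)
    have Qm: "measure Q R = measure \<pi> {z. T (fst z) \<in> R}" if [measurable]: "R \<in> sets borel" for R
      unfolding Q_def d(1)[symmetric] by (subst distr_distr) (auto simp: measure_distr sp vimage_def comp_def)
    have Se: "{x. infdist x S \<le> e} \<in> sets borel" "S \<in> sets borel"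
      using S by (auto intro!: borel_closed closed_Collect_le continuous_intros)
    have meas: "{z. e \<le> dist (snd z) (T (fst z))} \<in> sets \<pi>"
    proof -
      have "{z \<in> space \<pi>. e \<le> dist (snd z) (T (fst z))} \<in> sets \<pi>" by measurable
      then show ?thesis by (simp add: sp)
    qed
    have meas2: "{z. snd z \<in> R} \<in> sets \<pi>" "{z. T (fst z) \<in> R} \<in> sets \<pi>" if [measurable]: "R \<in> sets borel" for R
    proof -
      have "{z \<in> space \<pi>. snd z \<in> R} \<in> sets \<pi>" "{z \<in> space \<pi>. T (fst z) \<in> R} \<in> sets \<pi>" by measurable
      then show "{z. snd z \<in> R} \<in> sets \<pi>" "{z. T (fst z) \<in> R} \<in> sets \<pi>" by (simp_all add: sp)
    qed
    \<comment> \<open>Outside the exceptional set the two points are closer than \<open>e\<close>,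
      so if one lies in \<open>S\<close>, the other lies in its neighbourhood.\<close>
    have near: "infdist a S \<le> e" if "b \<in> S" "\<not> e \<le> dist a b" for a b
      using infdist_le2[OF that(1), of a e] that(2) by simp
    have U: "{z. T (fst z) \<in> {x. infdist x S \<le> e}} \<union> {z. e \<le> dist (snd z) (T (fst z))} \<in> sets \<pi>"
      "{z. snd z \<in> {x. infdist x S \<le> e}} \<union> {z. e \<le> dist (snd z) (T (fst z))} \<in> sets \<pi>"
      by (intro sets.Un meas meas2 Se)+
    have "measure \<pi> {z. snd z \<in> S} \<le> measure \<pi> ({z. T (fst z) \<in> {x. infdist x S \<le> e}} \<union> {z. e \<le> dist (snd z) (T (fst z))})"
      using near by (intro \<pi>.finite_measure_mono U) (auto simp: dist_commute)
    also have "\<dots> \<le> measure \<pi> {z. T (fst z) \<in> {x. infdist x S \<le> e}} + measure \<pi> {z. e \<le> dist (snd z) (T (fst z))}"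
      by (intro measure_Un_le meas meas2 Se)
    finally have "measure P S \<le> measure Q {x. infdist x S \<le> e} + e"
      using m unfolding Pm[OF Se(2)] Qm[OF Se(1)] by linarith
    moreover have "measure \<pi> {z. T (fst z) \<in> S} \<le> measure \<pi> ({z. snd z \<in> {x. infdist x S \<le> e}} \<union> {z. e \<le> dist (snd z) (T (fst z))})"
      using near by (intro \<pi>.finite_measure_mono U) auto
    moreover have "\<dots> \<le> measure \<pi> {z. snd z \<in> {x. infdist x S \<le> e}} + measure \<pi> {z. e \<le> dist (snd z) (T (fst z))}"
      by (intro measure_Un_le meas meas2 Se)
    ultimately show ?thesis
      using m unfolding Pm[OF Se(2)] Qm[OF Se(1)] Pm[OF Se(1)] Qm[OF Se(2)] by linarith
  qed (use e in \<open>simp add: add_nonneg_nonneg\<close>)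
  have "P = Q"
    by (rule measure_eqI_closed[OF P Q])
      (use main in \<open>auto intro!: antisym measure_closed_le[OF P Q] measure_closed_le[OF Q P]\<close>)
  then show ?thesis by (simp add: Q_def)
qed

section \<open>Strong concavity under a curvature bound\<close>

lemma convex_on_midpoint:
  fixes \<phi> :: "real \<Rightarrow> real"
  assumes "convex_on UNIV \<phi>"
  shows "\<phi> ((a + b) / 2) \<le> (\<phi> a + \<phi> b) / 2"
  using convex_onD[OF assms, of "1/2" a b] by (simp add: field_simps)

context growth_bounded_dual
begin

text \<open>The curvature bound \<open>l'' \<le> M\<close> enters only as convexity of \<open>m u\<^sup>2 - l u\<close> with \<open>m = M / 2\<close>.\<close>
context
  fixes m lam :: real
  assumes semi: "convex_on UNIV (\<lambda>u. m * u\<^sup>2 - l u)" and m0: "0 \<le> m"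
    and lam: "lam0 \<le> lam" and m_lam: "m * sqrt \<delta> * K < lam"
begin

lemma semiconcave_midpoint:
  "(l a + l b) / 2 - m * (a - b)\<^sup>2 / 4 \<le> l ((a + b) / 2)"
  using convex_on_midpoint[OF semi, of a b] by (simp add: power2_eq_square field_simps)

text \<open>Strong concavity in \<gamma>: the midpoint of two distinct maximisers would beat their
  common value by \<open>D\<close>.\<close>

lemma Gamma_unique:
  assumes kx: "k x \<le> K" and "\<gamma>1 \<in> \<Gamma> lam x" "\<gamma>2 \<in> \<Gamma> lam x"
  shows "\<gamma>1 = \<gamma>2"
proof (rule ccontr)
  assume ne: "\<gamma>1 \<noteq> \<gamma>2"
  define s where "s = sqrt \<delta>"
  have s: "0 < s" using sqrt_delta s_def by simp
  \<comment> \<open>The penalty gains \<open>lam * s * k x\<close> and the loss gives back at most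
    \<open>m * s\<^sup>2 * (k x)\<^sup>2\<close>, both times a quarter of the squared
    distance.\<close>
  define D where "D = s * k x * (lam - m * s * k x) * (\<gamma>1 - \<gamma>2)\<^sup>2 / 4"
  let ?a = "\<beta> \<bullet> x + \<gamma>1 * s * k x" and ?b = "\<beta> \<bullet> x + \<gamma>2 * s * k x"
  have ab: "(?a + ?b) / 2 = \<beta> \<bullet> x + (\<gamma>1 + \<gamma>2) / 2 * s * k x" by (simp add: field_simps)
  have "F lam ((\<gamma>1 + \<gamma>2) / 2) x = l ((?a + ?b) / 2) - lam * s * (((\<gamma>1 + \<gamma>2) / 2)\<^sup>2 * k x - 1)"
    unfolding ab by (simp add: dual_F_def s_def)
  also have "\<dots> \<ge> (l ?a + l ?b) / 2 - m * (?a - ?b)\<^sup>2 / 4 - lam * s * (((\<gamma>1 + \<gamma>2) / 2)\<^sup>2 * k x - 1)"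
    by (intro diff_right_mono semiconcave_midpoint)
  also have "(l ?a + l ?b) / 2 - m * (?a - ?b)\<^sup>2 / 4 - lam * s * (((\<gamma>1 + \<gamma>2) / 2)\<^sup>2 * k x - 1)
    = (F lam \<gamma>1 x + F lam \<gamma>2 x) / 2 + D"
    by (simp add: D_def dual_F_def s_def[symmetric] power2_eq_square field_simps)
  finally have "(F lam \<gamma>1 x + F lam \<gamma>2 x) / 2 + D \<le> F lam ((\<gamma>1 + \<gamma>2) / 2) x" .
  moreover have "m * s * k x \<le> m * s * K" using m0 s kx by (intro mult_left_mono) auto
  then have "0 < D"
    unfolding D_def using ne s k_pos[of x] m_lam by (intro divide_pos_pos mult_pos_pos) (auto simp: s_def)
  moreover have "F lam ((\<gamma>1 + \<gamma>2) / 2) x \<le> F lam \<gamma>1 x" "F lam ((\<gamma>1 + \<gamma>2) / 2) x \<le> F lam \<gamma>2 x"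
    using assms(2,3) by (simp_all add: Gamma_star_eq)
  ultimately show False by argo
qed

text \<open>Pointwise weak duality is applied at the midpoint of \<open>x'\<close> and the optimal
  image. There the cost saves by the parallelogram law and the loss gives up at most the curvature
  term, so the gap at \<open>x'\<close> keeps the difference
  \<open>lam / sqrt \<delta> - m * K\<close>.\<close>

lemma gap_ge_distance:
  assumes x: "x \<in> good" and g: "g \<in> \<Gamma> lam x"
    and \<rho>: "\<And>v. norm v = 1 \<Longrightarrow> \<rho> \<le> v \<bullet> (A x *v v)"
  shows "(lam / sqrt \<delta> - m * K) / 2 * (\<rho> * (dist x' (X_star \<delta> A \<beta> x g))\<^sup>2)
    \<le> val lam x - lam * sqrt \<delta> + lam / sqrt \<delta> * state_cost A x x' - l (\<beta> \<bullet> x')"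
proof -
  define s where "s = sqrt \<delta>"
  have s: "0 < s" "s * s = \<delta>" using sqrt_delta s_def by auto
  define T where "T = X_star \<delta> A \<beta> x g"
  define q where "q v = v \<bullet> (A x *v v)" for v
  define z where "z = (1/2) *\<^sub>R (x' + T)"
  have cq: "state_cost A x y = q (x - y)" for y by (simp add: state_cost_def q_def)
  \<comment> \<open>Parallelogram law for the form of \<open>A x\<close>.\<close>
  have par: "q (x - z) = (q (x - x') + q (x - T)) / 2 - q (x' - T) / 4"
  proof -
    define a b where "a = x - x'" and "b = x - T"
    have z: "x - z = (1/2) *\<^sub>R (a + b)" unfolding z_def a_def b_def
      by (simp add: scaleR_right_diff_distrib scaleR_add_right algebra_simps scaleR_2[symmetric])
    have d: "x' - T = b - a" by (simp add: a_def b_def)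
    have sym: "a \<bullet> (A x *v b) = b \<bullet> (A x *v a)" by (rule sym_pos_def_inner_commute[OF spd])
    show ?thesis unfolding z d q_def a_def[symmetric] b_def[symmetric]
      by (simp add: matrix_vector_mult_scaleR matrix_vector_right_distrib matrix_vector_mult_diff_distrib
        inner_add_left inner_add_right inner_diff_left inner_diff_right sym field_simps)
  qed
  have lz: "(l (\<beta> \<bullet> x') + l (\<beta> \<bullet> T)) / 2 - m * (\<beta> \<bullet> (x' - T))\<^sup>2 / 4 \<le> l (\<beta> \<bullet> z)"
    using semiconcave_midpoint[of "\<beta> \<bullet> x'" "\<beta> \<bullet> T"] by (simp add: z_def inner_add_right inner_diff_right)
  have bz: "m * (\<beta> \<bullet> (x' - T))\<^sup>2 \<le> m * K * q (x' - T)"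
  proof -
    have "(\<beta> \<bullet> (x' - T))\<^sup>2 \<le> k x * q (x' - T)" unfolding q_def by (rule inner_square_le_inv_quad[OF spd])
    also have "\<dots> \<le> K * q (x' - T)"
      using x sym_pos_def_nonneg[OF spd] by (intro mult_right_mono) (auto simp: good_def q_def)
    finally show ?thesis using m0 by (metis mult_left_mono mult.assoc)
  qed
  have Tv: "l (\<beta> \<bullet> T) - lam / s * q (x - T) = val lam x - lam * s"
  proof -
    have "lam / s * q (x - T) = lam * s * (g\<^sup>2 * k x)"
      unfolding cq[symmetric] T_def state_cost_X_star using s(1) by (simp add: s(2)[symmetric])
    then show ?thesis using val_eq[OF lam x g] by (simp add: dual_F_def T_def inner_X_star s_def algebra_simps)
  qed
  have up: "l (\<beta> \<bullet> z) \<le> val lam x - lam * s + lam / s * q (x - z)"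
    using loss_le_val_cost[OF lam x, of z] by (simp add: cq s_def)
  have "lam / s * q (x - z) = (lam / s * q (x - x') + lam / s * q (x - T)) / 2 - lam / s * q (x' - T) / 4"
    unfolding par by (simp add: algebra_simps add_divide_distrib)
  moreover have "(lam / s - m * K) / 2 * q (x' - T) = (lam / s * q (x' - T) - m * K * q (x' - T)) / 2"
    by (simp add: left_diff_distrib)
  ultimately have "(lam / s - m * K) / 2 * q (x' - T) \<le> val lam x - lam * s + lam / s * q (x - x') - l (\<beta> \<bullet> x')"
    using up lz bz Tv by argo
  moreover have "(lam / s - m * K) / 2 * (\<rho> * (norm (x' - T))\<^sup>2) \<le> (lam / s - m * K) / 2 * q (x' - T)"
    unfolding q_def
  proof (intro mult_left_mono quad_form_ge \<rho>)
    show "0 \<le> (lam / s - m * K) / 2" using m_lam s by (simp add: s_def[symmetric] field_simps)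
  qed
  ultimately show ?thesis by (simp add: cq s_def T_def dist_norm)
qed

lemma worst_case_unique:
  assumes g [measurable]: "g \<in> borel_measurable borel" and gG: "AE x in P0. g x \<in> \<Gamma> lam x"
    and \<rho>: "0 < \<rho>" "AE x in P0. \<forall>v. norm v = 1 \<longrightarrow> \<rho> \<le> v \<bullet> (A x *v v)"
    and P: "P \<in> transport_ball \<delta> P0 A" and opt: "integral\<^sup>L P0 (val lam) \<le> (\<integral>x. l (\<beta> \<bullet> x) \<partial>P)"
  shows "P = distr P0 borel (\<lambda>x. X_star \<delta> A \<beta> x (g x))"
proof (rule law_eq_distr_if_concentrated[OF _ _ prob sets_P0])
  show "prob_space P" "sets P = sets borel" using P by (auto simp: transport_ball_def)
  let ?T = "\<lambda>x. X_star \<delta> A \<beta> x (g x)"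
  show T [measurable]: "?T \<in> borel_measurable borel" by (rule X_star_measurable[OF lsc spd _ g]) simp
  fix e :: real assume e: "0 < e"
  define \<eta> where "\<eta> = (lam / sqrt \<delta> - m * K) / 2 * \<rho>"
  have \<eta>: "0 < \<eta>" unfolding \<eta>_def using \<rho>(1) m_lam sqrt_delta by (intro mult_pos_pos) (auto simp: field_simps)
  \<comment> \<open>Chosen so that the integrated gap is at most
    \<open>\<eta> * e\<^sup>2 * e\<close>; Markov's inequality at level
    \<open>\<eta> * e\<^sup>2\<close> then leaves probability at most \<open>e\<close>.\<close>
  define e' where "e' = \<eta> * e\<^sup>2 * e * sqrt \<delta> / lam"
  have e': "0 < e'" "lam / sqrt \<delta> * e' = \<eta> * e\<^sup>2 * e" using e \<eta> sqrt_delta lam_pos[OF lam] by (auto simp: e'_def)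
  obtain \<pi> where \<pi>: "\<pi> \<in> couplings P0 P"
    "(\<integral>\<^sup>+ z. ennreal (state_cost A (fst z) (snd z)) \<partial>\<pi>) \<le> ennreal (\<delta> + e')"
    using transport_ball_coupling[OF P e'(1)] by auto
  define gap where "gap z = val lam (fst z) - lam * sqrt \<delta> + lam / sqrt \<delta> * state_cost A (fst z) (snd z) - l (\<beta> \<bullet> snd z)" for z
  note gp = couplings_duality_gap[OF \<pi>(1) less_imp_le[OF e'(1)] lam \<pi>(2), folded gap_def]
  have gp3: "integral\<^sup>L \<pi> gap \<le> \<eta> * e\<^sup>2 * e" using gp(3) opt e'(2) unfolding gap_def by linarith
  note [measurable] = couplings_measurable[OF \<pi>(1)]
  interpret \<pi>: prob_space \<pi> using \<pi> by (simp add: couplings_def)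
  have s\<pi>: "sets \<pi> = sets borel" using \<pi> by (simp add: couplings_def)
  have sp: "space \<pi> = UNIV" using sets_eq_imp_space_eq[OF s\<pi>] by simp
  have [measurable]: "gap \<in> borel_measurable \<pi>" using gp(1) unfolding gap_def by simp
  have "AE z in \<pi>. fst z \<in> good \<and> g (fst z) \<in> \<Gamma> lam (fst z) \<and> (\<forall>v. norm v = 1 \<longrightarrow> \<rho> \<le> v \<bullet> (A (fst z) *v v))"
    by (rule couplings_AE_fst[OF \<pi>(1)]) (use AE_good gG \<rho>(2) in auto)
  then have "AE z in \<pi>. \<eta> * (dist (snd z) (?T (fst z)))\<^sup>2 \<le> gap z"
  proof eventually_elim
    case (elim z)
    then show ?case using gap_ge_distance[of "fst z" "g (fst z)" \<rho> "snd z"] by (auto simp: gap_def \<eta>_def mult_ac)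
  qed
  then have "AE z in \<pi>. e \<le> dist (snd z) (?T (fst z)) \<longrightarrow> \<eta> * e\<^sup>2 \<le> gap z"
  proof eventually_elim
    case (elim z)
    show ?case
    proof
      assume "e \<le> dist (snd z) (?T (fst z))"
      then have "\<eta> * e\<^sup>2 \<le> \<eta> * (dist (snd z) (?T (fst z)))\<^sup>2" using e \<eta> by (intro mult_left_mono power_mono) auto
      with elim show "\<eta> * e\<^sup>2 \<le> gap z" by simp
    qed
  qed
  moreover have "{z \<in> space \<pi>. \<eta> * e\<^sup>2 \<le> gap z} \<in> sets \<pi>" by measurable
  ultimately have "measure \<pi> {z \<in> space \<pi>. e \<le> dist (snd z) (?T (fst z))} \<le> measure \<pi> {z \<in> space \<pi>. \<eta> * e\<^sup>2 \<le> gap z}"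
    by (intro \<pi>.finite_measure_mono_AE) (auto simp: sp)
  also have "\<dots> \<le> integral\<^sup>L \<pi> gap / (\<eta> * e\<^sup>2)"
    using gp(1,2) \<eta> e by (intro integral_Markov_inequality_measure[where A="{}"]) (auto simp: gap_def[abs_def])
  also have "\<dots> \<le> \<eta> * e\<^sup>2 * e / (\<eta> * e\<^sup>2)" using gp3 \<eta> e by (intro divide_right_mono) auto
  also have "\<dots> = e" using \<eta> e by simp
  finally show "\<exists>\<pi>. prob_space \<pi> \<and> sets \<pi> = sets borel \<and> distr \<pi> borel fst = P0 \<and> distr \<pi> borel snd = P \<and>
      measure \<pi> {z. e \<le> dist (snd z) (?T (fst z))} \<le> e"
    using \<pi>(1) by (intro exI[of _ \<pi>]) (auto simp: couplings_def sp)
qed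

end
end

subsection \<open>Non-attainment at the threshold\<close>

text \<open>\<open>u\<^sup>2\<close> minus a remainder that vanishes only at \<open>u = 0\<close> but is only linear at infinity. With a unit
  budget around the point mass at \<open>0\<close>, the value \<open>1\<close> is approached by sending ever smaller mass to
  infinity, whereas attaining it would force all mass to stay at \<open>0\<close>.\<close>
definition pinched_square :: "real \<Rightarrow> real" where
  "pinched_square u = (max 0 (\<bar>u\<bar> - 1))\<^sup>2"

lemma pinched_square_convex: "convex_on UNIV pinched_square"
proof (rule convex_onI)
  fix t x y :: real assume t: "0 < t" "t < 1"
  define a b where "a = max 0 (\<bar>x\<bar> - 1)" and "b = max 0 (\<bar>y\<bar> - 1)"
  let ?z = "(1 - t) * x + t * y"
  have "\<bar>?z\<bar> \<le> (1 - t) * \<bar>x\<bar> + t * \<bar>y\<bar>"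
    using t abs_triangle_ineq[of "(1 - t) * x" "t * y"] by (simp add: abs_mult)
  also have "\<dots> \<le> (1 - t) * (a + 1) + t * (b + 1)"
    using t by (intro add_mono mult_left_mono) (auto simp: a_def b_def)
  finally have "\<bar>?z\<bar> - 1 \<le> (1 - t) * a + t * b" by (simp add: algebra_simps)
  moreover have ab: "0 \<le> a" "0 \<le> b" by (simp_all add: a_def b_def)
  ultimately have "max 0 (\<bar>?z\<bar> - 1) \<le> (1 - t) * a + t * b" using t by simp
  then have "(max 0 (\<bar>?z\<bar> - 1))\<^sup>2 \<le> ((1 - t) * a + t * b)\<^sup>2" by (intro power_mono) auto
  also have "\<dots> \<le> (1 - t) * a\<^sup>2 + t * b\<^sup>2"
  proof -
    have "0 \<le> t * (1 - t) * (a - b)\<^sup>2" using t by simp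
    then show ?thesis by (simp add: power2_eq_square algebra_simps)
  qed
  finally show "pinched_square ((1 - t) *\<^sub>R x + t *\<^sub>R y) \<le> (1 - t) * pinched_square x + t * pinched_square y"
    by (simp add: pinched_square_def a_def b_def)
qed simp

lemma pinched_square_bounds:
  "0 \<le> pinched_square u" "pinched_square u \<le> u\<^sup>2" "u\<^sup>2 - 2 * \<bar>u\<bar> \<le> pinched_square u"
proof -
  show "0 \<le> pinched_square u" by (simp add: pinched_square_def)
  have "(max 0 (\<bar>u\<bar> - 1))\<^sup>2 \<le> \<bar>u\<bar>\<^sup>2" by (intro power_mono) auto
  then show "pinched_square u \<le> u\<^sup>2" by (simp add: pinched_square_def)
  show "u\<^sup>2 - 2 * \<bar>u\<bar> \<le> pinched_square u"
  proof (cases "1 \<le> \<bar>u\<bar>")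
    case True
    then have "pinched_square u = u\<^sup>2 - 2 * \<bar>u\<bar> + 1"
      by (simp add: pinched_square_def power2_eq_square algebra_simps abs_mult_self_eq)
    then show ?thesis by simp
  next
    case False
    then have "\<bar>u\<bar> * \<bar>u\<bar> \<le> 2 * \<bar>u\<bar>" by (intro mult_right_mono) auto
    then show ?thesis using False by (simp add: pinched_square_def power2_eq_square abs_mult_self_eq)
  qed
qed

lemma pinched_square_eq_square: "pinched_square u = u\<^sup>2 \<Longrightarrow> u = 0"
proof (rule ccontr)
  assume "pinched_square u = u\<^sup>2" "u \<noteq> 0"
  moreover have "(max 0 (\<bar>u\<bar> - 1))\<^sup>2 < \<bar>u\<bar>\<^sup>2" using \<open>u \<noteq> 0\<close> by (intro power_strict_mono) auto
  ultimately show False by (simp add: pinched_square_def)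
qed

lemma pinched_square_exceeds:
  assumes "s < 1"
  shows "\<exists>u. c < pinched_square u - s * u\<^sup>2"
proof -
  \<comment> \<open>\<open>u\<^sup>2 - 2 * u - s * u\<^sup>2\<close> factors as
    \<open>((1 - s) * u - 2) * u\<close>; this \<open>u\<close> makes the first factor at least
    \<open>\<bar>c\<bar> + 1\<close> and the second at least 1.\<close>
  define u where "u = (\<bar>c\<bar> + 3) / (1 - s) + 1"
  have u: "1 \<le> u" "(1 - s) * u = \<bar>c\<bar> + 3 + (1 - s)" using assms by (auto simp: u_def field_simps)
  have "c < (\<bar>c\<bar> + 1) * 1" by simp
  also have "\<dots> \<le> ((1 - s) * u - 2) * u" using u assms by (intro mult_mono) auto
  also have "\<dots> = u\<^sup>2 - 2 * \<bar>u\<bar> - s * u\<^sup>2" using u by (simp add: power2_eq_square algebra_simps)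
  also have "\<dots> \<le> pinched_square u - s * u\<^sup>2" using pinched_square_bounds(3)[of u] by simp
  finally show ?thesis ..
qed

lemma growth_rate_pinched_square: "growth_rate pinched_square = 1"
proof (rule antisym)
  have "(SUP u. ereal (pinched_square u - 1 * u\<^sup>2)) \<le> ereal 0"
    by (intro SUP_least) (use pinched_square_bounds(2) in simp)
  also have "ereal 0 < \<infinity>" by simp
  finally show "growth_rate pinched_square \<le> 1"
    unfolding growth_rate_def one_ereal_def by (intro INF_lower) auto
  show "1 \<le> growth_rate pinched_square"
    unfolding growth_rate_def
  proof (intro INF_greatest)
    fix s :: real assume s: "s \<in> {s. 0 \<le> s \<and> (SUP u. ereal (pinched_square u - s * u\<^sup>2)) < \<infinity>}"
    then obtain c where c: "(SUP u. ereal (pinched_square u - s * u\<^sup>2)) \<le> ereal c"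
      by (metis (mono_tags, lifting) ereal_dense2 less_imp_le mem_Collect_eq)
    have "pinched_square u - s * u\<^sup>2 \<le> c" for u
    proof -
      have "ereal (pinched_square u - s * u\<^sup>2) \<le> ereal c" using c by (meson SUP_upper UNIV_I order_trans)
      then show ?thesis by simp
    qed
    then have "1 \<le> s" using pinched_square_exceeds[of s c] by (meson not_le)
    then show "1 \<le> ereal s" by (simp add: one_ereal_def)
  qed
qed

section \<open>The instance: point mass at 0, identity matrix, unit budget\<close>

lemma sym_pos_def_mat_1: "sym_pos_def (mat 1 :: real^'n^'n)"
  unfolding sym_pos_def_def by (simp add: transpose_mat)

lemma lower_semicont_continuous:
  assumes "continuous_on UNIV f" shows "lower_semicont f"
  unfolding lower_semicont_def
proof (intro allI impI)
  fix z t assume "t < f z"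
  moreover have "open {w. t < f w}" by (intro open_Collect_less assms continuous_intros)
  ultimately show "\<forall>\<^sub>F w in nhds z. t < f w" by (auto simp: eventually_nhds)
qed

lemma AE_return_eq: "AE x in return borel (a :: 'a::t1_space). x = a"
proof -
  have "{x \<in> space borel. x = a} \<in> sets borel" by simp
  then show ?thesis by (subst AE_return) (auto simp: pred_def)
qed

context
  fixes b :: "real^'n"
  assumes b: "norm b = 1"
begin

abbreviation "P0d \<equiv> return borel (0 :: real^'n)"
abbreviation "A1 \<equiv> \<lambda>_ :: real^'n. (mat 1 :: real^'n^'n)"

lemma state_cost_mat_1: "state_cost A1 x x' = (norm (x - x'))\<^sup>2"
  by (simp add: state_cost_def power2_norm_eq_inner)

lemma inv_quad_mat_1: "inv_quad A1 b x = 1"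
  using inv_quad_eq[of A1 "b" x b] sym_pos_def_mat_1 sym_pos_def_mult_inv[OF sym_pos_def_mat_1, of b] b
  by (simp add: inv_quad_def dot_square_norm)

lemma pinched_dual_F: "dual_F 1 pinched_square A1 \<gamma> b mu 0 = pinched_square \<gamma> - mu * (\<gamma>\<^sup>2 - 1)"
  by (simp add: dual_F_def inv_quad_mat_1)

text \<open>Below 1 the loss outgrows the penalty. From 1 on, \<open>\<gamma> = 0\<close> is optimal
  because the loss is at most the square, and the value is \<open>mu\<close>. So the minimiser is 1,
  exactly the threshold.\<close>

lemma pinched_dual_obj:
  assumes "0 \<le> mu"
  shows "dual_obj 1 P0d pinched_square A1 b mu = (if mu < 1 then \<infinity> else ereal mu)"
proof (cases "mu < 1")
  case True
  have "loss_rob 1 pinched_square A1 b mu 0 = \<infinity>"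
    unfolding loss_rob_def pinched_dual_F
  proof (rule SUP_PInfty)
    fix n :: nat
    obtain u where "real n - mu < pinched_square u - mu * u\<^sup>2" using pinched_square_exceeds[OF True] by blast
    then show "\<exists>i\<in>UNIV. ereal (real n) \<le> ereal (pinched_square i - mu * (i\<^sup>2 - 1))"
      by (intro bexI[of _ u]) (auto simp: algebra_simps)
  qed
  then have "dual_obj 1 P0d pinched_square A1 b mu = \<infinity>"
    unfolding dual_obj_def by (intro ext_expectation_eq_infinity[of "{0}"]) auto
  then show ?thesis using True by simp
next
  case False
  interpret prob_space P0d by (rule prob_space_return) simp
  have "loss_rob 1 pinched_square A1 b mu 0 = ereal mu"
    unfolding loss_rob_def pinched_dual_F
  proof (rule antisym)
    show "(SUP \<gamma>. ereal (pinched_square \<gamma> - mu * (\<gamma>\<^sup>2 - 1))) \<le> ereal mu"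
    proof (intro SUP_least)
      fix \<gamma> :: real
      have "pinched_square \<gamma> \<le> 1 * \<gamma>\<^sup>2" using pinched_square_bounds(2)[of \<gamma>] by simp
      also have "\<dots> \<le> mu * \<gamma>\<^sup>2" using False by (intro mult_right_mono) auto
      finally show "ereal (pinched_square \<gamma> - mu * (\<gamma>\<^sup>2 - 1)) \<le> ereal mu" by (simp add: algebra_simps)
    qed
    show "ereal mu \<le> (SUP \<gamma>. ereal (pinched_square \<gamma> - mu * (\<gamma>\<^sup>2 - 1)))"
      by (rule SUP_upper2[of 0]) (auto simp: pinched_square_def)
  qed
  then have "AE x in P0d. loss_rob 1 pinched_square A1 b mu x = ereal mu"
    using AE_return_eq[of "0::real^'n"] by auto
  then show ?thesis unfolding dual_obj_def using False
    by (subst ext_expectation_AE_eq_integral[of _ "\<lambda>_. mu"]) (use prob_space in auto)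
qed

lemma pinched_dual_optimizer: "dual_optimizer 1 P0d pinched_square A1 b 1"
  unfolding dual_optimizer_def is_arg_min_def by (auto simp: pinched_dual_obj one_ereal_def)

lemma pinched_dro_setting: "dro_setting {b} 1 P0d pinched_square A1"
proof -
  interpret prob_space P0d by (rule prob_space_return) simp
  have "lower_semicont (\<lambda>(x, x'). state_cost A1 x x')"
    unfolding state_cost_mat_1 case_prod_unfold
    by (intro lower_semicont_continuous continuous_intros)
  moreover have "integrable P0d (\<lambda>x. norm x ^ 4)"
  proof (rule integrable_const_bound[where B=0])
    show "AE x in P0d. norm (norm x ^ 4) \<le> 0" using AE_return_eq[of "0::real^'n"] by auto
  qed simp
  moreover have "\<exists>\<rho>min \<rho>max. 0 < \<rho>min \<and> 0 < \<rho>max \<and>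
    (AE x in P0d. \<forall>v::real^'n. norm v = 1 \<longrightarrow> \<rho>min \<le> v \<bullet> (mat 1 *v v) \<and> v \<bullet> (mat 1 *v v) \<le> \<rho>max)"
    by (intro exI[of _ 1]) (auto simp: dot_square_norm)
  ultimately show ?thesis
    unfolding dro_setting_def
    using sym_pos_def_mat_1 pinched_square_convex pinched_dual_optimizer prob_space_axioms
    by (auto simp: growth_rate_pinched_square one_ereal_def)
qed

lemma pinched_lambda_thr: "lambda_thr 1 P0d pinched_square A1 b = 1"
  by (simp add: lambda_thr_def growth_rate_pinched_square inv_quad_mat_1 esssup_const one_ereal_def)

text \<open>Any coupling with the point mass has first coordinate 0 almost surely, so its cost is
  the second moment of \<open>P\<close>.\<close>

lemma pinched_transport_ball:
  assumes P: "P \<in> transport_ball 1 P0d A1"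
  shows "(\<integral>\<^sup>+ x. ennreal ((norm x)\<^sup>2) \<partial>P) \<le> 1"
proof -
  have "(\<integral>\<^sup>+ x. ennreal ((norm x)\<^sup>2) \<partial>P) \<le> transport_cost A1 P0d P"
    unfolding transport_cost_def
  proof (rule INF_greatest)
    fix \<pi> assume \<pi>: "\<pi> \<in> couplings P0d P"
    then have s [measurable_cong]: "sets \<pi> = sets borel" and d: "distr \<pi> borel fst = P0d" "distr \<pi> borel snd = P"
      by (auto simp: couplings_def)
    have [measurable]: "(fst :: (real^'n) \<times> (real^'n) \<Rightarrow> _) \<in> borel_measurable borel" "(snd :: (real^'n) \<times> (real^'n) \<Rightarrow> _) \<in> borel_measurable borel"
      by (intro borel_measurable_continuous_onI continuous_intros)+
    have f: "fst \<in> borel_measurable \<pi>" by measurable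
    have "AE z in \<pi>. fst z = 0"
      by (rule AE_distrD[OF f]) (unfold d, rule AE_return_eq)
    then have "(\<integral>\<^sup>+ z. ennreal (state_cost A1 (fst z) (snd z)) \<partial>\<pi>) = (\<integral>\<^sup>+ z. ennreal ((norm (snd z))\<^sup>2) \<partial>\<pi>)"
      by (intro nn_integral_cong_AE) (auto simp: state_cost_mat_1)
    also have "\<dots> = (\<integral>\<^sup>+ x. ennreal ((norm x)\<^sup>2) \<partial>P)"
      unfolding d(2)[symmetric] by (subst nn_integral_distr) auto
    finally show "(\<integral>\<^sup>+ x. ennreal ((norm x)\<^sup>2) \<partial>P) \<le> (\<integral>\<^sup>+ z. ennreal (state_cost A1 (fst z) (snd z)) \<partial>\<pi>)" by simp
  qed
  also have "\<dots> \<le> 1" using P by (simp add: transport_ball_def)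
  finally show ?thesis .
qed

text \<open>Moving mass \<open>1/n\<^sup>2\<close> to \<open>n b\<close> uses the whole transport budget and recovers all but \<open>O(1/n)\<close> of it.\<close>
lemma pinched_supremum_ge:
  assumes n: "1 \<le> n"
  shows "ereal (1 - 2 / real n) \<le> (SUP Q\<in>transport_ball 1 P0d A1. expected_loss pinched_square b Q)"
proof -
  define p where "p = 1 / (real n)\<^sup>2"
  have p: "0 \<le> p" "p \<le> 1" using n by (auto simp: p_def divide_le_eq_1)
  define Y where "Y c = (if c then real n *\<^sub>R b else 0)" for c
  define Q where "Q = distr (measure_pmf (bernoulli_pmf p)) borel Y"
  define \<pi> where "\<pi> = distr (measure_pmf (bernoulli_pmf p)) borel (\<lambda>c. (0 :: real^'n, Y c))"
  have [measurable]: "(fst :: (real^'n) \<times> (real^'n) \<Rightarrow> _) \<in> borel_measurable borel" "(snd :: (real^'n) \<times> (real^'n) \<Rightarrow> _) \<in> borel_measurable borel"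
    by (intro borel_measurable_continuous_onI continuous_intros)+
  have "distr (measure_pmf (bernoulli_pmf p)) borel (\<lambda>c. 0 :: real^'n) = P0d"
    by (rule measure_pmf.distr_const) simp
  then have "\<pi> \<in> couplings P0d Q"
    unfolding couplings_def \<pi>_def Q_def
    by (auto simp: distr_distr comp_def intro: measure_pmf.prob_space_distr)
  then have "transport_cost A1 P0d Q \<le> (\<integral>\<^sup>+ z. ennreal (state_cost A1 (fst z) (snd z)) \<partial>\<pi>)"
    unfolding transport_cost_def by (rule INF_lower)
  also have "\<dots> = (\<integral>\<^sup>+ c. ennreal ((norm (Y c))\<^sup>2) \<partial>measure_pmf (bernoulli_pmf p))"
    unfolding \<pi>_def state_cost_mat_1 by (subst nn_integral_distr) auto
  also have "\<dots> = ennreal ((norm (Y True))\<^sup>2) * ennreal p"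
    using p by (simp add: nn_integral_bernoulli_pmf Y_def)
  also have "\<dots> = ennreal 1" using n p b by (simp add: Y_def p_def ennreal_mult[symmetric] power2_eq_square)
  finally have ball: "Q \<in> transport_ball 1 P0d A1"
    unfolding transport_ball_def Q_def by (auto intro: measure_pmf.prob_space_distr)
  have lm [measurable]: "pinched_square \<in> borel_measurable borel" unfolding pinched_square_def[abs_def] by measurable
  have "expected_loss pinched_square b Q = ereal (\<integral>x. pinched_square (b \<bullet> x) \<partial>Q)"
    unfolding expected_loss_def Q_def
    by (intro ext_expectation_AE_eq_integral AE_I2 refl)
      (auto simp: integrable_distr_eq intro: integrable_measure_pmf_finite)
  also have "(\<integral>x. pinched_square (b \<bullet> x) \<partial>Q) = pinched_square n * p"
    unfolding Q_def using p b by (subst integral_distr) (auto simp: Y_def pinched_square_def dot_square_norm)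
  finally have el: "expected_loss pinched_square b Q = ereal (pinched_square n * p)" .
  have "1 - 2 / real n = ((real n)\<^sup>2 - 2 * \<bar>real n\<bar>) * p" using n by (simp add: p_def power2_eq_square field_simps)
  also have "\<dots> \<le> pinched_square n * p" using p pinched_square_bounds(3) by (intro mult_right_mono)
  finally show ?thesis using SUP_upper2[OF ball, of _ "expected_loss pinched_square b"] el by simp
qed

lemma pinched_no_worst_case: "\<not> worst_case 1 P0d pinched_square A1 b P"
proof
  assume wc: "worst_case 1 P0d pinched_square A1 b P"
  then have P: "P \<in> transport_ball 1 P0d A1"
    and opt: "expected_loss pinched_square b P = (SUP Q\<in>transport_ball 1 P0d A1. expected_loss pinched_square b Q)"
    by (auto simp: worst_case_def)
  interpret P: prob_space P using P by (simp add: transport_ball_def)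
  have [measurable_cong]: "sets P = sets borel" using P by (simp add: transport_ball_def)
  have [measurable]: "pinched_square \<in> borel_measurable borel" unfolding pinched_square_def[abs_def] by measurable
  have le: "pinched_square (b \<bullet> x) \<le> (b \<bullet> x)\<^sup>2" "(b \<bullet> x)\<^sup>2 \<le> (norm x)\<^sup>2" for x
    using pinched_square_bounds(2) Cauchy_Schwarz_ineq2[of b x] b by (auto simp: abs_le_square_iff[symmetric])
  have i2: "integrable P (\<lambda>x. (norm x)\<^sup>2)"
    by (rule integrableI_nonneg) (use pinched_transport_ball[OF P] in \<open>auto intro: le_less_trans\<close>)
  have n2: "(\<integral>x. (norm x)\<^sup>2 \<partial>P) \<le> 1"
    using pinched_transport_ball[OF P] nn_integral_eq_integral[OF i2] by (simp add: ennreal_le_1)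
  have il: "integrable P (\<lambda>x. pinched_square (b \<bullet> x))"
  proof (rule Bochner_Integration.integrable_bound[OF i2])
    show "AE x in P. norm (pinched_square (b \<bullet> x)) \<le> norm ((norm x)\<^sup>2)"
      using le pinched_square_bounds(1) by (auto intro: order_trans)
  qed measurable
  have el: "expected_loss pinched_square b P = ereal (\<integral>x. pinched_square (b \<bullet> x) \<partial>P)"
    unfolding expected_loss_def by (rule ext_expectation_AE_eq_integral[OF il]) simp
  have "1 - 2 / real n \<le> (\<integral>x. pinched_square (b \<bullet> x) \<partial>P)" if "1 \<le> n" for n
    using pinched_supremum_ge[OF that] unfolding opt[symmetric] el by simp
  moreover have "(\<lambda>n. 1 - 2 / real n) \<longlonglongrightarrow> 1 - 0"
    by (intro tendsto_diff tendsto_const lim_const_over_n)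
  ultimately have ge: "1 \<le> (\<integral>x. pinched_square (b \<bullet> x) \<partial>P)"
    using LIMSEQ_le_const2[of "\<lambda>n. 1 - 2 / real n" 1] by auto
  \<comment> \<open>The loss is at most \<open>(b \<bullet> x)\<^sup>2\<close>, hence at most
    \<open>(norm x)\<^sup>2\<close>; its integral is at least 1 and that of the last at most 1, so
    all three agree almost everywhere.\<close>
  have "0 = (\<integral>x. (norm x)\<^sup>2 - pinched_square (b \<bullet> x) \<partial>P)"
  proof (rule antisym)
    show "0 \<le> (\<integral>x. (norm x)\<^sup>2 - pinched_square (b \<bullet> x) \<partial>P)"
      using le by (intro Bochner_Integration.integral_nonneg) (auto intro: order_trans)
    show "(\<integral>x. (norm x)\<^sup>2 - pinched_square (b \<bullet> x) \<partial>P) \<le> 0" using i2 il n2 ge by simp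
  qed
  then have "AE x in P. (norm x)\<^sup>2 - pinched_square (b \<bullet> x) = 0"
    using i2 il le by (subst integral_nonneg_eq_0_iff_AE[symmetric]) (auto intro: order_trans)
  then have "AE x in P. pinched_square (b \<bullet> x) = 0"
  proof eventually_elim
    case (elim x)
    then have "pinched_square (b \<bullet> x) = (b \<bullet> x)\<^sup>2" using le[of x] by simp
    from pinched_square_eq_square[OF this] show ?case by (simp add: pinched_square_def)
  qed
  then have "(\<integral>x. pinched_square (b \<bullet> x) \<partial>P) = (\<integral>x. 0 \<partial>P)" by (intro integral_cong_AE) auto
  with ge show False by simp
qed

end

lemma threshold_without_worst_case:
  "\<exists>(B' :: (real^'n) set) \<delta>' P0' l' A' \<beta>' lam'.
        dro_setting B' \<delta>' P0' l' A' \<and> \<beta>' \<in> B' \<and> \<beta>' \<noteq> 0 \<and>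
        dual_optimizer \<delta>' P0' l' A' \<beta>' lam' \<and>
        ereal lam' = lambda_thr \<delta>' P0' l' A' \<beta>' \<and>
        (\<nexists>P. worst_case \<delta>' P0' l' A' \<beta>' P)"
proof -
  obtain b :: "real^'n" where b: "norm b = 1" using vector_choose_size[of 1] by auto
  show ?thesis
    using pinched_dro_setting[OF b] pinched_dual_optimizer[OF b] pinched_lambda_thr[OF b] pinched_no_worst_case[OF b] b
    by (intro exI[of _ "{b}"] exI[of _ 1] exI[of _ "return borel 0"] exI[of _ pinched_square]
        exI[of _ "\<lambda>_. mat 1"] exI[of _ b]) (auto simp: one_ereal_def)
qed

subsection \<open>The dual optimizer and the threshold\<close>

lemma growth_rate_le:
  assumes "0 \<le> r" "\<And>u. l u \<le> C + r * u\<^sup>2"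
  shows "growth_rate l \<le> ereal r"
proof -
  have "(SUP u. ereal (l u - r * u\<^sup>2)) \<le> ereal C"
    by (intro SUP_least) (use assms(2) in \<open>simp add: algebra_simps\<close>)
  also have "ereal C < \<infinity>" by simp
  finally show ?thesis unfolding growth_rate_def using assms(1) by (intro INF_lower) auto
qed

text \<open>The affine minorant of \<open>m * u\<^sup>2 - l u\<close> leaves a linear term, which
  any rate above \<open>m\<close> absorbs. Consequently \<open>lambda_thr'\<close> dominates
  \<open>lambda_thr\<close>, and all results above the latter apply in the twice differentiable
  case.\<close>

lemma growth_rate_le_semiconcave:
  assumes m: "0 \<le> m" and semi: "convex_on UNIV (\<lambda>u. m * u\<^sup>2 - l u)"
  shows "growth_rate l \<le> ereal m"
proof (rule dense_ge)
  fix y assume "ereal m < y"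
  then obtain r where r: "m < r" "ereal r \<le> y"
    by (metis ereal_dense2 ereal_less(2) less_ereal.simps(1) less_imp_le)
  obtain a b where ab: "\<And>u. a + b * u \<le> m * u\<^sup>2 - l u" using convex_on_affine_minorant[OF semi] by metis
  have "l u \<le> (b\<^sup>2 / (4 * (r - m)) - a) + r * u\<^sup>2" for u
  proof -
    have "0 \<le> (2 * (r - m) * u + b)\<^sup>2 / (4 * (r - m))" using r by simp
    also have "\<dots> = (r - m) * u\<^sup>2 + b * u + b\<^sup>2 / (4 * (r - m))"
      using r by (simp add: power2_eq_square field_simps)
    finally show ?thesis using ab[of u] by (simp add: algebra_simps)
  qed
  then have "growth_rate l \<le> ereal r" using r m by (intro growth_rate_le) auto
  with r(2) show "growth_rate l \<le> y" by (rule order_trans[rotated])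
qed

text \<open>Substituting \<open>v = \<beta> \<bullet> x + \<gamma> * sqrt \<delta> * inv_quad A
  \<beta> x\<close> turns the inner problem into the growth of \<open>l v\<close> against a parabola
  centred at \<open>\<beta> \<bullet> x\<close>.\<close>

lemma loss_rob_infinite:
  assumes \<delta>: "0 < \<delta>" and k: "0 < inv_quad A \<beta> x"
    and unb: "\<And>c. \<exists>v. c < l v - lam / (sqrt \<delta> * inv_quad A \<beta> x) * (v - \<beta> \<bullet> x)\<^sup>2"
  shows "loss_rob \<delta> l A \<beta> lam x = \<infinity>"
  unfolding loss_rob_def
proof (rule SUP_PInfty)
  fix n :: nat
  define s where "s = sqrt \<delta>"
  define q where "q = inv_quad A \<beta> x"
  have s: "0 < s" "0 < q" using \<delta> k by (auto simp: s_def q_def)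
  obtain v where v: "real n - lam * s < l v - lam / (s * q) * (v - \<beta> \<bullet> x)\<^sup>2"
    using unb unfolding s_def q_def by blast
  define \<gamma> where "\<gamma> = (v - \<beta> \<bullet> x) / (s * q)"
  have "\<beta> \<bullet> x + \<gamma> * s * q = v" using s by (simp add: \<gamma>_def)
  moreover have "lam * s * (\<gamma>\<^sup>2 * q - 1) = lam / (s * q) * (v - \<beta> \<bullet> x)\<^sup>2 - lam * s"
    using s by (simp add: \<gamma>_def power2_eq_square field_simps)
  ultimately have "dual_F \<delta> l A \<gamma> \<beta> lam x = l v - (lam / (s * q) * (v - \<beta> \<bullet> x)\<^sup>2 - lam * s)"
    unfolding dual_F_def s_def[symmetric] q_def[symmetric] by simp
  with v show "\<exists>\<gamma>\<in>UNIV. ereal (real n) \<le> ereal (dual_F \<delta> l A \<gamma> \<beta> lam x)"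
    by (intro bexI[of _ \<gamma>]) auto
qed

text \<open>A rate \<open>r\<close> strictly between \<open>a\<close> and the growth rate absorbs
  the cross term created by centring the parabola at \<open>u\<close>.\<close>

lemma growth_rate_unbounded_shift:
  assumes a: "0 \<le> a" "ereal a < growth_rate l"
  shows "\<exists>v. c < l v - a * (v - u)\<^sup>2"
proof -
  obtain r where r: "a < r" "ereal r < growth_rate l"
    using ereal_dense2[OF a(2)] by auto
  obtain v where v: "(c + a * u\<^sup>2 + a\<^sup>2 * u\<^sup>2 / (r - a)) + r * v\<^sup>2 < l v"
    using growth_rate_unbounded[OF _ r(2)] r a by fastforce
  have "0 \<le> ((r - a) * v + a * u)\<^sup>2 / (r - a)" using r by simp
  also have "\<dots> = (r - a) * v\<^sup>2 + 2 * a * u * v + a\<^sup>2 * u\<^sup>2 / (r - a)"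
    using r by (simp add: power2_eq_square field_simps)
  finally have "a * (v - u)\<^sup>2 \<le> a * u\<^sup>2 + a\<^sup>2 * u\<^sup>2 / (r - a) + r * v\<^sup>2"
    by (simp add: power2_eq_square algebra_simps)
  with v show ?thesis by (intro exI[of _ v]) simp
qed

lemma worst_case_constant:
  assumes "l constant_on UNIV" and P: "P \<in> transport_ball \<delta> P0 A"
  shows "worst_case \<delta> P0 l A \<beta> P"
proof -
  obtain c where c: "\<And>u. l u = c" using assms(1) by (auto simp: constant_on_def)
  have "expected_loss l \<beta> Q = ereal c" if "Q \<in> transport_ball \<delta> P0 A" for Q
  proof -
    interpret prob_space Q using that by (simp add: transport_ball_def)
    show ?thesis unfolding expected_loss_def c
      by (subst ext_expectation_AE_eq_integral[of _ "\<lambda>_. c"]) (auto simp: prob_space)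
  qed
  then show ?thesis unfolding worst_case_def using P by (metis (mono_tags, lifting) SUP_cong SUP_const empty_iff)
qed

text \<open>\<open>K\<close> is the essential supremum itself, not the cruder bound from the
  eigenvalues, because the thresholds are expressed through it. The lower bound \<open>k1\<close>
  stays adjustable so that individual points can be made good.\<close>

lemma dro_setting_obtain:
  fixes A :: "real^'n \<Rightarrow> real^'n^'n"
  assumes setting: "dro_setting B \<delta> P0 l A" and \<beta>: "\<beta> \<noteq> 0"
  obtains k0 K \<kappa> \<rho> where "0 < k0" "k0 \<le> K" "AE x in P0. k0 \<le> inv_quad A \<beta> x \<and> inv_quad A \<beta> x \<le> K"
    "esssup P0 (\<lambda>x. ereal (inv_quad A \<beta> x)) = ereal K" "growth_rate l = ereal \<kappa>" "0 \<le> \<kappa>"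
    "0 < \<rho>" "AE x in P0. \<forall>v. norm v = 1 \<longrightarrow> \<rho> \<le> v \<bullet> (A x *v v)"
    "\<And>k1 r lam0. 0 < k1 \<Longrightarrow> k1 \<le> k0 \<Longrightarrow> \<kappa> < r \<Longrightarrow> r * sqrt \<delta> * K < lam0 \<Longrightarrow>
      \<exists>C. growth_bounded_dual \<delta> P0 l A \<beta> k1 K C r lam0"
proof -
  have P0: "prob_space P0" and sP0: "sets P0 = sets borel" and \<delta>: "0 < \<delta>" and spd: "\<And>x. sym_pos_def (A x)"
    and lsc: "lower_semicont (\<lambda>(x, x'). state_cost A x x')" and conv: "convex_on UNIV l"
    and gr: "growth_rate l < \<infinity>" and m4: "integrable P0 (\<lambda>x. norm x ^ 4)"
    using setting unfolding dro_setting_def by auto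
  interpret prob_space P0 by (rule P0)
  obtain \<rho> \<rho>' where \<rho>: "0 < \<rho>" "0 < \<rho>'"
    "AE x in P0. \<forall>v. norm v = 1 \<longrightarrow> \<rho> \<le> v \<bullet> (A x *v v) \<and> v \<bullet> (A x *v v) \<le> \<rho>'"
    using setting unfolding dro_setting_def by blast
  define k0 where "k0 = (norm \<beta>)\<^sup>2 / \<rho>'"
  have k0: "0 < k0" using \<beta> \<rho> by (simp add: k0_def)
  have AEk: "AE x in P0. k0 \<le> inv_quad A \<beta> x \<and> inv_quad A \<beta> x \<le> (norm \<beta>)\<^sup>2 / \<rho>"
    using \<rho>(3)
  proof eventually_elim
    case (elim x)
    then show ?case unfolding k0_def using \<rho>(1,2)
      by (intro conjI inv_quad_ge[OF spd] inv_quad_le[OF spd]) auto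
  qed
  let ?E = "esssup P0 (\<lambda>x. ereal (inv_quad A \<beta> x))"
  note [measurable] = inv_quad_measurable[OF lsc spd]
  have km: "(\<lambda>x. ereal (inv_quad A \<beta> x)) \<in> borel_measurable P0"
    using sP0 by (simp cong: measurable_cong_sets)
  have "?E \<le> ereal ((norm \<beta>)\<^sup>2 / \<rho>)" using AEk by (intro esssup_I[OF km]) auto
  moreover have "ereal k0 \<le> ?E"
  proof -
    have "AE x in P0. ereal k0 \<le> ?E" using AEk esssup_AE[of "\<lambda>x. ereal (inv_quad A \<beta> x)" P0]
    proof eventually_elim
      case (elim x)
      then have "ereal k0 \<le> ereal (inv_quad A \<beta> x)" by simp
      then show ?case using elim(2) by (rule order_trans)
    qed
    then show ?thesis by simp
  qed
  ultimately obtain K where K: "?E = ereal K" "k0 \<le> K" by (cases ?E) auto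
  have AEK: "AE x in P0. k0 \<le> inv_quad A \<beta> x \<and> inv_quad A \<beta> x \<le> K"
    using AEk esssup_AE[of "\<lambda>x. ereal (inv_quad A \<beta> x)" P0] unfolding K(1) by eventually_elim auto
  obtain \<kappa> where \<kappa>: "growth_rate l = ereal \<kappa>" "0 \<le> \<kappa>"
    using gr growth_rate_nonneg[of l] by (cases "growth_rate l") auto
  have m2: "integrable P0 (\<lambda>x. (norm x)\<^sup>2)"
  proof (rule Bochner_Integration.integrable_bound[of _ "\<lambda>x. 1 + norm x ^ 4"])
    show "integrable P0 (\<lambda>x. 1 + norm x ^ 4)" using m4 by simp
    have "(norm x)\<^sup>2 \<le> 1 + norm x ^ 4" for x :: "real^'n"
    proof -
      have "0 \<le> ((norm x)\<^sup>2 - 1)\<^sup>2 + (norm x)\<^sup>2 * (norm x)\<^sup>2 + 1" by simp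
      then show ?thesis by (simp add: power2_eq_square power4_eq_xxxx algebra_simps)
    qed
    then show "AE x in P0. norm ((norm x)\<^sup>2) \<le> norm (1 + norm x ^ 4)" by simp
  qed (use sP0 in \<open>simp cong: measurable_cong_sets\<close>)
  show ?thesis
  proof (rule that[OF k0 K(2) AEK K(1) \<kappa> \<rho>(1)])
    show "AE x in P0. \<forall>v. norm v = 1 \<longrightarrow> \<rho> \<le> v \<bullet> (A x *v v)" using \<rho>(3) by auto
    fix k1 r lam0 assume a: "0 < k1" "k1 \<le> k0" "\<kappa> < r" "r * sqrt \<delta> * K < lam0"
    obtain C where C: "\<And>u. l u \<le> C + r * u\<^sup>2" using growth_rate_bound[of l r] \<kappa> a(3) by auto
    have "growth_bounded_dual \<delta> P0 l A \<beta> k1 K C r lam0"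
      by unfold_locales (use \<delta> P0 sP0 spd lsc conv \<beta> m2 a K(2) \<kappa> C AEK in auto)
    then show "\<exists>C. growth_bounded_dual \<delta> P0 l A \<beta> k1 K C r lam0" ..
  qed
qed

text \<open>The mixture of infimum and supremum is treated on every space that carries a mixing
  variable with the prescribed probability; such a variable can fail to exist, as the two second
  moments need not straddle 1. Those of the extremal moduli always do, and for them a space is
  exhibited. Uniqueness of the maximiser is claimed where \<open>inv_quad A \<beta> x\<close> stays
  within its essential supremum, the region that the threshold controls.\<close>

theorem theorem6:
  fixes B :: "(real^'n) set" and \<delta> :: real and P0 :: "(real^'n) measure"
    and l :: "real \<Rightarrow> real" and A :: "real^'n \<Rightarrow> real^'n^'n"
    and \<beta> :: "real^'n" and lam :: real
  assumes setting: "dro_setting B \<delta> P0 l A"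
    and beta: "\<beta> \<in> B" "\<beta> \<noteq> 0"
    and opt: "dual_optimizer \<delta> P0 l A \<beta> lam"
  shows
    "((\<not> l constant_on UNIV \<longrightarrow> 0 < lam) \<and>
      (l constant_on UNIV \<longrightarrow> (\<forall>P\<in>transport_ball \<delta> P0 A. worst_case \<delta> P0 l A \<beta> P))) \<and>
     (\<not> l constant_on UNIV \<longrightarrow> lambda_thr \<delta> P0 l A \<beta> \<le> ereal lam) \<and>
     (lambda_thr \<delta> P0 l A \<beta> < ereal lam \<longrightarrow>
        (\<exists>Gm \<in> borel_measurable borel. \<exists>Gp \<in> borel_measurable borel.
           (AE x in P0. Gm x = Inf (Gamma_star \<delta> l A \<beta> lam x)) \<and>
           (AE x in P0. Gp x = Sup (Gamma_star \<delta> l A \<beta> lam x)) \<and>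
           integrable P0 (\<lambda>x. (Gm x)\<^sup>2 * inv_quad A \<beta> x) \<and>
           integrable P0 (\<lambda>x. (Gp x)\<^sup>2 * inv_quad A \<beta> x) \<and>
           (\<forall>(M :: 'w measure) X Z G.
              bernoulli_mixing P0 A \<beta> Gm Gp M X Z \<and>
              G = (\<lambda>\<omega>. Z \<omega> * Gm (X \<omega>) + (1 - Z \<omega>) * Gp (X \<omega>)) \<longrightarrow>
              worst_case \<delta> P0 l A \<beta> (law_X_star \<delta> A \<beta> M X G) \<and>
              cost_X_star \<delta> A \<beta> M X G = ennreal \<delta>)) \<and>
        (\<exists>G1 \<in> borel_measurable borel. \<exists>G2 \<in> borel_measurable borel.
           (AE x in P0. G1 x \<in> Gamma_star \<delta> l A \<beta> lam x \<and> G2 x \<in> Gamma_star \<delta> l A \<beta> lam x \<and>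
              (\<forall>\<gamma>\<in>Gamma_star \<delta> l A \<beta> lam x. \<bar>G1 x\<bar> \<le> \<bar>\<gamma>\<bar> \<and> \<bar>\<gamma>\<bar> \<le> \<bar>G2 x\<bar>)) \<and>
           integrable P0 (\<lambda>x. (G1 x)\<^sup>2 * inv_quad A \<beta> x) \<and>
           integrable P0 (\<lambda>x. (G2 x)\<^sup>2 * inv_quad A \<beta> x) \<and>
           (\<exists>(M :: ((real^'n) \<times> real) measure) X Z G.
              bernoulli_mixing P0 A \<beta> G1 G2 M X Z \<and>
              G = (\<lambda>\<omega>. Z \<omega> * G1 (X \<omega>) + (1 - Z \<omega>) * G2 (X \<omega>)) \<and>
              worst_case \<delta> P0 l A \<beta> (law_X_star \<delta> A \<beta> M X G) \<and>
              cost_X_star \<delta> A \<beta> M X G = ennreal \<delta>))) \<and>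
     (\<exists>(B' :: (real^'n) set) \<delta>' P0' l' A' \<beta>' lam'.
        dro_setting B' \<delta>' P0' l' A' \<and> \<beta>' \<in> B' \<and> \<beta>' \<noteq> 0 \<and>
        dual_optimizer \<delta>' P0' l' A' \<beta>' lam' \<and>
        ereal lam' = lambda_thr \<delta>' P0' l' A' \<beta>' \<and>
        (\<nexists>P. worst_case \<delta>' P0' l' A' \<beta>' P)) \<and>
     (\<forall>M l1 l2.
        0 < M \<and>
        (\<forall>u. (l has_real_derivative l1 u) (at u)) \<and>
        (\<forall>u. (l1 has_real_derivative l2 u) (at u)) \<and>
        (\<forall>u. l2 u \<le> M) \<and>
        (\<forall>b\<in>B. \<not> (AE x in P0. l1 (b \<bullet> x) = 0)) \<and>
        lambda_thr' \<delta> P0 M A \<beta> < ereal lam \<longrightarrow>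
        (\<forall>x. ereal (inv_quad A \<beta> x) \<le> esssup P0 (\<lambda>y. ereal (inv_quad A \<beta> y)) \<longrightarrow>
             is_singleton (Gamma_star \<delta> l A \<beta> lam x)) \<and>
        (AE x in P0. is_singleton (Gamma_star \<delta> l A \<beta> lam x)) \<and>
        (\<exists>G \<in> borel_measurable borel.
           (AE x in P0. Gamma_star \<delta> l A \<beta> lam x = {G x}) \<and>
           (\<forall>P. worst_case \<delta> P0 l A \<beta> P \<longleftrightarrow> P = law_X_star \<delta> A \<beta> P0 (\<lambda>x. x) G) \<and>
           cost_X_star \<delta> A \<beta> P0 (\<lambda>x. x) G = ennreal \<delta>))"
proof -
  have P0: "prob_space P0" and sP0: "sets P0 = sets borel" and \<delta>: "0 < \<delta>" and spd: "\<And>x. sym_pos_def (A x)"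
    and lsc: "lower_semicont (\<lambda>(x, x'). state_cost A x x')" and conv: "convex_on UNIV l"
    using setting unfolding dro_setting_def by auto
  interpret P0: prob_space P0 by (rule P0)
  obtain k0 K \<kappa> \<rho> where k0: "0 < k0" "k0 \<le> K" and AEk: "AE x in P0. k0 \<le> inv_quad A \<beta> x \<and> inv_quad A \<beta> x \<le> K"
    and ess: "esssup P0 (\<lambda>x. ereal (inv_quad A \<beta> x)) = ereal K"
    and \<kappa>: "growth_rate l = ereal \<kappa>" "0 \<le> \<kappa>"
    and \<rho>: "0 < \<rho>" "AE x in P0. \<forall>v. norm v = 1 \<longrightarrow> \<rho> \<le> v \<bullet> (A x *v v)"
    and loc: "\<And>k1 r lam0. 0 < k1 \<Longrightarrow> k1 \<le> k0 \<Longrightarrow> \<kappa> < r \<Longrightarrow> r * sqrt \<delta> * K < lam0 \<Longrightarrow>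
      \<exists>C. growth_bounded_dual \<delta> P0 l A \<beta> k1 K C r lam0"
    by (rule dro_setting_obtain[OF setting beta(2)], rule that)
  have s: "0 < sqrt \<delta>" using \<delta> by simp
  have K: "0 < K" using k0 by simp
  have thr: "lambda_thr \<delta> P0 l A \<beta> = ereal (\<kappa> * sqrt \<delta> * K)" by (simp add: lambda_thr_def \<kappa> ess)
  have lam: "0 \<le> lam" using opt by (simp add: dual_optimizer_def is_arg_min_def)
  have k_pos: "0 < inv_quad A \<beta> x" for x by (rule inv_quad_pos[OF spd beta(2)])
  have k_meas: "(\<lambda>x. ereal (inv_quad A \<beta> x)) \<in> borel_measurable P0"
    using inv_quad_measurable[OF lsc spd, of \<beta>] sP0 by (simp cong: measurable_cong_sets)

  \<comment> \<open>Some multiplier above the threshold has a finite dual value, hence so has the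
    minimiser. The next two claims are proved by exhibiting an infinite value.\<close>
  have finite_dual: "dual_obj \<delta> P0 l A \<beta> lam \<noteq> \<infinity>"
  proof
    assume inf: "dual_obj \<delta> P0 l A \<beta> lam = \<infinity>"
    define r where "r = \<kappa> + 1"
    obtain C where "growth_bounded_dual \<delta> P0 l A \<beta> k0 K C r (r * sqrt \<delta> * K + 1)"
      using loc[of k0 r "r * sqrt \<delta> * K + 1"] k0 by (auto simp: r_def)
    then interpret growth_bounded_dual \<delta> P0 l A \<beta> k0 K C r "r * sqrt \<delta> * K + 1" .
    have "dual_obj \<delta> P0 l A \<beta> (r * sqrt \<delta> * K + 1) < dual_obj \<delta> P0 l A \<beta> lam"
      unfolding inf by (simp add: dual_obj_eq)
    moreover have "0 \<le> r * sqrt \<delta> * K + 1" using lam_pos[OF order_refl] by simp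
    ultimately show False using opt by (auto simp: dual_optimizer_def is_arg_min_def)
  qed

  have a: "0 < lam" if nc: "\<not> l constant_on UNIV"
  proof (rule ccontr)
    assume "\<not> 0 < lam"
    then have "lam = 0" using lam by simp
    then have "loss_rob \<delta> l A \<beta> lam x = \<infinity>" for x
      using convex_on_nonconstant_unbounded[OF conv nc] by (intro loss_rob_infinite[OF \<delta> k_pos]) simp
    then have "dual_obj \<delta> P0 l A \<beta> lam = \<infinity>"
      unfolding dual_obj_def by (intro ext_expectation_eq_infinity[of "space P0"]) (auto simp: P0.emeasure_space_1)
    with finite_dual show False ..
  qed

  have b: "lambda_thr \<delta> P0 l A \<beta> \<le> ereal lam"
  proof (rule ccontr)
    assume "\<not> lambda_thr \<delta> P0 l A \<beta> \<le> ereal lam"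
    then have lt: "lam < \<kappa> * sqrt \<delta> * K" by (simp add: thr)
    have "0 < \<kappa> * sqrt \<delta> * K" using lam lt by linarith
    then have \<kappa>0: "0 < \<kappa>" using \<kappa>(2) by (cases "\<kappa> = 0") auto
    \<comment> \<open>The level at which \<open>lam / (sqrt \<delta> * z) = \<kappa>\<close> when
      \<open>lam > 0\<close>; where \<open>inv_quad\<close> exceeds \<open>z\<close>, the penalty
      rate falls below the growth rate.\<close>
    define z where "z = lam / (\<kappa> * sqrt \<delta>)"
    have "z < K" using lt \<kappa>0 s by (simp add: z_def field_simps)
    define E where "E = {x \<in> space P0. ereal (inv_quad A \<beta> x) > ereal z}"
    have E: "E \<in> sets P0" unfolding E_def using k_meas by measurable
    have "emeasure P0 E > 0"
      unfolding E_def by (rule esssup_pos_measure[OF k_meas]) (use ess \<open>z < K\<close> in simp)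
    moreover have "loss_rob \<delta> l A \<beta> lam x = \<infinity>" if "x \<in> E" for x
    proof (rule loss_rob_infinite[OF \<delta> k_pos])
      have "z < inv_quad A \<beta> x" using that by (simp add: E_def)
      then have "lam / (sqrt \<delta> * inv_quad A \<beta> x) < \<kappa>"
        using \<kappa>0 s k_pos[of x] by (simp add: z_def field_simps)
      then show "\<exists>v. c < l v - lam / (sqrt \<delta> * inv_quad A \<beta> x) * (v - \<beta> \<bullet> x)\<^sup>2" for c
        using lam s k_pos[of x] \<kappa>(1) by (intro growth_rate_unbounded_shift) auto
    qed
    ultimately have "dual_obj \<delta> P0 l A \<beta> lam = \<infinity>"
      unfolding dual_obj_def by (intro ext_expectation_eq_infinity[OF E]) auto
    with finite_dual show False ..
  qed

  \<comment> \<open>Room is left on both sides: \<open>r\<close> above \<open>\<kappa>\<close> for a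
    genuine quadratic bound, \<open>lam0\<close> below \<open>lam\<close> for approaching
    \<open>lam\<close> from below.\<close>
  have dual: "\<exists>r lam0. lam0 < lam \<and> \<kappa> < r \<and> r * sqrt \<delta> * K < lam0" if "lambda_thr \<delta> P0 l A \<beta> < ereal lam"
  proof -
    have "\<kappa> < lam / (sqrt \<delta> * K)" using that s K by (simp add: thr field_simps)
    then obtain r where r: "\<kappa> < r" "r < lam / (sqrt \<delta> * K)" using dense by blast
    then have "r * sqrt \<delta> * K < lam" using s K by (simp add: field_simps)
    with r(1) show ?thesis using dense by blast
  qed

  have c: "(\<exists>Gm \<in> borel_measurable borel. \<exists>Gp \<in> borel_measurable borel.
           (AE x in P0. Gm x = Inf (Gamma_star \<delta> l A \<beta> lam x)) \<and>
           (AE x in P0. Gp x = Sup (Gamma_star \<delta> l A \<beta> lam x)) \<and>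
           integrable P0 (\<lambda>x. (Gm x)\<^sup>2 * inv_quad A \<beta> x) \<and>
           integrable P0 (\<lambda>x. (Gp x)\<^sup>2 * inv_quad A \<beta> x) \<and>
           (\<forall>(M :: 'w measure) X Z G.
              bernoulli_mixing P0 A \<beta> Gm Gp M X Z \<and>
              G = (\<lambda>\<omega>. Z \<omega> * Gm (X \<omega>) + (1 - Z \<omega>) * Gp (X \<omega>)) \<longrightarrow>
              worst_case \<delta> P0 l A \<beta> (law_X_star \<delta> A \<beta> M X G) \<and>
              cost_X_star \<delta> A \<beta> M X G = ennreal \<delta>)) \<and>
        (\<exists>G1 \<in> borel_measurable borel. \<exists>G2 \<in> borel_measurable borel.
           (AE x in P0. G1 x \<in> Gamma_star \<delta> l A \<beta> lam x \<and> G2 x \<in> Gamma_star \<delta> l A \<beta> lam x \<and>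
              (\<forall>\<gamma>\<in>Gamma_star \<delta> l A \<beta> lam x. \<bar>G1 x\<bar> \<le> \<bar>\<gamma>\<bar> \<and> \<bar>\<gamma>\<bar> \<le> \<bar>G2 x\<bar>)) \<and>
           integrable P0 (\<lambda>x. (G1 x)\<^sup>2 * inv_quad A \<beta> x) \<and>
           integrable P0 (\<lambda>x. (G2 x)\<^sup>2 * inv_quad A \<beta> x) \<and>
           (\<exists>(M :: ((real^'n) \<times> real) measure) X Z G.
              bernoulli_mixing P0 A \<beta> G1 G2 M X Z \<and>
              G = (\<lambda>\<omega>. Z \<omega> * G1 (X \<omega>) + (1 - Z \<omega>) * G2 (X \<omega>)) \<and>
              worst_case \<delta> P0 l A \<beta> (law_X_star \<delta> A \<beta> M X G) \<and>
              cost_X_star \<delta> A \<beta> M X G = ennreal \<delta>))"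
    if above: "lambda_thr \<delta> P0 l A \<beta> < ereal lam"
  proof -
    obtain r lam0 where rl: "lam0 < lam" "\<kappa> < r" "r * sqrt \<delta> * K < lam0" using dual[OF above] by blast
    obtain C where "growth_bounded_dual \<delta> P0 l A \<beta> k0 K C r lam0" using loc[OF k0(1) order_refl rl(2,3)] by blast
    then interpret growth_bounded_dual \<delta> P0 l A \<beta> k0 K C r lam0 .
    have lam0_le: "lam0 \<le> lam" using rl by simp
    have cm: "continuous_on UNIV (\<lambda>\<gamma>::real. - \<gamma>)" by (intro continuous_intros)
    define Gm where "Gm = select (\<lambda>\<gamma>. \<gamma>) lam"
    \<comment> \<open>The supremum as the negated infimum of the negated maximisers.\<close>
    define Gp where "Gp x = - select (\<lambda>\<gamma>. - \<gamma>) lam x" for x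
    have meas: "Gm \<in> borel_measurable borel" "Gp \<in> borel_measurable borel"
      unfolding Gm_def Gp_def[abs_def] using select_measurable[OF lam0_le cm] select_measurable[OF lam0_le continuous_on_id] by auto
    have Gm: "Gm x = Inf (\<Gamma> lam x)" "Gm x \<in> \<Gamma> lam x" if "x \<in> good" for x
      using that select_id_in_Gamma[OF lam0_le that] by (simp_all add: Gm_def select_def)
    have Gp: "Gp x = Sup (\<Gamma> lam x)" "Gp x \<in> \<Gamma> lam x" if "x \<in> good" for x
    proof -
      show "Gp x = Sup (\<Gamma> lam x)" using that by (simp add: Gp_def select_def Inf_real_def image_image)
      show "Gp x \<in> \<Gamma> lam x" using select_attained[OF lam0_le cm that] unfolding Gp_def by (metis minus_minus)
    qed
    have int: "integrable P0 (\<lambda>x. (Gm x)\<^sup>2 * inv_quad A \<beta> x)" "integrable P0 (\<lambda>x. (Gp x)\<^sup>2 * inv_quad A \<beta> x)"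
      using Gm Gp by (blast intro!: integrable_Gamma[OF lam0_le] meas)+
    have AE: "AE x in P0. Gm x = Inf (\<Gamma> lam x)" "AE x in P0. Gp x = Sup (\<Gamma> lam x)"
      "AE x in P0. Gm x \<in> \<Gamma> lam x" "AE x in P0. Gp x \<in> \<Gamma> lam x"
      using AE_good Gm Gp by auto
    have mix: "worst_case \<delta> P0 l A \<beta> (law_X_star \<delta> A \<beta> M X G) \<and> cost_X_star \<delta> A \<beta> M X G = ennreal \<delta>"
      if "bernoulli_mixing P0 A \<beta> Gm Gp M X Z \<and> G = (\<lambda>\<omega>. Z \<omega> * Gm (X \<omega>) + (1 - Z \<omega>) * Gp (X \<omega>))"
      for M :: "'w measure" and X Z G
      using worst_case_bernoulli_mixing[OF lam0_le meas AE(3,4) int] that by blast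
    obtain G1 G2 where G12: "G1 \<in> borel_measurable borel" "G2 \<in> borel_measurable borel"
      "\<And>x. x \<in> good \<Longrightarrow> G1 x \<in> \<Gamma> lam x" "\<And>x. x \<in> good \<Longrightarrow> G2 x \<in> \<Gamma> lam x"
      "\<And>x \<gamma>. x \<in> good \<Longrightarrow> \<gamma> \<in> \<Gamma> lam x \<Longrightarrow> \<bar>G1 x\<bar> \<le> \<bar>\<gamma>\<bar> \<and> \<bar>\<gamma>\<bar> \<le> \<bar>G2 x\<bar>"
      using abs_extremal_selections[OF lam0_le] by metis
    have int12: "integrable P0 (\<lambda>x. (G1 x)\<^sup>2 * inv_quad A \<beta> x)" "integrable P0 (\<lambda>x. (G2 x)\<^sup>2 * inv_quad A \<beta> x)"
      using G12(3,4) by (blast intro!: integrable_Gamma[OF lam0_le] G12(1,2))+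
    have AE12: "AE x in P0. G1 x \<in> \<Gamma> lam x \<and> G2 x \<in> \<Gamma> lam x \<and>
              (\<forall>\<gamma>\<in>\<Gamma> lam x. \<bar>G1 x\<bar> \<le> \<bar>\<gamma>\<bar> \<and> \<bar>\<gamma>\<bar> \<le> \<bar>G2 x\<bar>)"
      using AE_good by eventually_elim (use G12 in blast)
    have "second_moment P0 A \<beta> G1 \<le> 1" "1 \<le> second_moment P0 A \<beta> G2"
      unfolding second_moment_def
      using optimizer_min_second_moment[OF opt lam0_le G12(1,3)] optimizer_max_second_moment[OF opt rl(1) G12(2,4)] G12(5)
      by blast+
    then obtain M :: "((real^'n) \<times> real) measure" and X Z where M: "bernoulli_mixing P0 A \<beta> G1 G2 M X Z"
      using bernoulli_mixing_exists[OF P0 sP0] by blast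
    have "AE x in P0. G1 x \<in> \<Gamma> lam x" "AE x in P0. G2 x \<in> \<Gamma> lam x" using AE12 by auto
    note wc = worst_case_bernoulli_mixing[OF lam0_le G12(1,2) this int12 M refl]
    show ?thesis
    proof (intro conjI)
      show "\<exists>Gm \<in> borel_measurable borel. \<exists>Gp \<in> borel_measurable borel.
           (AE x in P0. Gm x = Inf (\<Gamma> lam x)) \<and> (AE x in P0. Gp x = Sup (\<Gamma> lam x)) \<and>
           integrable P0 (\<lambda>x. (Gm x)\<^sup>2 * k x) \<and> integrable P0 (\<lambda>x. (Gp x)\<^sup>2 * k x) \<and>
           (\<forall>(M :: 'w measure) X Z G.
              bernoulli_mixing P0 A \<beta> Gm Gp M X Z \<and>
              G = (\<lambda>\<omega>. Z \<omega> * Gm (X \<omega>) + (1 - Z \<omega>) * Gp (X \<omega>)) \<longrightarrow>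
              worst_case \<delta> P0 l A \<beta> (law_X_star \<delta> A \<beta> M X G) \<and>
              cost_X_star \<delta> A \<beta> M X G = ennreal \<delta>)"
        by (rule bexI[OF _ meas(1)], rule bexI[OF _ meas(2)], intro conjI AE(1,2) int, use mix in blast)
      show "\<exists>G1 \<in> borel_measurable borel. \<exists>G2 \<in> borel_measurable borel.
           (AE x in P0. G1 x \<in> \<Gamma> lam x \<and> G2 x \<in> \<Gamma> lam x \<and>
              (\<forall>\<gamma>\<in>\<Gamma> lam x. \<bar>G1 x\<bar> \<le> \<bar>\<gamma>\<bar> \<and> \<bar>\<gamma>\<bar> \<le> \<bar>G2 x\<bar>)) \<and>
           integrable P0 (\<lambda>x. (G1 x)\<^sup>2 * k x) \<and> integrable P0 (\<lambda>x. (G2 x)\<^sup>2 * k x) \<and>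
           (\<exists>(M :: ((real^'n) \<times> real) measure) X Z G.
              bernoulli_mixing P0 A \<beta> G1 G2 M X Z \<and>
              G = (\<lambda>\<omega>. Z \<omega> * G1 (X \<omega>) + (1 - Z \<omega>) * G2 (X \<omega>)) \<and>
              worst_case \<delta> P0 l A \<beta> (law_X_star \<delta> A \<beta> M X G) \<and>
              cost_X_star \<delta> A \<beta> M X G = ennreal \<delta>)"
        by (rule bexI[OF _ G12(1)], rule bexI[OF _ G12(2)], intro conjI AE12 int12, use M wc in blast)
    qed
  qed

  have e: "(\<forall>x. ereal (inv_quad A \<beta> x) \<le> esssup P0 (\<lambda>y. ereal (inv_quad A \<beta> y)) \<longrightarrow>
             is_singleton (Gamma_star \<delta> l A \<beta> lam x)) \<and>
        (AE x in P0. is_singleton (Gamma_star \<delta> l A \<beta> lam x)) \<and>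
        (\<exists>G \<in> borel_measurable borel.
           (AE x in P0. Gamma_star \<delta> l A \<beta> lam x = {G x}) \<and>
           (\<forall>P. worst_case \<delta> P0 l A \<beta> P \<longleftrightarrow> P = law_X_star \<delta> A \<beta> P0 (\<lambda>x. x) G) \<and>
           cost_X_star \<delta> A \<beta> P0 (\<lambda>x. x) G = ennreal \<delta>)"
    if M: "0 < M" and l1: "\<forall>u. (l has_real_derivative l1 u) (at u)"
      and l2: "\<forall>u. (l1 has_real_derivative l2 u) (at u)" "\<forall>u. l2 u \<le> M"
      and above': "lambda_thr' \<delta> P0 M A \<beta> < ereal lam" for M l1 l2
  proof -
    define m where "m = M / 2"
    have m: "0 \<le> m" using M by (simp add: m_def)
    have semi: "convex_on UNIV (\<lambda>u. m * u\<^sup>2 - l u)"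
    proof (rule f''_ge0_imp_convex)
      show "((\<lambda>u. m * u\<^sup>2 - l u) has_real_derivative M * u - l1 u) (at u)" for u
        using l1 by (auto intro!: derivative_eq_intros simp: m_def)
      show "((\<lambda>u. M * u - l1 u) has_real_derivative M - l2 u) (at u)" for u
        using l2(1) by (auto intro!: derivative_eq_intros)
      show "0 \<le> M - l2 u" for u using l2(2) by simp
    qed simp
    have m_lam: "m * sqrt \<delta> * K < lam" using above' by (simp add: lambda_thr'_def ess m_def)
    have "\<kappa> \<le> m" using growth_rate_le_semiconcave[OF m semi] \<kappa>(1) by simp
    then have "\<kappa> * sqrt \<delta> * K \<le> m * sqrt \<delta> * K" using s K by (intro mult_right_mono) auto
    then have "lambda_thr \<delta> P0 l A \<beta> < ereal lam" using m_lam by (simp add: thr)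
    then obtain r lam0 where rl: "lam0 < lam" "\<kappa> < r" "r * sqrt \<delta> * K < lam0" using dual by blast
    have lam0_le: "lam0 \<le> lam" using rl by simp
    have singleton: "is_singleton (Gamma_star \<delta> l A \<beta> lam x)" if "inv_quad A \<beta> x \<le> K" for x
    proof -
      \<comment> \<open>An arbitrary point with \<open>inv_quad\<close> at most \<open>K\<close> may
        violate the lower bound \<open>k0\<close>; lowering that bound makes this one point
        good.\<close>
      define k1 where "k1 = min k0 (inv_quad A \<beta> x)"
      have k1: "0 < k1" "k1 \<le> k0" using k0 k_pos by (auto simp: k1_def)
      obtain C where "growth_bounded_dual \<delta> P0 l A \<beta> k1 K C r lam0" using loc[OF k1 rl(2,3)] by blast
      then interpret L: growth_bounded_dual \<delta> P0 l A \<beta> k1 K C r lam0 .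
      have "x \<in> L.good" unfolding L.good_def using that by (simp add: k1_def)
      then obtain \<gamma> where \<gamma>: "\<gamma> \<in> L.\<Gamma> lam x"
        using L.select_id_in_Gamma[OF lam0_le] by blast
      then have "L.\<Gamma> lam x = {\<gamma>}" using L.Gamma_unique[OF semi m lam0_le m_lam that] by blast
      then show ?thesis by (auto simp: is_singleton_def)
    qed
    obtain C where "growth_bounded_dual \<delta> P0 l A \<beta> k0 K C r lam0" using loc[OF k0(1) order_refl rl(2,3)] by blast
    then interpret growth_bounded_dual \<delta> P0 l A \<beta> k0 K C r lam0 .
    define G where "G = select (\<lambda>\<gamma>. \<gamma>) lam"
    have Gmeas [measurable]: "G \<in> borel_measurable borel"
      unfolding G_def using select_measurable[OF lam0_le continuous_on_id] by simp
    have GG: "G x \<in> \<Gamma> lam x" if "x \<in> good" for x unfolding G_def by (rule select_id_in_Gamma[OF lam0_le that])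
    have uniq: "\<gamma> = G x" if "x \<in> good" "\<gamma> \<in> \<Gamma> lam x" for x \<gamma>
      using Gamma_unique[OF semi m lam0_le m_lam _ that(2) GG[OF that(1)]] that(1) by (simp add: good_def)
    have AE_in: "AE x in P0. G x \<in> \<Gamma> lam x" using AE_good GG by auto
    have AE_eq: "AE x in P0. \<Gamma> lam x = {G x}" using AE_good by eventually_elim (use GG uniq in blast)
    have int: "integrable P0 (\<lambda>x. (G x)\<^sup>2 * k x)"
      by (rule integrable_Gamma[OF lam0_le Gmeas]) (use GG in blast)
    have one: "(\<integral>x. (G x)\<^sup>2 * k x \<partial>P0) = 1"
    proof (rule antisym)
      show "(\<integral>x. (G x)\<^sup>2 * k x \<partial>P0) \<le> 1"
        by (rule optimizer_min_second_moment[OF opt lam0_le Gmeas GG]) (use uniq in auto)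
      show "1 \<le> (\<integral>x. (G x)\<^sup>2 * k x \<partial>P0)"
        by (rule optimizer_max_second_moment[OF opt rl(1) Gmeas GG]) (use uniq in auto)
    qed
    have X: "(\<lambda>x. x) \<in> borel_measurable P0" "G \<in> borel_measurable P0" "distr P0 borel (\<lambda>x. x) = P0"
      using sP0 by (simp_all add: distr_id2 cong: measurable_cong_sets)
    note wc = worst_case_law_X_star[OF lam0_le P0 X AE_in int one]
    have "P = law_X_star \<delta> A \<beta> P0 (\<lambda>x. x) G" if P: "worst_case \<delta> P0 l A \<beta> P" for P
    proof -
      have ball: "P \<in> transport_ball \<delta> P0 A" using P by (simp add: worst_case_def)
      \<comment> \<open>Both laws attain the supremum, and for the explicit one its value is known
        to be the dual value; so \<open>P\<close> closes the duality gap as well.\<close>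
      have "expected_loss l \<beta> P = expected_loss l \<beta> (law_X_star \<delta> A \<beta> P0 (\<lambda>x. x) G)"
        using P wc(1) by (simp add: worst_case_def)
      then have "integral\<^sup>L P0 (val lam) \<le> (\<integral>x. l (\<beta> \<bullet> x) \<partial>P)"
        unfolding wc(3) expected_loss_eq[OF ball] by simp
      then show ?thesis unfolding law_X_star_def
        by (rule worst_case_unique[OF semi m lam0_le m_lam Gmeas AE_in \<rho> ball])
    qed
    then have iff: "\<forall>P. worst_case \<delta> P0 l A \<beta> P \<longleftrightarrow> P = law_X_star \<delta> A \<beta> P0 (\<lambda>x. x) G" using wc(1) by blast
    have "AE x in P0. is_singleton (\<Gamma> lam x)" using AE_eq by eventually_elim simp
    moreover have "\<forall>x. ereal (inv_quad A \<beta> x) \<le> esssup P0 (\<lambda>y. ereal (inv_quad A \<beta> y)) \<longrightarrow> is_singleton (\<Gamma> lam x)"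
      using singleton by (simp add: ess)
    ultimately show ?thesis using Gmeas AE_eq iff wc(2) by blast
  qed

  show ?thesis
  proof (intro conjI)
    show "\<not> l constant_on UNIV \<longrightarrow> 0 < lam" using a by simp
    show "l constant_on UNIV \<longrightarrow> (\<forall>P\<in>transport_ball \<delta> P0 A. worst_case \<delta> P0 l A \<beta> P)"
      using worst_case_constant by blast
    show "\<not> l constant_on UNIV \<longrightarrow> lambda_thr \<delta> P0 l A \<beta> \<le> ereal lam" using b by simp
  qed ((rule impI, erule c) | rule threshold_without_worst_case | (intro allI impI, elim conjE, rule e; assumption))+
qed

end
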